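(* Let $p$ be an odd prime and let $r\in\mathbb{Z}_p^\times$ be an element that is not a root of unity. Then there is an isomorphism of C$^*$-algebras $$I_r\cong c_0(\mathbb{Z}_{\geq 0})\otimes\mathrm{BD}\big(\mathrm{ord}_{\mathbb{Z}_p^\times}(r)\big).$$
   Context: $\mathbb{Z}_p$ is the ring of $p$-adic integers and $\mathbb{Z}_p^\times$ its group of units. For $r\in\mathbb{Z}_p^\times$, let $(\alpha_rf)(x)=f(x/r)$ for $f\in C(\mathbb{Z}_p)$. The algebra $A_r=C(\mathbb{Z}_p)\rtimes_{\alpha_r}\mathbb{N}$ is the universal unital C$^*$-algebra generated by a (unital) copy $\{M_f:f\in C(\mathbb{Z}_p)\}$ of $C(\mathbb{Z}_p)$ and an element $V_r$ satisfying $V_r^*V_r=I$ and $V_rM_fV_r^*=M_{\alpha_r(f)}$. With $\{E_k\}_{k\in\mathbb{Z}}$ the canonical basis of $\ell^2(\mathbb{Z})$, let $\pi_0:A_r\to B(\ell^2(\mathbb{Z}))$ be the representation $V_r\mapsto v$, $vE_k=E_{k+1}$, and $M_f\mapsto m_f$, $m_fE_k=f(0)E_k$; the ideal is $I_r:=\mathrm{Ker}\,\pi_0$. $U_N$ denotes the group of units of $\mathbb{Z}/p^N\mathbb{Z}$, and $\mathrm{ord}_{U_N}(r)$ is the order of $r$ mod $p^N$ in $U_N$. $\mathrm{ord}_{\mathbb{Z}_p^\times}(r)$ is the supernatural number $\mathrm{lcm}\{\mathrm{ord}_{U_N}(r):N\geq 1\}$. For a supernatural number $S$, the Bunce-Deddens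 algebra $\mathrm{BD}(S)$ is the C$^*$-algebra of operators on $\ell^2(\mathbb{Z})$ generated by the bilateral shift $v$ and all diagonal operators $E_k\mapsto a(k)E_k$ with $a:\mathbb{Z}\to\mathbb{C}$ periodic with some period $l$ dividing $S$ ($l$ a positive integer). $c_0(\mathbb{Z}_{\geq 0})$ is the C$^*$-algebra of complex sequences converging to $0$. *)

theory Defs
  imports
    "HOL-Analysis.Analysis"
    "HOL-Library.Function_Algebras"
    "HOL-Library.Extended_Nat"
    "HOL-Number_Theory.Residues"
begin

section \<open>The Hilbert spaces of square-summable families\<close>

typedef 'i ell2 = "{x :: 'i \<Rightarrow> complex. (\<lambda>i. (cmod (x i))\<^sup>2) summable_on UNIV}"
  morphisms coord Abs_ell2
  by (rule exI[of _ "\<lambda>_. 0"]) simp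

setup_lifting type_definition_ell2

lemma ell2_ext: "(\<And>i. coord x i = coord y i) \<Longrightarrow> x = y"
  by (metis coord_inject ext)

lemma summable_coord: "(\<lambda>i. (cmod (coord x i))\<^sup>2) summable_on UNIV"
  using coord by blast

lemma square_summableI:
  assumes "\<And>F. finite F \<Longrightarrow> L2_set (\<lambda>i. cmod (f i)) F \<le> B"
  shows "(\<lambda>i. (cmod (f i))\<^sup>2) summable_on UNIV"
    and "sqrt (\<Sum>\<^sub>\<infinity>i. (cmod (f i))\<^sup>2) \<le> B"
proof -
  have B: "0 \<le> B"
    using assms[of "{}"] by simp
  have fin: "(\<Sum>i\<in>F. (cmod (f i))\<^sup>2) \<le> B\<^sup>2" if "finite F" for F
    using assms[OF that] B unfolding L2_set_def
    by (metis real_sqrt_le_iff real_sqrt_unique)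
  show s: "(\<lambda>i. (cmod (f i))\<^sup>2) summable_on UNIV"
    by (rule nonneg_bdd_above_summable_on) (auto intro!: bdd_aboveI2[where M = "B\<^sup>2"] fin)
  have "(\<Sum>\<^sub>\<infinity>i. (cmod (f i))\<^sup>2) \<le> B\<^sup>2"
    by (rule infsum_le_finite_sums[OF s]) (use fin in auto)
  then show "sqrt (\<Sum>\<^sub>\<infinity>i. (cmod (f i))\<^sup>2) \<le> B"
    using B real_le_lsqrt by blast
qed

lemma L2_set_le:
  assumes "(\<lambda>i. (cmod (f i))\<^sup>2) summable_on UNIV" "finite F"
  shows "L2_set (\<lambda>i. cmod (f i)) F \<le> sqrt (\<Sum>\<^sub>\<infinity>i. (cmod (f i))\<^sup>2)"
  unfolding L2_set_def using assms by (intro real_sqrt_le_mono finite_sum_le_infsum) auto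

lemma square_summable_add:
  assumes "(\<lambda>i. (cmod (f i))\<^sup>2) summable_on UNIV" "(\<lambda>i. (cmod (g i))\<^sup>2) summable_on UNIV"
  shows "(\<lambda>i. (cmod (f i + g i))\<^sup>2) summable_on UNIV"
    and "sqrt (\<Sum>\<^sub>\<infinity>i. (cmod (f i + g i))\<^sup>2)
      \<le> sqrt (\<Sum>\<^sub>\<infinity>i. (cmod (f i))\<^sup>2) + sqrt (\<Sum>\<^sub>\<infinity>i. (cmod (g i))\<^sup>2)"
proof -
  have "L2_set (\<lambda>i. cmod (f i + g i)) F
      \<le> sqrt (\<Sum>\<^sub>\<infinity>i. (cmod (f i))\<^sup>2) + sqrt (\<Sum>\<^sub>\<infinity>i. (cmod (g i))\<^sup>2)" if "finite F" for F
  proof -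
    have "L2_set (\<lambda>i. cmod (f i + g i)) F \<le> L2_set (\<lambda>i. cmod (f i) + cmod (g i)) F"
      by (intro L2_set_mono norm_triangle_ineq norm_ge_zero)
    also have "\<dots> \<le> L2_set (\<lambda>i. cmod (f i)) F + L2_set (\<lambda>i. cmod (g i)) F"
      by (rule L2_set_triangle_ineq)
    also have "\<dots> \<le> sqrt (\<Sum>\<^sub>\<infinity>i. (cmod (f i))\<^sup>2) + sqrt (\<Sum>\<^sub>\<infinity>i. (cmod (g i))\<^sup>2)"
      using assms that by (intro add_mono L2_set_le)
    finally show ?thesis .
  qed
  from square_summableI[OF this]
  show "(\<lambda>i. (cmod (f i + g i))\<^sup>2) summable_on UNIV"
    and "sqrt (\<Sum>\<^sub>\<infinity>i. (cmod (f i + g i))\<^sup>2)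
      \<le> sqrt (\<Sum>\<^sub>\<infinity>i. (cmod (f i))\<^sup>2) + sqrt (\<Sum>\<^sub>\<infinity>i. (cmod (g i))\<^sup>2)"
    by blast+
qed

lemma square_summable_scale:
  "(\<lambda>i. (cmod (f i))\<^sup>2) summable_on UNIV \<Longrightarrow> (\<lambda>i. (cmod (c * f i))\<^sup>2) summable_on UNIV"
  by (simp add: norm_mult power_mult_distrib summable_on_cmult_right)

class scaleC =
  fixes scaleC :: "complex \<Rightarrow> 'a \<Rightarrow> 'a"  (infixr \<open>*\<^sub>C\<close> 75)

class star =
  fixes star :: "'a \<Rightarrow> 'a"

instantiation ell2 :: (type) "{real_normed_vector, scaleC}"
begin

lift_definition zero_ell2 :: "'a ell2" is "\<lambda>_. 0"
  by simp

lift_definition plus_ell2 :: "'a ell2 \<Rightarrow> 'a ell2 \<Rightarrow> 'a ell2" is "\<lambda>x y i. x i + y i"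
  by (rule square_summable_add)

lift_definition uminus_ell2 :: "'a ell2 \<Rightarrow> 'a ell2" is "\<lambda>x i. - x i"
  by simp

lift_definition minus_ell2 :: "'a ell2 \<Rightarrow> 'a ell2 \<Rightarrow> 'a ell2" is "\<lambda>x y i. x i - y i"
  subgoal for f g
    using square_summable_add(1)[of f "\<lambda>i. - g i"] by simp
  done

lift_definition scaleC_ell2 :: "complex \<Rightarrow> 'a ell2 \<Rightarrow> 'a ell2" is "\<lambda>c x i. c * x i"
  by (rule square_summable_scale)

lift_definition scaleR_ell2 :: "real \<Rightarrow> 'a ell2 \<Rightarrow> 'a ell2" is "\<lambda>c x i. complex_of_real c * x i"
  by (rule square_summable_scale)

lift_definition norm_ell2 :: "'a ell2 \<Rightarrow> real" is "\<lambda>x. sqrt (\<Sum>\<^sub>\<infinity>i. (cmod (x i))\<^sup>2)" .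

definition sgn_ell2 :: "'a ell2 \<Rightarrow> 'a ell2"
  where "sgn_ell2 x = inverse (norm x) *\<^sub>R x"

definition dist_ell2 :: "'a ell2 \<Rightarrow> 'a ell2 \<Rightarrow> real"
  where "dist_ell2 x y = norm (x - y)"

definition uniformity_ell2 :: "('a ell2 \<times> 'a ell2) filter"
  where "uniformity_ell2 = (INF e\<in>{0<..}. principal {(x, y). dist x y < e})"

definition open_ell2 :: "'a ell2 set \<Rightarrow> bool"
  where "open_ell2 S = (\<forall>x\<in>S. \<forall>\<^sub>F (x', y) in uniformity. x' = x \<longrightarrow> y \<in> S)"

instance
proof
  fix a b :: real and x y z :: "'a ell2"
  show "x + y + z = x + (y + z)" by transfer (simp add: algebra_simps)
  show "x + y = y + x" by transfer (simp add: algebra_simps)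
  show "0 + x = x" by transfer simp
  show "- x + x = 0" by transfer simp
  show "x - y = x + - y" by transfer simp
  show "a *\<^sub>R (x + y) = a *\<^sub>R x + a *\<^sub>R y" by transfer (simp add: algebra_simps)
  show "(a + b) *\<^sub>R x = a *\<^sub>R x + b *\<^sub>R x" by transfer (simp add: algebra_simps)
  show "a *\<^sub>R b *\<^sub>R x = (a * b) *\<^sub>R x" by transfer (simp add: algebra_simps)
  show "1 *\<^sub>R x = x" by transfer simp
  show "dist x y = norm (x - y)" by (rule dist_ell2_def)
  show "sgn x = inverse (norm x) *\<^sub>R x" by (rule sgn_ell2_def)
  show "(uniformity :: ('a ell2 \<times> 'a ell2) filter) = (INF e\<in>{0<..}. principal {(x, y). dist x y < e})"
    by (rule uniformity_ell2_def)
  show "open S = (\<forall>x\<in>S. \<forall>\<^sub>F (x', y) in uniformity. x' = x \<longrightarrow> y \<in> S)" for S :: "'a ell2 set"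
    by (rule open_ell2_def)
  show "norm x = 0 \<longleftrightarrow> x = 0"
  proof transfer
    fix x :: "'a \<Rightarrow> complex"
    assume x: "(\<lambda>i. (cmod (x i))\<^sup>2) summable_on UNIV"
    show "sqrt (\<Sum>\<^sub>\<infinity>i. (cmod (x i))\<^sup>2) = 0 \<longleftrightarrow> x = (\<lambda>_. 0)"
    proof
      assume "sqrt (\<Sum>\<^sub>\<infinity>i. (cmod (x i))\<^sup>2) = 0"
      then have "(cmod (x i))\<^sup>2 = 0" for i
        using x by (intro nonneg_infsum_le_0D[where A = UNIV and f = "\<lambda>i. (cmod (x i))\<^sup>2"]) auto
      then show "x = (\<lambda>_. 0)" by auto
    qed simp
  qed
  show "norm (x + y) \<le> norm x + norm y" by transfer (rule square_summable_add)
  show "norm (a *\<^sub>R x) = \<bar>a\<bar> * norm x"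
    by transfer (simp add: norm_mult power_mult_distrib infsum_cmult_right' real_sqrt_mult)
qed

end

lemmas coord_simps [simp] =
  zero_ell2.rep_eq plus_ell2.rep_eq uminus_ell2.rep_eq minus_ell2.rep_eq
  scaleC_ell2.rep_eq scaleR_ell2.rep_eq

lemma norm_scaleC_ell2: "norm (c *\<^sub>C x) = cmod c * norm x" for x :: "'i ell2"
  by transfer (simp add: norm_mult power_mult_distrib infsum_cmult_right' real_sqrt_mult)

lift_definition basis_vec :: "'i \<Rightarrow> 'i ell2" is "\<lambda>k i. if i = k then 1 else 0"
  subgoal for k
    by (rule square_summableI[where B = 1])
       (simp add: L2_set_def if_distrib[of cmod] if_distrib[of "\<lambda>t. t\<^sup>2"] cong: if_cong)
  done

definition cinner :: "'i ell2 \<Rightarrow> 'i ell2 \<Rightarrow> complex"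
  where "cinner x y = (\<Sum>\<^sub>\<infinity>i. cnj (coord x i) * coord y i)"


lemma coord_sum: "coord (\<Sum>i\<in>F. f i) k = (\<Sum>i\<in>F. coord (f i) k)"
  by (induction F rule: infinite_finite_induct) auto

lemma norm_coord_le: "cmod (coord x i) \<le> norm x"
  using L2_set_le[OF summable_coord, of "{i}" x] by (simp add: norm_ell2.rep_eq)

lemma cinner_abs_summable:
  "(\<lambda>i. norm (cnj (coord x i) * coord y i)) summable_on UNIV"
proof (rule summable_on_comparison_test)
  show "(\<lambda>i. (cmod (coord x i))\<^sup>2 + (cmod (coord y i))\<^sup>2) summable_on UNIV"
    by (intro summable_on_add summable_coord)
  fix i
  have "cmod (coord x i) * cmod (coord y i) \<le> (cmod (coord x i))\<^sup>2 + (cmod (coord y i))\<^sup>2"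
    using sum_squares_bound[of "cmod (coord x i)" "cmod (coord y i)"]
      mult_nonneg_nonneg[OF norm_ge_zero[of "coord x i"] norm_ge_zero[of "coord y i"]]
    by linarith
  then show "norm (cnj (coord x i) * coord y i) \<le> (cmod (coord x i))\<^sup>2 + (cmod (coord y i))\<^sup>2"
    by (simp add: norm_mult)
qed auto

lemmas cinner_summable = abs_summable_summable[OF cinner_abs_summable]

lemma cinner_add_left: "cinner (x + y) z = cinner x z + cinner y z"
  by (simp add: cinner_def infsum_add cinner_summable distrib_right)

lemma cinner_scaleC_left: "cinner (c *\<^sub>C x) y = cnj c * cinner x y"
  by (simp add: cinner_def infsum_cmult_right'[symmetric] mult.assoc)

lemma cinner_commute: "cinner x y = cnj (cinner y x)"
  by (simp add: cinner_def infsum_cnj[symmetric] mult.commute)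

lemma cinner_add_right: "cinner x (y + z) = cinner x y + cinner x z"
  by (simp add: cinner_def infsum_add cinner_summable distrib_left)

lemma cinner_scaleC_right: "cinner x (c *\<^sub>C y) = c * cinner x y"
  by (simp add: cinner_def infsum_cmult_right'[symmetric] mult_ac)

lemma cinner_bound: "cmod (cinner x y) \<le> norm x * norm y"
proof -
  have "cmod (cinner x y) \<le> (\<Sum>\<^sub>\<infinity>i. cmod (cnj (coord x i) * coord y i))"
    unfolding cinner_def by (rule norm_infsum_bound[OF cinner_abs_summable])
  also have "\<dots> \<le> norm x * norm y"
  proof (rule infsum_le_finite_sums[OF cinner_abs_summable])
    fix F :: "'a set" assume F: "finite F"
    have "(\<Sum>i\<in>F. cmod (cnj (coord x i) * coord y i))
        \<le> L2_set (\<lambda>i. cmod (coord x i)) F * L2_set (\<lambda>i. cmod (coord y i)) F"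
      using L2_set_mult_ineq[of "\<lambda>i. cmod (coord x i)" "\<lambda>i. cmod (coord y i)" F]
      by (simp add: norm_mult)
    also have "\<dots> \<le> norm x * norm y"
      unfolding norm_ell2.rep_eq
      by (intro mult_mono L2_set_le summable_coord F) (auto intro!: infsum_nonneg)
    finally show "(\<Sum>i\<in>F. cmod (cnj (coord x i) * coord y i)) \<le> norm x * norm y" .
  qed
  finally show ?thesis .
qed

lemma cinner_basis_left: "cinner (basis_vec k) y = coord y k"
proof -
  have "cinner (basis_vec k) y = (\<Sum>\<^sub>\<infinity>i\<in>{k}. coord y i)"
    unfolding cinner_def by (rule infsum_cong_neutral) (auto simp: basis_vec.rep_eq)
  then show ?thesis by simp
qed

lemma norm_basis_vec [simp]: "norm (basis_vec k) = 1"
proof -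
  have "(\<Sum>\<^sub>\<infinity>i. (cmod (coord (basis_vec k) i))\<^sup>2) = (\<Sum>\<^sub>\<infinity>i\<in>{k}. (1::real))"
    by (rule infsum_cong_neutral) (auto simp: basis_vec.rep_eq)
  then show ?thesis by (simp add: norm_ell2.rep_eq)
qed

lemma scaleC_add_right_ell2: "c *\<^sub>C (x + y) = c *\<^sub>C x + c *\<^sub>C y" for x y :: "'i ell2"
  by transfer (simp add: algebra_simps)

lemma scaleC_scaleC_ell2: "c *\<^sub>C d *\<^sub>C x = (c * d) *\<^sub>C x" for x :: "'i ell2"
  by transfer (simp add: algebra_simps)

lemma scaleR_eq_scaleC: "r *\<^sub>R x = complex_of_real r *\<^sub>C x" for x :: "'i ell2"
  by transfer simp

lemma basis_expansion: "((\<lambda>i. coord x i *\<^sub>C basis_vec i) has_sum x) UNIV"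
  unfolding has_sum_def
proof (rule tendstoI)
  fix e :: real assume e: "0 < e"
  let ?f = "\<lambda>i. (cmod (coord x i))\<^sup>2"
  have "(sum ?f \<longlongrightarrow> infsum ?f UNIV) (finite_subsets_at_top UNIV)"
    using has_sum_infsum[OF summable_coord[of x]] by (simp add: has_sum_def)
  then have "\<forall>\<^sub>F F in finite_subsets_at_top UNIV. dist (sum ?f F) (infsum ?f UNIV) < e\<^sup>2"
    using e by (intro tendstoD) auto
  moreover have "\<forall>\<^sub>F F :: 'a set in finite_subsets_at_top UNIV. finite F"
    by (rule eventually_finite_subsets_at_top_weakI) simp
  ultimately show "\<forall>\<^sub>F F in finite_subsets_at_top UNIV. dist (\<Sum>i\<in>F. coord x i *\<^sub>C basis_vec i) x < e"
  proof eventually_elim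
    case (elim F)
    have c: "coord ((\<Sum>i\<in>F. coord x i *\<^sub>C basis_vec i) - x) k = (if k \<in> F then 0 else - coord x k)" for k
      using elim by (simp add: coord_sum basis_vec.rep_eq if_distrib cong: if_cong)
    have "(\<Sum>\<^sub>\<infinity>k. (cmod (if k \<in> F then 0 else - coord x k))\<^sup>2) = infsum ?f (UNIV - F)"
      by (rule infsum_cong_neutral) auto
    also have "\<dots> = infsum ?f UNIV - sum ?f F"
      using elim by (subst infsum_Diff) (auto simp: summable_coord)
    also have "\<dots> < e\<^sup>2"
      using elim by (simp add: dist_real_def)
    finally have "sqrt (\<Sum>\<^sub>\<infinity>k. (cmod (if k \<in> F then 0 else - coord x k))\<^sup>2) < sqrt (e\<^sup>2)"
      by (rule real_sqrt_less_mono)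
    then show ?case
      using e by (simp add: dist_norm norm_ell2.rep_eq c del: coord_simps)
  qed
qed


lift_definition tensor_vec :: "'i ell2 \<Rightarrow> 'j ell2 \<Rightarrow> ('i \<times> 'j) ell2"
  is "\<lambda>x y (i, j). x i * y j"
  subgoal for x y
  proof (rule square_summableI(1))
    fix F :: "('i \<times> 'j) set"
    assume F: "finite F"
    let ?A = "fst ` F" and ?B = "snd ` F"
    have "F \<subseteq> ?A \<times> ?B" by (rule subset_fst_snd)
    then have "(\<Sum>k\<in>F. (cmod (case k of (i, j) \<Rightarrow> x i * y j))\<^sup>2)
        \<le> (\<Sum>k\<in>?A \<times> ?B. (cmod (case k of (i, j) \<Rightarrow> x i * y j))\<^sup>2)"
      using F by (intro sum_mono2) auto
    also have "\<dots> = (\<Sum>i\<in>?A. (cmod (x i))\<^sup>2) * (\<Sum>j\<in>?B. (cmod (y j))\<^sup>2)"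
      by (simp add: sum_product sum.cartesian_product case_prod_unfold norm_mult power_mult_distrib)
    finally have "L2_set (\<lambda>k. cmod (case k of (i, j) \<Rightarrow> x i * y j)) F
        \<le> L2_set (\<lambda>i. cmod (x i)) ?A * L2_set (\<lambda>j. cmod (y j)) ?B"
      unfolding L2_set_def real_sqrt_mult[symmetric] by (rule real_sqrt_le_mono)
    also assume "(\<lambda>i. (cmod (x i))\<^sup>2) summable_on UNIV" and "(\<lambda>j. (cmod (y j))\<^sup>2) summable_on UNIV"
    then have "L2_set (\<lambda>i. cmod (x i)) ?A * L2_set (\<lambda>j. cmod (y j)) ?B
        \<le> sqrt (\<Sum>\<^sub>\<infinity>i. (cmod (x i))\<^sup>2) * sqrt (\<Sum>\<^sub>\<infinity>j. (cmod (y j))\<^sup>2)"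
      using F by (intro mult_mono L2_set_le) (auto intro!: infsum_nonneg)
    finally show "L2_set (\<lambda>k. cmod (case k of (i, j) \<Rightarrow> x i * y j)) F
        \<le> sqrt (\<Sum>\<^sub>\<infinity>i. (cmod (x i))\<^sup>2) * sqrt (\<Sum>\<^sub>\<infinity>j. (cmod (y j))\<^sup>2)" .
  qed
  done

lift_definition permute_vec :: "('i \<Rightarrow> 'j) \<Rightarrow> 'j ell2 \<Rightarrow> 'i ell2"
  is "\<lambda>\<sigma> x i. if bij \<sigma> then x (\<sigma> i) else 0"
  subgoal for \<sigma> x
    using summable_on_reindex_bij_betw[of \<sigma> UNIV UNIV "\<lambda>i. (cmod (x i))\<^sup>2"] by (cases "bij \<sigma>") auto
  done

lemma coord_permute_vec: "bij \<sigma> \<Longrightarrow> coord (permute_vec \<sigma> x) i = coord x (\<sigma> i)"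
  by (simp add: permute_vec.rep_eq)

lemma norm_permute_vec: "bij \<sigma> \<Longrightarrow> norm (permute_vec \<sigma> x) = norm x"
  using infsum_reindex_bij_betw[of \<sigma> UNIV UNIV "\<lambda>i. (cmod (coord x i))\<^sup>2"]
  by (simp add: norm_ell2.rep_eq coord_permute_vec)

lemma coord_tensor_vec: "coord (tensor_vec x y) (i, j) = coord x i * coord y j"
  by (simp add: tensor_vec.rep_eq)

lemma basis_vec_Pair: "basis_vec (i, j) = tensor_vec (basis_vec i) (basis_vec j)"
  by (rule ell2_ext) (auto simp: tensor_vec.rep_eq basis_vec.rep_eq split: if_splits)

lemma L2_set_coord_le: "finite F \<Longrightarrow> L2_set (\<lambda>i. cmod (coord x i)) F \<le> norm x"
  unfolding norm_ell2.rep_eq by (rule L2_set_le[OF summable_coord])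

lift_definition row_vec :: "('i \<times> 'j) ell2 \<Rightarrow> 'i \<Rightarrow> 'j ell2" is "\<lambda>z i j. z (i, j)"
  subgoal for z i
  proof (rule square_summableI(1))
    fix F :: "'j set"
    assume z: "(\<lambda>k. (cmod (z k))\<^sup>2) summable_on UNIV" and F: "finite F"
    have "L2_set (\<lambda>j. cmod (z (i, j))) F = L2_set (\<lambda>k. cmod (z k)) (Pair i ` F)"
      by (simp add: L2_set_def sum.reindex inj_on_def)
    also have "\<dots> \<le> sqrt (\<Sum>\<^sub>\<infinity>k. (cmod (z k))\<^sup>2)"
      by (rule L2_set_le[OF z]) (simp add: F)
    finally show "L2_set (\<lambda>j. cmod (z (i, j))) F \<le> sqrt (\<Sum>\<^sub>\<infinity>k. (cmod (z k))\<^sup>2)" .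
  qed
  done

lemma norm_ell2_square: "(norm x)\<^sup>2 = (\<Sum>\<^sub>\<infinity>i. (cmod (coord x i))\<^sup>2)" for x :: "'i ell2"
  by (simp add: norm_ell2.rep_eq infsum_nonneg)

lemma sum_norm_row_vec_le:
  fixes z :: "('i \<times> 'j) ell2"
  assumes A: "finite A"
  shows "(\<Sum>i\<in>A. (norm (row_vec z i))\<^sup>2) \<le> (norm z)\<^sup>2"
proof -
  let ?f = "\<lambda>k. (cmod (coord z k))\<^sup>2"
  have s: "?f summable_on (A \<times> UNIV)"
    by (rule summable_on_subset_banach[OF summable_coord]) simp
  have "(\<Sum>i\<in>A. (norm (row_vec z i))\<^sup>2) = (\<Sum>\<^sub>\<infinity>i\<in>A. \<Sum>\<^sub>\<infinity>j. ?f (i, j))"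
    using A by (simp add: norm_ell2_square row_vec.rep_eq)
  also have "\<dots> = infsum ?f (A \<times> UNIV)"
    using infsum_Sigma_banach[OF s] by simp
  also have "\<dots> \<le> infsum ?f UNIV"
    by (rule infsum_mono_neutral[OF s summable_coord]) auto
  finally show ?thesis by (simp add: norm_ell2_square)
qed

lifting_forget ell2.lifting


section \<open>Bounded operators\<close>

typedef 'i cop = "{T :: 'i ell2 \<Rightarrow>\<^sub>L 'i ell2. \<forall>c x. T (c *\<^sub>C x) = c *\<^sub>C T x}"
  morphisms blinfun_of_cop Abs_cop
  by (rule exI[of _ 0]) (simp add: ell2_ext)

setup_lifting type_definition_cop

lift_definition cop_apply :: "'i cop \<Rightarrow> 'i ell2 \<Rightarrow> 'i ell2" is blinfun_apply .

declare [[coercion "cop_apply :: 'i cop \<Rightarrow> 'i ell2 \<Rightarrow> 'i ell2"]]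

lemma bounded_linear_scaleC_ell2: "bounded_linear (\<lambda>x :: 'i ell2. c *\<^sub>C x)"
  by (rule bounded_linear_intro[where K = "cmod c"])
     (auto simp: scaleC_add_right_ell2 scaleR_eq_scaleC scaleC_scaleC_ell2 norm_scaleC_ell2 mult.commute)

lift_definition scaleC_blinfun :: "complex \<Rightarrow> ('i ell2 \<Rightarrow>\<^sub>L 'i ell2) \<Rightarrow> ('i ell2 \<Rightarrow>\<^sub>L 'i ell2)"
  is "\<lambda>c T x. c *\<^sub>C T x"
  by (rule bounded_linear_compose[OF bounded_linear_scaleC_ell2])

instantiation cop :: (type) "{real_normed_algebra_1, scaleC, star}"
begin

lift_definition zero_cop :: "'a cop" is 0
  by (simp add: ell2_ext)

lift_definition one_cop :: "'a cop" is id_blinfun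
  by simp

lift_definition plus_cop :: "'a cop \<Rightarrow> 'a cop \<Rightarrow> 'a cop" is "(+)"
  by (simp add: blinfun.add_left scaleC_add_right_ell2)

lift_definition uminus_cop :: "'a cop \<Rightarrow> 'a cop" is uminus
  by (auto simp: blinfun.minus_left intro: ell2_ext)

lift_definition minus_cop :: "'a cop \<Rightarrow> 'a cop \<Rightarrow> 'a cop" is "(-)"
  by (auto simp: blinfun.diff_left algebra_simps intro: ell2_ext)

lift_definition times_cop :: "'a cop \<Rightarrow> 'a cop \<Rightarrow> 'a cop" is blinfun_compose
  by simp

lift_definition scaleR_cop :: "real \<Rightarrow> 'a cop \<Rightarrow> 'a cop" is scaleR
  by (simp add: blinfun.scaleR_left scaleR_eq_scaleC scaleC_scaleC_ell2 mult.commute)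

lift_definition scaleC_cop :: "complex \<Rightarrow> 'a cop \<Rightarrow> 'a cop" is scaleC_blinfun
  by (simp add: scaleC_blinfun.rep_eq scaleC_scaleC_ell2 mult.commute)

lift_definition norm_cop :: "'a cop \<Rightarrow> real" is norm .

definition star_cop :: "'a cop \<Rightarrow> 'a cop"
  where "star_cop T = (THE S :: 'a cop. \<forall>x y. cinner (S x) y = cinner x (T y))"

definition sgn_cop :: "'a cop \<Rightarrow> 'a cop"
  where "sgn_cop T = inverse (norm T) *\<^sub>R T"

definition dist_cop :: "'a cop \<Rightarrow> 'a cop \<Rightarrow> real"
  where "dist_cop S T = norm (S - T)"

definition uniformity_cop :: "('a cop \<times> 'a cop) filter"
  where "uniformity_cop = (INF e\<in>{0<..}. principal {(S, T). dist S T < e})"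

definition open_cop :: "'a cop set \<Rightarrow> bool"
  where "open_cop X = (\<forall>S\<in>X. \<forall>\<^sub>F (S', T) in uniformity. S' = S \<longrightarrow> T \<in> X)"

instance
proof
  fix a b :: real and x y z :: "'a cop"
  show "x + y + z = x + (y + z)" by transfer (simp add: algebra_simps)
  show "x + y = y + x" by transfer (simp add: algebra_simps)
  show "0 + x = x" by transfer simp
  show "- x + x = 0" by transfer simp
  show "x - y = x + - y" by transfer simp
  show "a *\<^sub>R (x + y) = a *\<^sub>R x + a *\<^sub>R y" by transfer (simp add: algebra_simps)
  show "(a + b) *\<^sub>R x = a *\<^sub>R x + b *\<^sub>R x" by transfer (simp add: algebra_simps)
  show "a *\<^sub>R b *\<^sub>R x = (a * b) *\<^sub>R x" by transfer (simp add: algebra_simps)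
  show "1 *\<^sub>R x = x" by transfer simp
  show "x * y * z = x * (y * z)" by transfer (rule blinfun_eqI, simp)
  show "(x + y) * z = x * z + y * z"
    by transfer (rule blinfun_eqI, simp add: blinfun.bilinear_simps)
  show "x * (y + z) = x * y + x * z"
    by transfer (rule blinfun_eqI, simp add: blinfun.bilinear_simps)
  show "a *\<^sub>R x * y = a *\<^sub>R (x * y)"
    by transfer (rule blinfun_eqI, simp add: blinfun.bilinear_simps)
  show "x * a *\<^sub>R y = a *\<^sub>R (x * y)"
    by transfer (rule blinfun_eqI, simp add: blinfun.bilinear_simps)
  show "1 * x = x" by transfer (rule blinfun_eqI, simp)
  show "x * 1 = x" by transfer (rule blinfun_eqI, simp)
  show norm_one: "norm (1 :: 'a cop) = 1"
  proof transfer
    have "norm (basis_vec undefined :: 'a ell2) \<le> norm (id_blinfun :: 'a ell2 \<Rightarrow>\<^sub>L 'a ell2)"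
      using norm_blinfun[of id_blinfun "basis_vec undefined :: 'a ell2"] by simp
    then show "norm (id_blinfun :: 'a ell2 \<Rightarrow>\<^sub>L 'a ell2) = 1"
      using norm_blinfun_id_le[where 'a = "'a ell2"] by simp
  qed
  show "(0 :: 'a cop) \<noteq> 1"
  proof
    assume "(0 :: 'a cop) = 1"
    moreover have "norm (0 :: 'a cop) = 0" by transfer simp
    ultimately show False using norm_one by simp
  qed
  show "dist x y = norm (x - y)" by (rule dist_cop_def)
  show "sgn x = inverse (norm x) *\<^sub>R x" by (rule sgn_cop_def)
  show "(uniformity :: ('a cop \<times> 'a cop) filter) = (INF e\<in>{0<..}. principal {(x, y). dist x y < e})"
    by (rule uniformity_cop_def)
  show "open X = (\<forall>x\<in>X. \<forall>\<^sub>F (x', y) in uniformity. x' = x \<longrightarrow> y \<in> X)" for X :: "'a cop set"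
    by (rule open_cop_def)
  show "norm x = 0 \<longleftrightarrow> x = 0" by transfer simp
  show "norm (x + y) \<le> norm x + norm y" by transfer (rule norm_triangle_ineq)
  show "norm (a *\<^sub>R x) = \<bar>a\<bar> * norm x" by transfer simp
  show "norm (x * y) \<le> norm x * norm y" by transfer (rule norm_blinfun_compose)
qed

end

lemma cop_apply_simps [simp]:
  "cop_apply 0 x = 0"
  "cop_apply 1 x = x"
  "cop_apply (S + T) x = S x + T x"
  "cop_apply (- T) x = - T x"
  "cop_apply (S - T) x = S x - T x"
  "cop_apply (S * T) x = S (T x)"
  "cop_apply (c *\<^sub>C T) x = c *\<^sub>C T x"
  by (transfer, simp add: blinfun.bilinear_simps scaleC_blinfun.rep_eq)+

lemma cop_scaleC_right [simp]: "cop_apply T (c *\<^sub>C x) = c *\<^sub>C T x"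
  by transfer simp

lemma cop_add_right [simp]: "cop_apply T (x + y) = T x + T y"
  by transfer (simp add: blinfun.bilinear_simps)

lemma cop_eqI: "(\<And>x. cop_apply S x = cop_apply T x) \<Longrightarrow> S = T"
  by transfer (rule blinfun_eqI)

lemma bounded_linear_cop: "bounded_linear (cop_apply T)"
  by transfer (rule blinfun.bounded_linear_right)

lemma norm_cop_apply: "norm (cop_apply T x) \<le> norm T * norm x"
  by transfer (rule norm_blinfun)

lemma cop_eqI_basis:
  assumes "\<And>i. cop_apply S (basis_vec i) = cop_apply T (basis_vec i)"
  shows "S = T"
proof (rule cop_eqI)
  fix x
  have "((\<lambda>i. cop_apply S (coord x i *\<^sub>C basis_vec i)) has_sum S x) UNIV"
    and "((\<lambda>i. cop_apply T (coord x i *\<^sub>C basis_vec i)) has_sum T x) UNIV"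
    by (rule has_sum_bounded_linear[OF bounded_linear_cop basis_expansion, unfolded o_def])+
  then show "cop_apply S x = T x"
    using assms by (simp add: has_sum_unique)
qed

lemma cop_exists:
  assumes add: "\<And>x y. f (x + y) = f x + f y"
    and scale: "\<And>c x. f (c *\<^sub>C x) = c *\<^sub>C f x"
    and bound: "\<And>x. norm (f x) \<le> norm x * K"
  shows "\<exists>T. cop_apply T = f"
proof -
  have bl: "bounded_linear f"
    by (rule bounded_linear_intro[where K = K]) (auto simp: add scaleR_eq_scaleC scale bound)
  have "cop_apply (Abs_cop (Blinfun f)) = f"
    by (simp add: cop_apply.rep_eq Abs_cop_inverse bounded_linear_Blinfun_apply[OF bl] scale)
  then show ?thesis by blast
qed

lemma cinner_ext: "(\<And>y. cinner x y = cinner x' y) \<Longrightarrow> x = x'"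
  by (metis cinner_basis_left cinner_commute ell2_ext)

lemma adjoint_exists:
  fixes T :: "'i cop"
  shows "\<exists>S. \<forall>x y. cinner (cop_apply S x) y = cinner x (T y)"
proof -
  have bound: "L2_set (\<lambda>i. cmod (cinner (T (basis_vec i)) y)) F \<le> norm T * norm y"
    if F: "finite F" for y :: "'i ell2" and F
  proof -
    define a where "a i = cinner (T (basis_vec i)) y" for i
    define z :: "'i ell2" where "z = (\<Sum>i\<in>F. a i *\<^sub>C basis_vec i)"
    define L where "L = L2_set (\<lambda>i. cmod (a i)) F"
    have "coord z k = (if k \<in> F then a k else 0)" for k
      using F by (simp add: z_def coord_sum basis_vec.rep_eq if_distrib cong: if_cong)
    then have "(\<Sum>\<^sub>\<infinity>k. (cmod (coord z k))\<^sup>2) = (\<Sum>\<^sub>\<infinity>k\<in>F. (cmod (a k))\<^sup>2)"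
      by (intro infsum_cong_neutral) auto
    then have nz: "norm z = L"
      using F by (simp add: norm_ell2.rep_eq L_def L2_set_def)
    have "cinner (T (\<Sum>i\<in>G. a i *\<^sub>C basis_vec i)) y = (\<Sum>i\<in>G. cnj (a i) * a i)" if "finite G" for G
      using that
    proof induction
      case empty
      have "cop_apply T 0 = 0"
        using bounded_linear_cop[of T] by (simp add: linear_simps)
      then show ?case by (simp add: cinner_def)
    qed (simp add: cinner_add_left cinner_scaleC_left a_def)
    then have "cinner (T z) y = (\<Sum>i\<in>F. cnj (a i) * a i)"
      using F by (simp add: z_def)
    also have "\<dots> = complex_of_real (\<Sum>i\<in>F. (cmod (a i))\<^sup>2)"
      by (simp only: of_real_sum complex_norm_square mult.commute)
    also have "\<dots> = complex_of_real (L\<^sup>2)"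
      by (simp add: L_def L2_set_def sum_nonneg)
    finally have "L\<^sup>2 = cmod (cinner (T z) y)"
      by (simp only: norm_of_real abs_power2)
    also have "\<dots> \<le> norm (T z) * norm y"
      by (rule cinner_bound)
    also have "\<dots> \<le> norm T * L * norm y"
      using norm_cop_apply[of T z] by (simp add: mult_right_mono nz)
    finally have "L * L \<le> (norm T * norm y) * L"
      by (simp add: power2_eq_square mult_ac)
    moreover have "0 \<le> L" by (simp add: L_def)
    ultimately have "L \<le> norm T * norm y"
      by (cases "L = 0") auto
    then show ?thesis by (simp add: L_def a_def)
  qed
  define f where "f y = Abs_ell2 (\<lambda>i. cinner (T (basis_vec i)) y)" for y
  have f: "coord (f y) i = cinner (T (basis_vec i)) y" for y i
    unfolding f_def using square_summableI(1)[OF bound] by (simp add: Abs_ell2_inverse)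
  have "\<exists>S :: 'i cop. cop_apply S = f"
  proof (rule cop_exists)
    show "norm (f y) \<le> norm y * norm T" for y
      using square_summableI(2)[OF bound, of y] by (simp add: norm_ell2.rep_eq f mult.commute)
  qed (auto intro!: ell2_ext simp: f cinner_add_right cinner_scaleC_right)
  then obtain S where S: "cop_apply S = f" by blast
  have "cinner (T y) x = cinner y (S x)" for x y
  proof -
    have "bounded_linear (\<lambda>z. cinner z x)"
      by (rule bounded_linear_intro[where K = "norm x"])
         (auto simp: cinner_add_left scaleR_eq_scaleC cinner_scaleC_left scaleR_conv_of_real cinner_bound)
    then have "bounded_linear (\<lambda>y. cinner (T y) x)"
      by (rule bounded_linear_compose[OF _ bounded_linear_cop])
    from has_sum_bounded_linear[OF this basis_expansion[of y]]
    have "((\<lambda>i. cnj (coord y i) * coord (S x) i) has_sum cinner (T y) x) UNIV"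
      by (simp add: o_def cinner_scaleC_left S f)
    then show ?thesis
      unfolding cinner_def[of y] by (simp add: infsumI)
  qed
  then show ?thesis
    by (metis cinner_commute)
qed

lemma star_adjoint: "cinner (cop_apply (star T) x) y = cinner x (cop_apply T y)"
proof -
  obtain S where S: "\<forall>x y. cinner (cop_apply S x) y = cinner x (T y)"
    using adjoint_exists by blast
  have "star T = S"
    unfolding star_cop_def
    by (rule the_equality) (use S in \<open>auto intro!: cop_eqI cinner_ext\<close>)
  then show ?thesis using S by simp
qed

lemma star_eqI:
  assumes "\<And>x y. cinner (cop_apply S x) y = cinner x (cop_apply T y)"
  shows "star T = S"
  by (rule cop_eqI, rule cinner_ext) (simp add: star_adjoint assms)


section \<open>The shift and tensor products of operators\<close>

definition shift :: "int cop"
  where "shift = (THE T. \<forall>k. cop_apply T (basis_vec k) = basis_vec (k + 1))"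

lemma coord_shift: "coord (cop_apply shift x) k = coord x (k - 1)"
  and shift_basis: "cop_apply shift (basis_vec k) = basis_vec (k + 1)"
proof -
  have b: "bij (\<lambda>k :: int. k - 1)"
    by (rule bij_betw_byWitness[where f' = "\<lambda>k. k + 1"]) auto
  have "\<exists>T. cop_apply T = permute_vec (\<lambda>k :: int. k - 1)"
    by (rule cop_exists[where K = 1])
       (auto simp: norm_permute_vec[OF b] coord_permute_vec[OF b] intro!: ell2_ext)
  then obtain T where T: "cop_apply T = permute_vec (\<lambda>k :: int. k - 1)"
    by blast
  then have basis: "cop_apply T (basis_vec k) = basis_vec (k + 1)" for k
    by (intro ell2_ext) (auto simp: coord_permute_vec[OF b] basis_vec.rep_eq)
  then have "shift = T"
    unfolding shift_def by (intro the_equality) (auto intro: cop_eqI_basis)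
  with T basis show "coord (cop_apply shift x) k = coord x (k - 1)"
    and "cop_apply shift (basis_vec k) = basis_vec (k + 1)"
    by (auto simp: coord_permute_vec[OF b])
qed

lemma tensor_right_exists:
  fixes b :: "'j cop"
  shows "\<exists>T :: ('i \<times> 'j) cop. \<forall>x y. cop_apply T (tensor_vec x y) = tensor_vec x (b y)"
proof -
  have bound: "L2_set (\<lambda>k. cmod (case k of (i, j) \<Rightarrow> coord (b (row_vec z i)) j)) F \<le> norm b * norm z"
    if F: "finite F" for z :: "('i \<times> 'j) ell2" and F
  proof -
    let ?A = "fst ` F" and ?B = "snd ` F"
    have AB: "finite ?A" "finite ?B" using F by auto
    have "F \<subseteq> ?A \<times> ?B" by (rule subset_fst_snd)
    then have "(\<Sum>k\<in>F. (cmod (case k of (i, j) \<Rightarrow> coord (b (row_vec z i)) j))\<^sup>2)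
        \<le> (\<Sum>k\<in>?A \<times> ?B. (cmod (case k of (i, j) \<Rightarrow> coord (b (row_vec z i)) j))\<^sup>2)"
      using F by (intro sum_mono2) auto
    also have "\<dots> = (\<Sum>i\<in>?A. \<Sum>j\<in>?B. (cmod (coord (b (row_vec z i)) j))\<^sup>2)"
      by (simp add: sum.cartesian_product case_prod_unfold)
    also have "\<dots> \<le> (\<Sum>i\<in>?A. (norm (b (row_vec z i)))\<^sup>2)"
      unfolding norm_ell2_square
      by (intro sum_mono finite_sum_le_infsum summable_coord AB) auto
    also have "\<dots> \<le> (\<Sum>i\<in>?A. (norm b)\<^sup>2 * (norm (row_vec z i))\<^sup>2)"
      unfolding power_mult_distrib[symmetric] by (intro sum_mono power_mono norm_cop_apply norm_ge_zero)
    also have "\<dots> \<le> (norm b)\<^sup>2 * (norm z)\<^sup>2"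
      unfolding sum_distrib_left[symmetric]
      by (intro mult_left_mono sum_norm_row_vec_le AB) simp
    finally have "(\<Sum>k\<in>F. (cmod (case k of (i, j) \<Rightarrow> coord (b (row_vec z i)) j))\<^sup>2) \<le> (norm b * norm z)\<^sup>2"
      by (simp add: power_mult_distrib)
    then show ?thesis
      unfolding L2_set_def by (intro real_le_lsqrt) (auto intro: sum_nonneg)
  qed
  define f where "f z = Abs_ell2 (\<lambda>(i, j). coord (b (row_vec z i)) j)" for z :: "('i \<times> 'j) ell2"
  have "(\<lambda>k. (cmod (case k of (i, j) \<Rightarrow> coord (b (row_vec z i)) j))\<^sup>2) summable_on UNIV"
    for z :: "('i \<times> 'j) ell2"
    using square_summableI(1)[OF bound] by blast
  then have f: "coord (f z) = (\<lambda>(i, j). coord (b (row_vec z i)) j)" for z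
    unfolding f_def by (subst Abs_ell2_inverse) auto
  have row: "row_vec (x + y) i = row_vec x i + row_vec y i"
    "row_vec (c *\<^sub>C x) i = c *\<^sub>C row_vec x i"
    "row_vec (tensor_vec u v) i = coord u i *\<^sub>C v"
    for x y :: "('i \<times> 'j) ell2" and c i and u :: "'i ell2" and v
    by (auto intro!: ell2_ext simp: row_vec.rep_eq coord_tensor_vec)
  have "\<exists>T :: ('i \<times> 'j) cop. cop_apply T = f"
  proof (rule cop_exists)
    show "norm (f z) \<le> norm z * norm b" for z
      using square_summableI(2)[OF bound, of z] by (simp add: norm_ell2.rep_eq f mult.commute)
  qed (auto intro!: ell2_ext simp: f row)
  then obtain T :: "('i \<times> 'j) cop" where T: "cop_apply T = f" by blast
  have "cop_apply T (tensor_vec x y) = tensor_vec x (b y)" for x y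
    by (auto intro!: ell2_ext simp: T f row coord_tensor_vec)
  then show ?thesis by blast
qed

definition tensor_op :: "'i cop \<Rightarrow> 'j cop \<Rightarrow> ('i \<times> 'j) cop"
  where "tensor_op a b =
    (THE T. \<forall>x y. cop_apply T (tensor_vec x y) = tensor_vec (a x) (b y))"

lemma tensor_op_apply:
  "cop_apply (tensor_op a b) (tensor_vec x y) = tensor_vec (cop_apply a x) (cop_apply b y)"
  for a :: "'i cop" and b :: "'j cop"
proof -
  obtain R :: "('i \<times> 'j) cop" where R: "cop_apply R (tensor_vec x y) = tensor_vec x (b y)" for x y
    using tensor_right_exists[of b] by blast
  obtain Q :: "('j \<times> 'i) cop" where Q: "cop_apply Q (tensor_vec y x) = tensor_vec y (a x)" for x y
    using tensor_right_exists[of a] by blast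
  define f :: "('i \<times> 'j) ell2 \<Rightarrow> ('i \<times> 'j) ell2"
    where "f z = permute_vec prod.swap (Q (permute_vec prod.swap z))" for z
  have permute: "permute_vec prod.swap (u + v) = permute_vec prod.swap u + permute_vec prod.swap v"
    "permute_vec prod.swap (c *\<^sub>C u) = c *\<^sub>C permute_vec prod.swap u"
    for c and u v :: "('k \<times> 'l) ell2"
    by (auto intro!: ell2_ext simp: coord_permute_vec)
  have "\<exists>S. cop_apply S = f"
  proof (rule cop_exists)
    show "norm (f z) \<le> norm z * norm Q" for z
      using norm_cop_apply[of Q "permute_vec prod.swap z"]
      by (simp add: f_def norm_permute_vec mult.commute)
  qed (simp_all add: f_def permute)
  then obtain S where S: "cop_apply S = f" by blast
  have swap: "permute_vec prod.swap (tensor_vec u v) = tensor_vec v u"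
    for u :: "'k ell2" and v :: "'l ell2"
    by (rule ell2_ext) (auto simp: coord_permute_vec coord_tensor_vec)
  have SR: "cop_apply (S * R) (tensor_vec x y) = tensor_vec (a x) (b y)" for x y
    by (simp add: S R f_def swap Q)
  have "tensor_op a b = S * R"
    unfolding tensor_op_def
    by (rule the_equality) (use SR in \<open>auto intro!: cop_eqI_basis simp: basis_vec_Pair\<close>)
  with SR show ?thesis by simp
qed


section \<open>Concrete C*-algebras\<close>

instantiation "fun" :: (type, scaleC) scaleC
begin
definition "c *\<^sub>C f = (\<lambda>x. c *\<^sub>C f x)"
instance ..
end

instantiation "fun" :: (type, star) star
begin
definition "star f = (\<lambda>x. star (f x))"
instance ..
end

definition star_subalgebra :: "'a :: {zero, plus, times, scaleC, star} set \<Rightarrow> bool"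
  where "star_subalgebra B \<longleftrightarrow> 0 \<in> B
    \<and> (\<forall>x\<in>B. \<forall>y\<in>B. x + y \<in> B \<and> x * y \<in> B)
    \<and> (\<forall>x\<in>B. star x \<in> B \<and> (\<forall>c. c *\<^sub>C x \<in> B))"

definition cstar_generated :: "'i cop set \<Rightarrow> 'i cop set"
  where "cstar_generated G = \<Inter>{B. star_subalgebra B \<and> closed B \<and> G \<subseteq> B}"

text \<open>
  Families of operators carry the pointwise operations and the supremum norm. The topology of
  the function type is pointwise convergence, so closedness under uniform limits is spelled out.
\<close>

definition cstar_generated_family :: "('r \<Rightarrow> 'i cop) set \<Rightarrow> ('r \<Rightarrow> 'i cop) set"
  where "cstar_generated_family G = \<Inter>{B. star_subalgebra B
    \<and> (\<forall>X x. (\<forall>n :: nat. X n \<in> B) \<and> uniform_limit UNIV X x sequentially \<longrightarrow> x \<in> B)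
    \<and> G \<subseteq> B}"

text \<open>A bijective *-homomorphism between C*-algebras is automatically isometric.\<close>

definition cstar_isomorphic ::
  "'a :: {plus, times, scaleC, star} set \<Rightarrow> 'b :: {plus, times, scaleC, star} set \<Rightarrow> bool"
  where "cstar_isomorphic A B \<longleftrightarrow> (\<exists>\<phi>. bij_betw \<phi> A B
    \<and> (\<forall>x\<in>A. \<forall>y\<in>A. \<phi> (x + y) = \<phi> x + \<phi> y \<and> \<phi> (x * y) = \<phi> x * \<phi> y)
    \<and> (\<forall>x\<in>A. \<phi> (star x) = star (\<phi> x) \<and> (\<forall>c. \<phi> (c *\<^sub>C x) = c *\<^sub>C \<phi> x)))"

text \<open>
  The spatial tensor product of C*-algebras of operators. It is used with a commutative, hence
  nuclear, factor, so that there is only one C*-tensor product.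
\<close>

definition cstar_tensor :: "'i cop set \<Rightarrow> 'j cop set \<Rightarrow> ('i \<times> 'j) cop set"
  where "cstar_tensor A B = cstar_generated {tensor_op a b | a b. a \<in> A \<and> b \<in> B}"

text \<open>A null sequence is identified with the operator of multiplication by it.\<close>

definition c0_algebra :: "nat cop set"
  where "c0_algebra =
    {T. \<exists>a. a \<longlonglongrightarrow> 0 \<and> (\<forall>k. cop_apply T (basis_vec k) = a k *\<^sub>C basis_vec k)}"


section \<open>Supernatural numbers and Bunce-Deddens algebras\<close>

text \<open>
  A supernatural number is given by its exponents, all exponents at non-primes being 0.
  Divisibility is the pointwise order and the least common multiple is the pointwise supremum.
\<close>

type_synonym supernatural = "nat \<Rightarrow> enat"

definition supernatural_of_nat :: "nat \<Rightarrow> supernatural"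
  where "supernatural_of_nat n = (\<lambda>q. if prime q then enat (multiplicity q n) else 0)"

definition bunce_deddens :: "supernatural \<Rightarrow> int cop set"
  where "bunce_deddens S = cstar_generated (insert shift
    {T. \<exists>a. (\<exists>l > 0. supernatural_of_nat l \<le> S \<and> (\<forall>k. a (k + int l) = a k))
      \<and> (\<forall>k. cop_apply T (basis_vec k) = a k *\<^sub>C basis_vec k)})"


section \<open>The p-adic integers\<close>

text \<open>
  The p-adic integers are the sequences \<open>x\<close> in which \<open>x n\<close> is the residue mod \<open>p ^ n\<close> in
  \<open>{0..<p ^ n}\<close>. The topology of the function type, \<open>int\<close> being discrete, induces the p-adic one.
\<close>

type_synonym padic = "nat \<Rightarrow> int"

definition padic_integers :: "nat \<Rightarrow> padic ring"
  where "padic_integers p =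
    \<lparr>carrier = {x. \<forall>n. x n \<in> {0..<int p ^ n} \<and> x (Suc n) mod int p ^ n = x n},
     mult = \<lambda>x y n. x n * y n mod int p ^ n,
     one = \<lambda>n. 1 mod int p ^ n,
     zero = \<lambda>n. 0,
     add = \<lambda>x y n. (x n + y n) mod int p ^ n\<rparr>"

lemma padic_mod_mod: "0 < p \<Longrightarrow> a mod int p ^ Suc n mod int p ^ n = a mod int p ^ n"
  by (simp add: mod_mod_cancel)

lemma cring_padic_integers:
  assumes p: "0 < p"
  shows "cring (padic_integers p)"
proof (rule cringI)
  let ?Z = "padic_integers p"
  have pos: "0 < int p ^ n" for n using p by simp
  have red: "a mod int p ^ n mod int p ^ n = a mod int p ^ n" for a n
    by simp
  show "abelian_group ?Z"
  proof (rule abelian_groupI)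
    fix x assume x: "x \<in> carrier ?Z"
    let ?y = "\<lambda>n. - x n mod int p ^ n"
    have "- x (Suc n) mod int p ^ n = - x n mod int p ^ n" for n
      using x by (metis (mono_tags, lifting) mem_Collect_eq mod_minus_eq padic_integers_def partial_object.select_convs(1))
    then have "?y \<in> carrier ?Z"
      using pos by (simp add: padic_integers_def padic_mod_mod[OF p] del: power_Suc)
    moreover have "?y \<oplus>\<^bsub>?Z\<^esub> x = \<zero>\<^bsub>?Z\<^esub>"
      by (simp add: padic_integers_def mod_add_left_eq)
    ultimately show "\<exists>y\<in>carrier ?Z. y \<oplus>\<^bsub>?Z\<^esub> x = \<zero>\<^bsub>?Z\<^esub>" by blast
  next
    fix x y assume "x \<in> carrier ?Z" "y \<in> carrier ?Z"
    then show "x \<oplus>\<^bsub>?Z\<^esub> y \<in> carrier ?Z"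
      using pos by (simp add: padic_integers_def padic_mod_mod[OF p] del: power_Suc)
        (metis mod_add_eq)
  qed (use pos in \<open>auto simp: padic_integers_def mod_simps ac_simps\<close>)
  show "Group.comm_monoid ?Z"
  proof (rule comm_monoidI)
    fix x y assume "x \<in> carrier ?Z" "y \<in> carrier ?Z"
    then show "x \<otimes>\<^bsub>?Z\<^esub> y \<in> carrier ?Z"
      using pos by (simp add: padic_integers_def padic_mod_mod[OF p] del: power_Suc)
        (metis mod_mult_eq)
  next
    show "\<one>\<^bsub>?Z\<^esub> \<in> carrier ?Z"
      using pos by (simp add: padic_integers_def padic_mod_mod[OF p] del: power_Suc)
  qed (use pos in \<open>auto simp: padic_integers_def mod_simps ac_simps\<close>)
  show "(x \<oplus>\<^bsub>?Z\<^esub> y) \<otimes>\<^bsub>?Z\<^esub> z = x \<otimes>\<^bsub>?Z\<^esub> z \<oplus>\<^bsub>?Z\<^esub> y \<otimes>\<^bsub>?Z\<^esub> z" for x y z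
    by (simp add: padic_integers_def mod_simps algebra_simps)
qed

text \<open>
  For \<open>N \<ge> 1\<close>, \<open>r N\<close> is the residue class of \<open>r\<close> in the group of units of the integers mod
  \<open>p ^ N\<close>.
\<close>

definition padic_ord :: "nat \<Rightarrow> padic \<Rightarrow> supernatural"
  where "padic_ord p r =
    (SUP N\<in>{1..}. supernatural_of_nat (group.ord (units_of (residue_ring (int p ^ N))) (r N)))"


section \<open>The crossed product\<close>

text \<open>
  Functions on the p-adic integers are represented by arbitrary extensions to the type
  \<open>padic\<close>; only their values on the carrier matter.
\<close>

definition padic_continuous :: "nat \<Rightarrow> (padic \<Rightarrow> complex) set"
  where "padic_continuous p = {f. continuous_on (carrier (padic_integers p)) f}"

definition padic_dilation :: "nat \<Rightarrow> padic \<Rightarrow> (padic \<Rightarrow> complex) \<Rightarrow> padic \<Rightarrow> complex"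
  where "padic_dilation p r f =
    (\<lambda>x. f (x \<otimes>\<^bsub>padic_integers p\<^esub> inv\<^bsub>padic_integers p\<^esub> r))"

definition padic_function_rep :: "nat \<Rightarrow> ((padic \<Rightarrow> complex) \<Rightarrow> 'i cop) \<Rightarrow> bool"
  where "padic_function_rep p M \<longleftrightarrow> M (\<lambda>_. 1) = 1
    \<and> (\<forall>f \<in> padic_continuous p. \<forall>g \<in> padic_continuous p.
        ((\<forall>x \<in> carrier (padic_integers p). f x = g x) \<longrightarrow> M f = M g)
        \<and> M (\<lambda>x. f x + g x) = M f + M g
        \<and> M (\<lambda>x. f x * g x) = M f * M g)
    \<and> (\<forall>f \<in> padic_continuous p.
        M (\<lambda>x. cnj (f x)) = star (M f) \<and> (\<forall>c. M (\<lambda>x. c * f x) = c *\<^sub>C M f))"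

type_synonym covariant_pair = "((padic \<Rightarrow> complex) \<Rightarrow> int cop) \<times> int cop"

definition covariant_pairs :: "nat \<Rightarrow> padic \<Rightarrow> covariant_pair set"
  where "covariant_pairs p r = {(M, V). padic_function_rep p M \<and> star V * V = 1
    \<and> (\<forall>f \<in> padic_continuous p. V * M f * star V = M (padic_dilation p r f))}"

definition universal_M :: "nat \<Rightarrow> padic \<Rightarrow> (padic \<Rightarrow> complex) \<Rightarrow> covariant_pair \<Rightarrow> int cop"
  where "universal_M p r f = (\<lambda>\<rho>. if \<rho> \<in> covariant_pairs p r then fst \<rho> f else 0)"

definition universal_V :: "nat \<Rightarrow> padic \<Rightarrow> covariant_pair \<Rightarrow> int cop"
  where "universal_V p r = (\<lambda>\<rho>. if \<rho> \<in> covariant_pairs p r then snd \<rho> else 0)"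

text \<open>
  The universal C*-algebra of the relations is generated by the families of all values of the
  generators under all representations of the relations, with the supremum norm. Since the
  algebra of continuous functions is separable, every representation is a direct sum of
  representations on separable spaces, and by amplification these may be taken on the
  infinite-dimensional separable space \<open>int ell2\<close>.
\<close>

definition crossed_product :: "nat \<Rightarrow> padic \<Rightarrow> (covariant_pair \<Rightarrow> int cop) set"
  where "crossed_product p r =
    cstar_generated_family (insert (universal_V p r) (universal_M p r ` padic_continuous p))"

text \<open>
  By construction, the representation of \<open>crossed_product p r\<close> induced by a covariant pair is
  evaluation at that pair.
\<close>

definition zero_rep :: "nat \<Rightarrow> covariant_pair"
  where "zero_rep p = (\<lambda>f. f \<zero>\<^bsub>padic_integers p\<^esub> *\<^sub>C 1, shift)"

definition pi0 :: "nat \<Rightarrow> (covariant_pair \<Rightarrow> int cop) \<Rightarrow> int cop"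
  where "pi0 p x = x (zero_rep p)"

definition kernel_ideal :: "nat \<Rightarrow> padic \<Rightarrow> (covariant_pair \<Rightarrow> int cop) set"
  where "kernel_ideal p r = {x \<in> crossed_product p r. pi0 p x = 0}"

lemma star_scalar: "star (c *\<^sub>C (1 :: 'i cop)) = cnj c *\<^sub>C 1"
  by (rule star_eqI) (simp add: cinner_scaleC_left cinner_scaleC_right)

lemma shift_unitary: "star shift * shift = 1" "shift * star shift = 1"
proof -
  have b: "bij (\<lambda>k :: int. k + 1)" "bij (\<lambda>k :: int. k - 1)"
    by (rule bij_betw_byWitness[where f' = "\<lambda>k. k - 1"] bij_betw_byWitness[where f' = "\<lambda>k. k + 1"]; auto)+
  have "\<exists>U. cop_apply U = permute_vec (\<lambda>k :: int. k + 1)"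
    by (rule cop_exists[where K = 1])
       (auto simp: norm_permute_vec[OF b(1)] coord_permute_vec[OF b(1)] intro!: ell2_ext)
  then obtain U :: "int cop" where U: "cop_apply U = permute_vec (\<lambda>k. k + 1)"
    by blast
  have "star shift = U"
  proof (rule star_eqI)
    fix x y :: "int ell2"
    show "cinner (cop_apply U x) y = cinner x (cop_apply shift y)"
      using infsum_reindex_bij_betw[OF b(2), of "\<lambda>k. cnj (coord x (k + 1)) * coord y k"]
      by (simp add: cinner_def U coord_permute_vec[OF b(1)] coord_shift)
  qed
  moreover have "U * shift = 1" "shift * U = 1"
    by (auto intro!: cop_eqI ell2_ext simp: coord_shift U coord_permute_vec[OF b(1)])
  ultimately show "star shift * shift = 1" "shift * star shift = 1"
    by simp_all
qed

lemma zero_rep_covariant: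
  assumes "0 < p" and r: "r \<in> Units (padic_integers p)"
  shows "zero_rep p \<in> covariant_pairs p r"
proof -
  interpret cring "padic_integers p" by (rule cring_padic_integers[OF assms(1)])
  have [simp]: "c *\<^sub>C (1 :: int cop) * T = c *\<^sub>C T" "T * c *\<^sub>C 1 = c *\<^sub>C T"
    "c *\<^sub>C d *\<^sub>C T = (c * d) *\<^sub>C T" "c *\<^sub>C S * T = c *\<^sub>C (S * T)"
    "(c + d) *\<^sub>C T = c *\<^sub>C T + d *\<^sub>C T" "1 *\<^sub>C T = T"
    for c d and S T :: "int cop"
    by (auto intro!: cop_eqI ell2_ext simp: algebra_simps)
  show ?thesis
    using r by (auto simp: zero_rep_def covariant_pairs_def padic_function_rep_def shift_unitary
        star_scalar padic_dilation_def mult.commute)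
qed

lemma pi0_generators:
  assumes "0 < p" "r \<in> Units (padic_integers p)"
  shows "pi0 p (universal_V p r) = shift"
    and "pi0 p (universal_M p r f) = f \<zero>\<^bsub>padic_integers p\<^esub> *\<^sub>C 1"
  using zero_rep_covariant[OF assms]
  by (auto simp: pi0_def universal_V_def universal_M_def zero_rep_def)

end

theory Submission
  imports Defs
begin

text \<open>
  Every \<open>V\<close> in a covariant pair is unitary, so the crossed product is one by the integers. The nonzero
  \<open>p\<close>-adic integers decompose into the sets \<open>p\<^sup>n c H\<close>, where \<open>H\<close> is the closure of the powers of \<open>r\<close>
  and \<open>c\<close> runs through representatives of the units modulo \<open>H\<close>. As \<open>r\<close> is not a root of unity and \<open>p\<close> is odd,
  \<open>H\<close> is open, so these sets form a sequence \<open>K\<^sub>0, K\<^sub>1, \<dots>\<close> shrinking to \<open>0\<close>. A point \<open>y\<^sub>j\<close> of \<open>K\<^sub>j\<close> yields the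
  covariant pair in which \<open>V\<close> is the bilateral shift and \<open>f\<close> acts by the diagonal \<open>k \<mapsto> f (y\<^sub>j r\<^sup>k)\<close>.

  The direct sum of these representations is isometric on the crossed product: a covariant pair on any
  space is compared with them on long finite pieces of orbits (transference), the boundary of such a
  piece being negligible because the integers are amenable. In each of them the crossed product acts
  inside the Bunce-Deddens algebra, and the operators converge in norm to the value at \<open>\<pi>\<^sub>0\<close>. Hence the kernel
  of \<open>\<pi>\<^sub>0\<close> is mapped into the \<open>c\<^sub>0\<close>-sum of copies of the Bunce-Deddens algebra. The image is closed, and
  since the \<open>K\<^sub>j\<close> are separated by locally constant functions, it contains every summand.
\<close>

section \<open>Operators on square-summable families\<close>

text \<open>Unitarity comes from covariance at the constant function 1, which every dilation fixes.
  Oddness of p enters through one sum: 0 + 1 + ... + (p - 1) is divisible by p, so for N at least 1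
  the p-th power of an element at distance exactly p^-N from 1 lies at distance exactly p^-(N+1).
  This fills H with a ball around 1, and cosets of H become decidable modulo a fixed p^s. The
  obstacle is that the norm of the crossed product is a supremum over all covariant pairs, including
  those that give mass to the point 0, which lies on none of the chosen orbits. The comparison is
  therefore made with locally constant functions of one level N: they see only residues mod p^N, and
  every residue, that of 0 included, is taken by a point of some orbit. In an arbitrary pair the
  operators \<open>W N j i\<close> obey the same rules under right multiplication as the coordinate
  functionals of the orbit representation, so one matrix describes an element in both. Edges cost a
  factor (L + 2n)/L, which tends to 1. Isometry then gives injectivity and the closed image, and a
  closed image reduces surjectivity to generators of the Bunce-Deddens algebra.\<close>

lemma cop_norm_leI:
  assumes "0 \<le> B" "\<And>x. norm (cop_apply T x) \<le> B * norm x"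
  shows "norm T \<le> B"
  using assms by transfer (rule norm_blinfun_bound)

lemma scaleC_cop_simps [simp]:
  fixes S T :: "'i cop"
  shows "c *\<^sub>C S * T = c *\<^sub>C (S * T)" "S * c *\<^sub>C T = c *\<^sub>C (S * T)"
    and "c *\<^sub>C d *\<^sub>C T = (c * d) *\<^sub>C T" "1 *\<^sub>C T = T" "0 *\<^sub>C T = 0" "c *\<^sub>C (0 :: 'i cop) = 0"
  by (auto intro!: cop_eqI ell2_ext)

lemma scaleC_ell2_simps [simp]: "0 *\<^sub>C x = 0" "1 *\<^sub>C x = x" "c *\<^sub>C (0 :: 'i ell2) = 0"
  for x :: "'i ell2"
  by (auto intro!: ell2_ext)

lemma cop_apply_zero [simp]: "cop_apply T 0 = 0"
  using bounded_linear_cop[of T] by (simp add: linear_simps)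

lemma cop_apply_sum: "cop_apply (\<Sum>i\<in>F. S i) x = (\<Sum>i\<in>F. cop_apply (S i) x)"
  by (induction F rule: infinite_finite_induct) auto

lemma scaleC_add_right_cop: "c *\<^sub>C (S + T) = c *\<^sub>C S + c *\<^sub>C T"
  and scaleC_add_left_cop: "(c + d) *\<^sub>C T = c *\<^sub>C T + d *\<^sub>C T"
  and scaleC_diff_right_cop: "c *\<^sub>C (S - T) = c *\<^sub>C S - c *\<^sub>C T"
  for S T :: "'i cop"
  by (auto intro!: cop_eqI ell2_ext simp: algebra_simps)

lemma scaleC_sum_right_cop: "c *\<^sub>C (\<Sum>i\<in>F. S i) = (\<Sum>i\<in>F. c *\<^sub>C S i)" for S :: "'a \<Rightarrow> 'i cop"
  by (induction F rule: infinite_finite_induct) (auto simp: scaleC_add_right_cop)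

lemma scaleC_sum_left_cop: "(\<Sum>i\<in>F. c i) *\<^sub>C S = (\<Sum>i\<in>F. c i *\<^sub>C S)" for S :: "'i cop"
  by (induction F rule: infinite_finite_induct) (auto simp: scaleC_add_left_cop)

lemma norm_scaleC_cop: "norm (c *\<^sub>C T) = cmod c * norm T" for T :: "'i cop"
proof -
  have le: "norm (c *\<^sub>C T) \<le> cmod c * norm T" for c and T :: "'i cop"
  proof (rule cop_norm_leI)
    show "norm (cop_apply (c *\<^sub>C T) x) \<le> cmod c * norm T * norm x" for x
      using norm_cop_apply[of T x] by (simp add: norm_scaleC_ell2 mult.assoc mult_left_mono)
  qed simp
  show ?thesis
  proof (cases "c = 0")
    case False
    then have "cmod c * norm T \<le> norm (c *\<^sub>C T)"
      using le[of "inverse c" "c *\<^sub>C T"] by (simp add: norm_inverse norm_divide field_simps)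
    with le[of c T] show ?thesis by simp
  qed simp
qed

lemma scaleC_minus_one_cop: "(- 1) *\<^sub>C T = - T" for T :: "'i cop"
  by (auto intro!: cop_eqI ell2_ext)


section \<open>Adjoints and their norms\<close>

lemma cinner_self: "cinner x x = complex_of_real ((norm x)\<^sup>2)"
proof -
  have "cinner x x = (\<Sum>\<^sub>\<infinity>i. complex_of_real ((cmod (coord x i))\<^sup>2))"
    unfolding cinner_def by (intro infsum_cong) (simp only: complex_norm_square mult.commute)
  also have "\<dots> = complex_of_real (\<Sum>\<^sub>\<infinity>i. (cmod (coord x i))\<^sup>2)"
    using has_sum_of_real[OF has_sum_infsum[OF summable_coord[of x]]] by (rule infsumI)
  finally show ?thesis by (simp only: norm_ell2_square)
qed

lemma star_adjoint_right: "cinner x (cop_apply (star T) y) = cinner (cop_apply T x) y"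
  by (subst cinner_commute, subst cinner_commute[of "cop_apply T x"]) (simp only: star_adjoint)

lemma star_cop_simps:
  fixes S T :: "'i cop"
  shows star_cop_add: "star (S + T) = star S + star T"
    and star_cop_mult: "star (S * T) = star T * star S"
    and star_cop_star [simp]: "star (star T) = T"
    and star_cop_scaleC: "star (c *\<^sub>C T) = cnj c *\<^sub>C star T"
    and star_cop_zero [simp]: "star (0 :: 'i cop) = 0"
proof -
  show "star (c *\<^sub>C T) = cnj c *\<^sub>C star T" for c and T :: "'i cop"
    by (rule star_eqI) (simp add: cinner_scaleC_left cinner_scaleC_right star_adjoint)
  from this[of 0] show "star (0 :: 'i cop) = 0" by simp
qed (rule star_eqI; simp add: cinner_add_left cinner_add_right star_adjoint star_adjoint_right)+

lemma star_cop_diff: "star (S - T) = star S - star T" for S T :: "'i cop"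
  using star_cop_add[of S "- T"] star_cop_scaleC[of "-1" T]
  by (simp add: scaleC_minus_one_cop)

text \<open>Apply Cauchy-Schwarz to <T* x, T* x> = <x, T T* x> and cancel one factor
  \<open>norm ?y\<close>; the reverse bound is the same estimate for \<open>star T\<close>.\<close>

lemma norm_star_cop [simp]: "norm (star T) = norm T" for T :: "'i cop"
proof -
  have le: "norm (star T) \<le> norm T" for T :: "'i cop"
  proof (rule cop_norm_leI)
    fix x :: "'i ell2"
    let ?y = "cop_apply (star T) x"
    have "(norm ?y)\<^sup>2 = cmod (cinner ?y ?y)"
      by (simp only: cinner_self norm_of_real abs_power2)
    also have "cinner ?y ?y = cinner x (cop_apply T ?y)"
      by (rule star_adjoint)
    also have "cmod \<dots> \<le> norm x * (norm T * norm ?y)"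
      by (intro order_trans[OF cinner_bound] mult_left_mono norm_cop_apply) simp
    finally have "norm ?y * norm ?y \<le> (norm T * norm x) * norm ?y"
      by (simp add: power2_eq_square mult_ac)
    then show "norm ?y \<le> norm T * norm x"
      by (cases "norm ?y = 0") (auto simp: mult_le_cancel_right)
  qed simp
  show ?thesis using le[of T] le[of "star T"] by simp
qed

text \<open>Lets identities between adjoints be checked entry by entry on matrices.\<close>

lemma coord_star_basis:
  "coord (cop_apply (star T) (basis_vec a)) b = cnj (coord (cop_apply T (basis_vec b)) a)"
  by (simp only: cinner_basis_left[symmetric] star_adjoint_right)
     (rule cinner_commute)

lemma star_eqI_basis:
  assumes "\<And>a b. coord (cop_apply S (basis_vec a)) b = cnj (coord (cop_apply T (basis_vec b)) a)"
  shows "star T = S"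
  by (intro cop_eqI_basis ell2_ext) (simp add: coord_star_basis assms)


instance ell2 :: (type) banach
proof
  fix X :: "nat \<Rightarrow> 'a ell2"
  assume C: "Cauchy X"
  have "\<exists>l. (\<lambda>n. coord (X n) i) \<longlonglongrightarrow> l" for i
  proof -
    have "Cauchy (\<lambda>n. coord (X n) i)"
    proof (rule metric_CauchyI)
      fix e :: real assume "0 < e"
      then obtain M where M: "\<And>m n. m \<ge> M \<Longrightarrow> n \<ge> M \<Longrightarrow> dist (X m) (X n) < e"
        using metric_CauchyD[OF C] by blast
      have "dist (coord (X m) i) (coord (X n) i) \<le> dist (X m) (X n)" for m n
        using norm_coord_le[of "X m - X n" i] by (simp add: dist_norm)
      then show "\<exists>M. \<forall>m\<ge>M. \<forall>n\<ge>M. dist (coord (X m) i) (coord (X n) i) < e"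
        using M by (meson le_less_trans)
    qed
    then show ?thesis by (simp add: Cauchy_convergent_iff convergent_def)
  qed
  then have "\<exists>z. \<forall>i. (\<lambda>n. coord (X n) i) \<longlonglongrightarrow> z i"
    by (intro choice allI)
  then obtain z where z: "\<And>i. (\<lambda>n. coord (X n) i) \<longlonglongrightarrow> z i" by blast
  have bound: "L2_set (\<lambda>i. cmod (coord (X n) i - z i)) F \<le> e"
    if M: "\<forall>m\<ge>M. \<forall>n\<ge>M. dist (X m) (X n) < e" and "n \<ge> M" "finite F" for e M n F
  proof (rule LIMSEQ_le_const2)
    show "(\<lambda>m. L2_set (\<lambda>i. cmod (coord (X n) i - coord (X m) i)) F)
        \<longlonglongrightarrow> L2_set (\<lambda>i. cmod (coord (X n) i - z i)) F"
      unfolding L2_set_def by (intro tendsto_intros z)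
    have "L2_set (\<lambda>i. cmod (coord (X n) i - coord (X m) i)) F \<le> e" if "m \<ge> M" for m
    proof -
      have "dist (X n) (X m) < e" using M that \<open>n \<ge> M\<close> by blast
      then show ?thesis
        using L2_set_coord_le[OF \<open>finite F\<close>, of "X n - X m"] by (simp add: dist_norm)
    qed
    then show "\<exists>N. \<forall>m\<ge>N. L2_set (\<lambda>i. cmod (coord (X n) i - coord (X m) i)) F \<le> e" by blast
  qed
  obtain M where M: "\<forall>m\<ge>M. \<forall>n\<ge>M. dist (X m) (X n) < 1"
    using metric_CauchyD[OF C, of 1] by auto
  \<comment> \<open>The coordinatewise limit \<open>z\<close> is not yet known to be square
    summable. By \<open>bound\<close> the difference \<open>X M - z\<close> is, so the limit vector
    is built as \<open>X M\<close> minus that difference.\<close>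
  define x where "x = X M - Abs_ell2 (\<lambda>i. coord (X M) i - z i)"
  have x: "coord x i = z i" for i
    unfolding x_def using square_summableI(1)[OF bound[OF M order.refl]] by (simp add: Abs_ell2_inverse)
  have "X \<longlonglongrightarrow> x"
  proof (rule metric_LIMSEQ_I)
    fix e :: real assume "0 < e"
    then obtain M where M: "\<forall>m\<ge>M. \<forall>n\<ge>M. dist (X m) (X n) < e / 2"
      using metric_CauchyD[OF C, of "e / 2"] by auto
    have "dist (X n) x < e" if "n \<ge> M" for n
      using square_summableI(2)[OF bound[OF M that]] \<open>0 < e\<close>
      by (simp add: dist_norm norm_ell2.rep_eq x)
    then show "\<exists>M. \<forall>n\<ge>M. dist (X n) x < e" by blast
  qed
  then show "convergent X" by (rule convergentI)
qed

text \<open>Complex linearity survives limits, so completeness of the bounded real-linear maps is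
  inherited. It makes uniformly Cauchy families of operators converge, from which the image of the
  kernel ideal will be seen to be closed.\<close>

instance cop :: (type) banach
proof
  fix X :: "nat \<Rightarrow> 'a cop"
  assume C: "Cauchy X"
  have d: "dist (blinfun_of_cop S) (blinfun_of_cop T) = dist S T" for S T :: "'a cop"
    by (simp add: dist_norm norm_cop.rep_eq minus_cop.rep_eq)
  have "Cauchy (\<lambda>n. blinfun_of_cop (X n))"
    using C by (simp add: Cauchy_def d)
  then obtain L where L: "(\<lambda>n. blinfun_of_cop (X n)) \<longlonglongrightarrow> L"
    by (auto simp: Cauchy_convergent_iff convergent_def)
  have ap: "(\<lambda>n. blinfun_of_cop (X n) x) \<longlonglongrightarrow> L x" for x
    by (intro tendsto_intros L)
  have "L (c *\<^sub>C x) = c *\<^sub>C L x" for c x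
  proof (rule LIMSEQ_unique[OF ap])
    have "(\<lambda>n. c *\<^sub>C blinfun_of_cop (X n) x) \<longlonglongrightarrow> c *\<^sub>C L x"
      by (rule bounded_linear.tendsto[OF bounded_linear_scaleC_ell2 ap])
    then show "(\<lambda>n. blinfun_of_cop (X n) (c *\<^sub>C x)) \<longlonglongrightarrow> c *\<^sub>C L x"
      by (simp add: cop_apply.rep_eq[symmetric])
  qed
  then have "blinfun_of_cop (Abs_cop L) = L"
    by (simp add: Abs_cop_inverse)
  with L have "X \<longlonglongrightarrow> Abs_cop L"
    by (simp add: tendsto_iff d[symmetric])
  then show "convergent X" by (rule convergentI)
qed

text \<open>Junk for unbounded \<open>a\<close>, as is \<open>dir_sum\<close> below for unbounded families.\<close>

definition diag :: "('i \<Rightarrow> complex) \<Rightarrow> 'i cop"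
  where "diag a = (THE T. \<forall>k. cop_apply T (basis_vec k) = a k *\<^sub>C basis_vec k)"

lemma diag_eqI:
  assumes "\<And>k. cop_apply T (basis_vec k) = a k *\<^sub>C basis_vec k"
  shows "diag a = T"
  unfolding diag_def by (rule the_equality) (use assms in \<open>auto intro: cop_eqI_basis\<close>)

lemma
  assumes B: "\<And>k. cmod (a k) \<le> B"
  shows coord_diag: "coord (cop_apply (diag a) x) k = a k * coord x k"
    and diag_basis: "cop_apply (diag a) (basis_vec k) = a k *\<^sub>C basis_vec k"
    and norm_diag_le: "norm (diag a) \<le> B"
proof -
  have B0: "0 \<le> B" using order_trans[OF norm_ge_zero B] .
  have bound: "L2_set (\<lambda>k. cmod (a k * coord x k)) F \<le> norm x * B" if "finite F" for x :: "'a ell2" and F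
  proof -
    have "L2_set (\<lambda>k. cmod (a k * coord x k)) F \<le> L2_set (\<lambda>k. B * cmod (coord x k)) F"
      by (intro L2_set_mono) (auto simp: norm_mult B mult_right_mono)
    also have "\<dots> = B * L2_set (\<lambda>k. cmod (coord x k)) F"
      using B0 by (simp add: L2_set_right_distrib)
    also have "\<dots> \<le> B * norm x"
      by (intro mult_left_mono L2_set_coord_le that B0)
    finally show ?thesis by (simp add: mult.commute)
  qed
  define f where "f x = Abs_ell2 (\<lambda>k. a k * coord x k)" for x
  have f: "coord (f x) k = a k * coord x k" for x k
    unfolding f_def using square_summableI(1)[OF bound] by (simp add: Abs_ell2_inverse)
  have nf: "norm (f x) \<le> norm x * B" for x
    using square_summableI(2)[OF bound, of x] by (simp add: norm_ell2.rep_eq f)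
  have "\<exists>T. cop_apply T = f"
  proof (rule cop_exists[where K = B])
    show "norm (f x) \<le> norm x * B" for x by (rule nf)
  qed (auto intro!: ell2_ext simp: f algebra_simps)
  then obtain T where T: "cop_apply T = f" by blast
  have "diag a = T"
    by (intro diag_eqI) (auto intro!: ell2_ext simp: T f basis_vec.rep_eq)
  with T f show "coord (cop_apply (diag a) x) k = a k * coord x k" by simp
  show "norm (diag a) \<le> B"
  proof (rule cop_norm_leI[OF B0])
    show "norm (cop_apply (diag a) x) \<le> B * norm x" for x
      using nf[of x] T \<open>diag a = T\<close> by (simp add: mult.commute)
  qed
  show "cop_apply (diag a) (basis_vec k) = a k *\<^sub>C basis_vec k"
    by (auto intro!: ell2_ext simp: T f \<open>diag a = T\<close> basis_vec.rep_eq)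
qed


section \<open>Direct sums of operators\<close>

lemma row_vec_ext: "(\<And>j. row_vec x j = row_vec y j) \<Longrightarrow> x = y"
  by (rule ell2_ext) (metis row_vec.rep_eq surj_pair)

lemma row_vec_simps [simp]:
  "row_vec (x + y) j = row_vec x j + row_vec y j"
  "row_vec (c *\<^sub>C x) j = c *\<^sub>C row_vec x j"
  "row_vec 0 j = 0"
  by (auto intro!: ell2_ext simp: row_vec.rep_eq)

lemma row_vec_tensor: "row_vec (tensor_vec u v) j = coord u j *\<^sub>C v"
  by (auto intro!: ell2_ext simp: row_vec.rep_eq coord_tensor_vec)

lemma norm_tensor_basis: "norm (tensor_vec (basis_vec j) x) = norm x"
proof -
  have "(\<Sum>\<^sub>\<infinity>q. (cmod (coord (tensor_vec (basis_vec j) x) q))\<^sup>2)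
      = (\<Sum>\<^sub>\<infinity>q\<in>range (Pair j). (cmod (coord (tensor_vec (basis_vec j) x) q))\<^sup>2)"
    by (rule infsum_cong_neutral) (auto simp: coord_tensor_vec basis_vec.rep_eq)
  also have "\<dots> = (\<Sum>\<^sub>\<infinity>k. (cmod (coord x k))\<^sup>2)"
    by (subst infsum_reindex) (auto simp: inj_on_def o_def coord_tensor_vec basis_vec.rep_eq)
  finally show ?thesis by (simp add: norm_ell2.rep_eq)
qed

text \<open>Block-diagonal operators are realised on pairs of indices, where they can be compared
  with \<open>tensor_op\<close> directly.\<close>

definition dir_sum :: "('j \<Rightarrow> 'i cop) \<Rightarrow> ('j \<times> 'i) cop"
  where "dir_sum T = (THE S. \<forall>z j. row_vec (cop_apply S z) j = cop_apply (T j) (row_vec z j))"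

lemma
  fixes T :: "'j \<Rightarrow> 'i cop"
  assumes B: "\<And>j. norm (T j) \<le> B"
  shows row_vec_dir_sum: "row_vec (cop_apply (dir_sum T) z) j = cop_apply (T j) (row_vec z j)"
    and norm_dir_sum_le: "norm (dir_sum T) \<le> B"
proof -
  have B0: "0 \<le> B" using order_trans[OF norm_ge_zero B] .
  let ?g = "\<lambda>z (j, k). coord (cop_apply (T j) (row_vec z j)) k"
  have bound: "L2_set (\<lambda>q. cmod (?g z q)) F \<le> norm z * B" if F: "finite F" for z and F
  proof -
    let ?A = "fst ` F" and ?B = "snd ` F"
    have AB: "finite ?A" "finite ?B" using F by auto
    have "F \<subseteq> ?A \<times> ?B" by (rule subset_fst_snd)
    then have "(\<Sum>q\<in>F. (cmod (?g z q))\<^sup>2) \<le> (\<Sum>q\<in>?A \<times> ?B. (cmod (?g z q))\<^sup>2)"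
      using F by (intro sum_mono2) auto
    also have "\<dots> = (\<Sum>j\<in>?A. \<Sum>k\<in>?B. (cmod (coord (cop_apply (T j) (row_vec z j)) k))\<^sup>2)"
      by (simp add: sum.cartesian_product case_prod_unfold)
    also have "\<dots> \<le> (\<Sum>j\<in>?A. (norm (cop_apply (T j) (row_vec z j)))\<^sup>2)"
      unfolding norm_ell2_square
      by (intro sum_mono finite_sum_le_infsum summable_coord AB) auto
    also have "\<dots> \<le> (\<Sum>j\<in>?A. B\<^sup>2 * (norm (row_vec z j))\<^sup>2)"
      unfolding power_mult_distrib[symmetric]
      by (intro sum_mono power_mono order_trans[OF norm_cop_apply] mult_right_mono B norm_ge_zero)
    also have "\<dots> \<le> B\<^sup>2 * (norm z)\<^sup>2"
      unfolding sum_distrib_left[symmetric]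
      by (intro mult_left_mono sum_norm_row_vec_le AB) simp
    finally have "(\<Sum>q\<in>F. (cmod (?g z q))\<^sup>2) \<le> (norm z * B)\<^sup>2"
      by (simp add: power_mult_distrib mult.commute)
    then show ?thesis
      unfolding L2_set_def using B0 by (intro real_le_lsqrt) (auto intro: sum_nonneg)
  qed
  define f where "f z = Abs_ell2 (?g z)" for z
  have f: "coord (f z) = ?g z" for z
    unfolding f_def by (rule Abs_ell2_inverse) (use square_summableI(1)[OF bound] in blast)
  have row: "row_vec (f z) j = cop_apply (T j) (row_vec z j)" for z j
    by (auto intro!: ell2_ext simp: row_vec.rep_eq f)
  have nf: "norm (f z) \<le> norm z * B" for z
    using square_summableI(2)[OF bound, of z] by (simp add: norm_ell2.rep_eq f)
  have "\<exists>S. cop_apply S = f"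
  proof (rule cop_exists[where K = B])
    show "norm (f z) \<le> norm z * B" for z by (rule nf)
  qed (auto intro!: row_vec_ext simp: row)
  then obtain S where S: "cop_apply S = f" by blast
  have "dir_sum T = S"
    unfolding dir_sum_def by (rule the_equality) (auto simp: S row intro!: cop_eqI row_vec_ext)
  with S row show "row_vec (cop_apply (dir_sum T) z) j = cop_apply (T j) (row_vec z j)" by simp
  show "norm (dir_sum T) \<le> B"
  proof (rule cop_norm_leI[OF B0])
    show "norm (cop_apply (dir_sum T) z) \<le> B * norm z" for z
      using nf[of z] S \<open>dir_sum T = S\<close> by (simp add: mult.commute)
  qed
qed

lemma coord_dir_sum_basis:
  assumes "\<And>j. norm (T j) \<le> B"
  shows "coord (cop_apply (dir_sum T) (basis_vec (j, k))) (i, l)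
    = (if i = j then coord (cop_apply (T j) (basis_vec k)) l else 0)"
proof -
  have "coord (cop_apply (dir_sum T) (basis_vec (j, k))) (i, l)
      = coord (row_vec (cop_apply (dir_sum T) (basis_vec (j, k))) i) l"
    by (simp add: row_vec.rep_eq)
  also have "\<dots> = (if i = j then coord (cop_apply (T j) (basis_vec k)) l else 0)"
    by (simp add: row_vec_dir_sum[OF assms] basis_vec_Pair row_vec_tensor basis_vec.rep_eq)
  finally show ?thesis .
qed

text \<open>Test on vectors supported in the single row \<open>j\<close>, where the direct sum acts
  as \<open>T j\<close>. With \<open>norm_dir_sum_le\<close>, the norm of a bounded direct sum is
  the supremum of the norms of its summands.\<close>

lemma norm_le_norm_dir_sum:
  assumes "\<And>j. norm (T j) \<le> B"
  shows "norm (T j) \<le> norm (dir_sum T)"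
proof (rule cop_norm_leI)
  fix x
  let ?z = "cop_apply (dir_sum T) (tensor_vec (basis_vec j) x)"
  have "cop_apply (T j) x = row_vec ?z j"
    by (simp add: row_vec_dir_sum[OF assms] row_vec_tensor basis_vec.rep_eq)
  moreover have "norm (row_vec ?z j) \<le> norm ?z"
    using sum_norm_row_vec_le[of "{j}" ?z] by (simp add: power_mono_iff)
  ultimately show "norm (cop_apply (T j) x) \<le> norm (dir_sum T) * norm x"
    using norm_cop_apply[of "dir_sum T" "tensor_vec (basis_vec j) x"] by (simp add: norm_tensor_basis)
qed simp

lemma
  fixes S T :: "'j \<Rightarrow> 'i cop"
  assumes S: "\<And>j. norm (S j) \<le> B" and T: "\<And>j. norm (T j) \<le> C"
  shows dir_sum_add: "dir_sum (\<lambda>j. S j + T j) = dir_sum S + dir_sum T"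
    and dir_sum_diff: "dir_sum (\<lambda>j. S j - T j) = dir_sum S - dir_sum T"
    and dir_sum_mult: "dir_sum (\<lambda>j. S j * T j) = dir_sum S * dir_sum T"
proof -
  have ST: "norm (S j + T j) \<le> B + C" "norm (S j - T j) \<le> B + C" "norm (S j * T j) \<le> B * C" for j
    by (rule order_trans[OF norm_triangle_ineq add_mono[OF S T]]
        order_trans[OF norm_triangle_ineq4 add_mono[OF S T]]
        order_trans[OF norm_mult_ineq mult_mono[OF S T order_trans[OF norm_ge_zero S] norm_ge_zero]])+
  have row_diff: "row_vec (x - y) j = row_vec x j - row_vec y j" for x y :: "('j \<times> 'i) ell2" and j
    by (auto intro!: ell2_ext simp: row_vec.rep_eq)
  show "dir_sum (\<lambda>j. S j + T j) = dir_sum S + dir_sum T" "dir_sum (\<lambda>j. S j - T j) = dir_sum S - dir_sum T"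
    "dir_sum (\<lambda>j. S j * T j) = dir_sum S * dir_sum T"
    by (auto intro!: cop_eqI row_vec_ext simp: row_diff row_vec_dir_sum[OF S] row_vec_dir_sum[OF T]
        row_vec_dir_sum[OF ST(1)] row_vec_dir_sum[OF ST(2)] row_vec_dir_sum[OF ST(3)])
qed

lemma
  fixes T :: "'j \<Rightarrow> 'i cop"
  assumes T: "\<And>j. norm (T j) \<le> B"
  shows dir_sum_star: "dir_sum (\<lambda>j. star (T j)) = star (dir_sum T)"
    and dir_sum_scaleC: "dir_sum (\<lambda>j. c *\<^sub>C T j) = c *\<^sub>C dir_sum T"
proof -
  have T': "norm (star (T j)) \<le> B" "norm (c *\<^sub>C T j) \<le> cmod c * B" for j
    using T by (auto simp: norm_scaleC_cop mult_left_mono)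
  show "dir_sum (\<lambda>j. star (T j)) = star (dir_sum T)"
    by (rule star_eqI_basis[symmetric])
       (auto simp: coord_dir_sum_basis[OF T] coord_dir_sum_basis[OF T'(1)] coord_star_basis)
  show "dir_sum (\<lambda>j. c *\<^sub>C T j) = c *\<^sub>C dir_sum T"
    by (auto intro!: cop_eqI row_vec_ext simp: row_vec_dir_sum[OF T] row_vec_dir_sum[OF T'(2)])
qed

text \<open>The bridge between the two sides of the theorem: elementary tensors with a diagonal left
  factor become block-diagonal operators.\<close>

lemma dir_sum_tensor_op:
  fixes A :: "'j cop" and b :: "'i cop"
  assumes a: "\<And>j. cop_apply A (basis_vec j) = a j *\<^sub>C basis_vec j" and B: "\<And>j. cmod (a j) \<le> B"
  shows "dir_sum (\<lambda>j. a j *\<^sub>C b) = tensor_op A b"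
proof (rule cop_eqI_basis, rule ell2_ext)
  fix q s :: "'j \<times> 'i"
  obtain j k i l where qs: "q = (j, k)" "s = (i, l)" by (metis surj_pair)
  have nb: "norm (a j *\<^sub>C b) \<le> B * norm b" for j
    by (simp add: norm_scaleC_cop B mult_right_mono)
  have "coord (cop_apply (tensor_op A b) (basis_vec q)) s
      = (if i = j then a j * coord (cop_apply b (basis_vec k)) l else 0)"
    by (simp add: qs basis_vec_Pair tensor_op_apply coord_tensor_vec a basis_vec.rep_eq)
  then show "coord (cop_apply (dir_sum (\<lambda>j. a j *\<^sub>C b)) (basis_vec q)) s
      = coord (cop_apply (tensor_op A b) (basis_vec q)) s"
    by (simp add: qs coord_dir_sum_basis[OF nb])
qed


section \<open>Diagonal operators and generated algebras\<close>

lemma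
  fixes a b :: "'i \<Rightarrow> complex"
  assumes a: "\<And>k. cmod (a k) \<le> A" and b: "\<And>k. cmod (b k) \<le> B"
  shows diag_add: "diag (\<lambda>k. a k + b k) = diag a + diag b"
    and diag_mult: "diag (\<lambda>k. a k * b k) = diag a * diag b"
    and diag_scaleC: "diag (\<lambda>k. c * a k) = c *\<^sub>C diag a"
    and diag_cnj: "diag (\<lambda>k. cnj (a k)) = star (diag a)"
proof -
  show "diag (\<lambda>k. a k + b k) = diag a + diag b" "diag (\<lambda>k. a k * b k) = diag a * diag b"
    "diag (\<lambda>k. c * a k) = c *\<^sub>C diag a"
    by (rule diag_eqI; auto intro!: ell2_ext simp: coord_diag[OF a] coord_diag[OF b] basis_vec.rep_eq)+
  have a': "cmod (cnj (a k)) \<le> A" for k using a by simp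
  show "diag (\<lambda>k. cnj (a k)) = star (diag a)"
    by (rule star_eqI_basis[symmetric]) (auto simp: coord_diag[OF a] coord_diag[OF a'] basis_vec.rep_eq)
qed

lemma diag_const: "diag (\<lambda>_. c) = c *\<^sub>C 1"
  by (rule diag_eqI) simp

section \<open>Generated algebras and uniform closures\<close>

lemma star_subalgebraD:
  assumes "star_subalgebra B"
  shows "0 \<in> B" "x \<in> B \<Longrightarrow> y \<in> B \<Longrightarrow> x + y \<in> B" "x \<in> B \<Longrightarrow> y \<in> B \<Longrightarrow> x * y \<in> B"
    "x \<in> B \<Longrightarrow> star x \<in> B" "x \<in> B \<Longrightarrow> c *\<^sub>C x \<in> B"
  using assms by (auto simp: star_subalgebra_def)

lemma star_subalgebra_Inter: "(\<And>B. B \<in> \<B> \<Longrightarrow> star_subalgebra B) \<Longrightarrow> star_subalgebra (\<Inter>\<B>)"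
  unfolding star_subalgebra_def by blast

lemma star_subalgebra_cstar_generated: "star_subalgebra (cstar_generated G)"
  and closed_cstar_generated: "closed (cstar_generated G)"
  and cstar_generated_superset: "G \<subseteq> cstar_generated G"
  and cstar_generated_least: "star_subalgebra B \<Longrightarrow> closed B \<Longrightarrow> G \<subseteq> B \<Longrightarrow> cstar_generated G \<subseteq> B"
  unfolding cstar_generated_def
  by (auto intro!: star_subalgebra_Inter closed_Inter)

text \<open>The closure condition spelled out inside \<open>cstar_generated_family\<close>, isolated
  so that generated families admit an induction principle.\<close>

definition uniformly_closed :: "('r \<Rightarrow> 'i cop) set \<Rightarrow> bool"
  where "uniformly_closed B \<longleftrightarrow>
    (\<forall>X x. (\<forall>n :: nat. X n \<in> B) \<and> uniform_limit UNIV X x sequentially \<longrightarrow> x \<in> B)"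

lemma uniformly_closedD:
  "uniformly_closed B \<Longrightarrow> (\<And>n :: nat. X n \<in> B) \<Longrightarrow> uniform_limit UNIV X x sequentially \<Longrightarrow> x \<in> B"
  unfolding uniformly_closed_def by blast

lemma star_subalgebra_cstar_generated_family: "star_subalgebra (cstar_generated_family G)"
  and uniformly_closed_cstar_generated_family: "uniformly_closed (cstar_generated_family G)"
  and cstar_generated_family_superset: "G \<subseteq> cstar_generated_family G"
  and cstar_generated_family_least:
    "star_subalgebra B \<Longrightarrow> uniformly_closed B \<Longrightarrow> G \<subseteq> B \<Longrightarrow> cstar_generated_family G \<subseteq> B"
proof -
  let ?\<B> = "{B. star_subalgebra B \<and> uniformly_closed B \<and> G \<subseteq> B}"
  have eq: "cstar_generated_family G = \<Inter>?\<B>"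
    unfolding cstar_generated_family_def uniformly_closed_def ..
  show "star_subalgebra (cstar_generated_family G)"
    unfolding eq by (intro star_subalgebra_Inter) auto
  show "uniformly_closed (cstar_generated_family G)"
    unfolding eq uniformly_closed_def[of "\<Inter>?\<B>"] by (blast dest: uniformly_closedD)
  show "G \<subseteq> cstar_generated_family G"
    unfolding eq by blast
  show "star_subalgebra B \<Longrightarrow> uniformly_closed B \<Longrightarrow> G \<subseteq> B \<Longrightarrow> cstar_generated_family G \<subseteq> B"
    unfolding eq by blast
qed

lemma uniform_limit_approx:
  fixes X :: "nat \<Rightarrow> 'r \<Rightarrow> 'i cop"
  assumes "uniform_limit UNIV X x sequentially" "0 < e"
  shows "\<exists>N. \<forall>n\<ge>N. \<forall>\<rho>. norm (x \<rho> - X n \<rho>) < e"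
  using uniform_limitD[OF assms] unfolding eventually_sequentially
  by (auto simp: dist_norm norm_minus_commute)

lemmas family_simps = plus_fun_def times_fun_def star_fun_def scaleC_fun_def zero_fun_def

text \<open>Boundedness is included because multiplication is uniformly continuous only on bounded
  sets, and the closure has to be an algebra again. Unbounded members of \<open>B\<close> are
  thereby left out.\<close>

definition uniform_closure :: "('r \<Rightarrow> 'i cop) set \<Rightarrow> ('r \<Rightarrow> 'i cop) set"
  where "uniform_closure B = {x. (\<exists>K. \<forall>\<rho>. norm (x \<rho>) \<le> K)
    \<and> (\<forall>e>0. \<exists>y\<in>B. \<forall>\<rho>. norm (x \<rho> - y \<rho>) \<le> e)}"

lemma uniformly_closed_uniform_closure:
  fixes B :: "('r \<Rightarrow> 'i cop) set"
  shows "uniformly_closed (uniform_closure B)"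
  unfolding uniformly_closed_def
proof (intro allI impI, elim conjE)
  fix X :: "nat \<Rightarrow> 'r \<Rightarrow> 'i cop" and x
  assume X: "\<forall>n. X n \<in> uniform_closure B" and lim: "uniform_limit UNIV X x sequentially"
  have tri: "norm (x \<rho> - y) \<le> norm (x \<rho> - X n \<rho>) + norm (X n \<rho> - y)" for n \<rho> y
    using norm_triangle_ineq[of "x \<rho> - X n \<rho>" "X n \<rho> - y"] by simp
  have "\<exists>K. \<forall>\<rho>. norm (x \<rho>) \<le> K"
  proof -
    obtain n where n: "\<And>\<rho>. norm (x \<rho> - X n \<rho>) < 1"
      using uniform_limit_approx[OF lim, of 1] by auto
    obtain K where "\<And>\<rho>. norm (X n \<rho>) \<le> K"
      using X unfolding uniform_closure_def by blast
    then have "norm (x \<rho>) \<le> 1 + K" for \<rho>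
      using tri[of \<rho> 0 n] n[of \<rho>] by (smt (verit) diff_zero)
    then show ?thesis by blast
  qed
  moreover have "\<exists>y\<in>B. \<forall>\<rho>. norm (x \<rho> - y \<rho>) \<le> e" if e: "0 < e" for e
  proof -
    obtain n where n: "\<And>\<rho>. norm (x \<rho> - X n \<rho>) < e / 2"
      using uniform_limit_approx[OF lim, of "e / 2"] e by auto
    have "X n \<in> uniform_closure B" "e / 2 > 0" using X e by auto
    then obtain y where y: "y \<in> B" "\<And>\<rho>. norm (X n \<rho> - y \<rho>) \<le> e / 2"
      unfolding uniform_closure_def by blast
    have "norm (x \<rho> - y \<rho>) \<le> e" for \<rho>
      using tri[of \<rho> "y \<rho>" n] n[of \<rho>] y(2)[of \<rho>] by linarith
    with y(1) show ?thesis by blast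
  qed
  ultimately show "x \<in> uniform_closure B" by (simp add: uniform_closure_def)
qed

lemma star_subalgebra_uniform_closure:
  fixes B :: "('r \<Rightarrow> 'i cop) set"
  assumes B: "star_subalgebra B"
  shows "star_subalgebra (uniform_closure B)"
  unfolding star_subalgebra_def
proof (intro conjI ballI allI)
  have appr: "\<exists>y\<in>B. \<forall>\<rho>. norm (x \<rho> - y \<rho>) \<le> e" if "x \<in> uniform_closure B" "0 < e" for x e
    using that by (auto simp: uniform_closure_def)
  have bdd: "\<exists>K>0. \<forall>\<rho>. norm (x \<rho>) \<le> K" if x: "x \<in> uniform_closure B" for x
  proof -
    obtain K where K: "\<And>\<rho>. norm (x \<rho>) \<le> K" using x by (auto simp: uniform_closure_def)
    have "norm (x \<rho>) \<le> max 1 K" for \<rho>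
      using K[of \<rho>] by simp
    then show ?thesis by (intro exI[of _ "max 1 K"]) auto
  qed
  show "0 \<in> uniform_closure B"
    using star_subalgebraD(1)[OF B] by (auto simp: uniform_closure_def family_simps intro!: bexI[of _ 0])
  fix x assume x: "x \<in> uniform_closure B"
  obtain K where K: "K > 0" "\<And>\<rho>. norm (x \<rho>) \<le> K" using bdd[OF x] by blast
  have "\<exists>y\<in>B. \<forall>\<rho>. norm (star x \<rho> - y \<rho>) \<le> e" if e: "0 < e" for e
  proof -
    obtain y where "y \<in> B" "\<And>\<rho>. norm (x \<rho> - y \<rho>) \<le> e" using appr[OF x e] by blast
    then show ?thesis
      by (intro bexI[of _ "star y"] star_subalgebraD(4)[OF B])
         (auto simp: family_simps star_cop_diff[symmetric])
  qed
  then show "star x \<in> uniform_closure B"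
    using K by (auto simp: uniform_closure_def family_simps)
  show "c *\<^sub>C x \<in> uniform_closure B" for c
  proof -
    have "\<exists>y\<in>B. \<forall>\<rho>. norm ((c *\<^sub>C x) \<rho> - y \<rho>) \<le> e" if e: "0 < e" for e
    proof -
      have c1: "0 < cmod c + 1"
        using norm_ge_zero[of c] by linarith
      obtain y where y: "y \<in> B" "\<And>\<rho>. norm (x \<rho> - y \<rho>) \<le> e / (cmod c + 1)"
        using appr[OF x, of "e / (cmod c + 1)"] e c1 by auto
      have "norm (c *\<^sub>C x \<rho> - c *\<^sub>C y \<rho>) \<le> e" for \<rho>
      proof -
        have "norm (c *\<^sub>C x \<rho> - c *\<^sub>C y \<rho>) \<le> (cmod c + 1) * (e / (cmod c + 1))"
          unfolding scaleC_diff_right_cop[symmetric] norm_scaleC_cop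
          using c1 by (intro mult_mono y(2)) auto
        then show ?thesis using c1 by simp
      qed
      then show ?thesis
        by (intro bexI[of _ "c *\<^sub>C y"] star_subalgebraD(5)[OF B] y(1)) (simp add: family_simps)
    qed
    moreover have "norm ((c *\<^sub>C x) \<rho>) \<le> cmod c * K" for \<rho>
      by (simp add: family_simps norm_scaleC_cop K(2) mult_left_mono)
    ultimately show ?thesis by (auto simp: uniform_closure_def)
  qed
  fix y assume y: "y \<in> uniform_closure B"
  obtain L where L: "L > 0" "\<And>\<rho>. norm (y \<rho>) \<le> L" using bdd[OF y] by blast
  have "\<exists>z\<in>B. \<forall>\<rho>. norm ((x + y) \<rho> - z \<rho>) \<le> e" if e: "0 < e" for e
  proof -
    obtain x' y' where x': "x' \<in> B" "\<And>\<rho>. norm (x \<rho> - x' \<rho>) \<le> e / 2"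
      and y': "y' \<in> B" "\<And>\<rho>. norm (y \<rho> - y' \<rho>) \<le> e / 2"
      using appr[OF x, of "e / 2"] appr[OF y, of "e / 2"] e by auto
    have "norm ((x + y) \<rho> - (x' + y') \<rho>) \<le> e" for \<rho>
      using norm_triangle_ineq[of "x \<rho> - x' \<rho>" "y \<rho> - y' \<rho>"] x'(2)[of \<rho>] y'(2)[of \<rho>]
      by (simp add: family_simps algebra_simps)
    then show ?thesis using star_subalgebraD(2)[OF B x'(1) y'(1)] by blast
  qed
  moreover have "norm ((x + y) \<rho>) \<le> K + L" for \<rho>
    unfolding family_simps by (intro order_trans[OF norm_triangle_ineq] add_mono K L)
  ultimately show "x + y \<in> uniform_closure B" by (auto simp: uniform_closure_def)
  have "\<exists>z\<in>B. \<forall>\<rho>. norm ((x * y) \<rho> - z \<rho>) \<le> e" if e: "0 < e" for e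
  proof -
    \<comment> \<open>\<open>d\<close> bounds both errors. The splitting below costs
      \<open>d * L + (K + 1) * d\<close>, which is \<open>d * (K + L + 1)\<close>; the cap 1 keeps
      \<open>x'\<close> below \<open>K + 1\<close>.\<close>
    define d where "d = min 1 (e / (K + L + 1))"
    have KL: "0 < K + L + 1" using K(1) L(1) by simp
    have d: "0 < d" "d \<le> 1" using e KL by (simp_all add: d_def)
    have "d * (K + L + 1) \<le> e / (K + L + 1) * (K + L + 1)"
      using KL by (intro mult_right_mono) (simp_all add: d_def)
    then have de: "d * (K + L + 1) \<le> e" using KL by simp
    obtain x' y' where x': "x' \<in> B" "\<And>\<rho>. norm (x \<rho> - x' \<rho>) \<le> d"
      and y': "y' \<in> B" "\<And>\<rho>. norm (y \<rho> - y' \<rho>) \<le> d"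
      using appr[OF x d(1)] appr[OF y d(1)] by blast
    have "norm ((x * y) \<rho> - (x' * y') \<rho>) \<le> e" for \<rho>
    proof -
      have nx': "norm (x' \<rho>) \<le> K + 1"
        using norm_triangle_ineq4[of "x \<rho>" "x \<rho> - x' \<rho>"] K(2)[of \<rho>] x'(2)[of \<rho>] d(2) by simp
      have "x \<rho> * y \<rho> - x' \<rho> * y' \<rho> = (x \<rho> - x' \<rho>) * y \<rho> + x' \<rho> * (y \<rho> - y' \<rho>)"
        by (simp add: algebra_simps)
      also have "norm \<dots> \<le> d * L + (K + 1) * d"
        using d K L
        by (intro order_trans[OF norm_triangle_ineq] add_mono order_trans[OF norm_mult_ineq]
            mult_mono x'(2) y'(2) L(2) nx') auto
      also have "\<dots> \<le> e" using de by (simp add: algebra_simps)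
      finally show ?thesis by (simp add: family_simps)
    qed
    then show ?thesis using star_subalgebraD(3)[OF B x'(1) y'(1)] by blast
  qed
  moreover have "norm ((x * y) \<rho>) \<le> K * L" for \<rho>
    unfolding family_simps using K(1) by (intro order_trans[OF norm_mult_ineq] mult_mono K L) auto
  ultimately show "x * y \<in> uniform_closure B" by (auto simp: uniform_closure_def)
qed


section \<open>Orbits of a unit on the p-adic integers\<close>

lemma binomial_expansion_mod_square:
  fixes y :: int
  shows "\<exists>w. (1 + y) ^ m = 1 + int m * y + y\<^sup>2 * w"
proof (induction m)
  case (Suc m)
  then obtain w where "(1 + y) ^ m = 1 + int m * y + y\<^sup>2 * w" by blast
  then have "(1 + y) ^ Suc m = 1 + int (Suc m) * y + y\<^sup>2 * (int m + w + y * w)"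
    by (simp add: algebra_simps power2_eq_square)
  then show ?case by blast
qed (auto intro: exI[of _ 0])

text \<open>Factor \<open>g ^ p - 1\<close> as \<open>g - 1\<close> times the sum of the
  \<open>g ^ i\<close> with \<open>i < p\<close>. That sum is \<open>p\<close> times an integer
  congruent to 1 mod \<open>p\<close>, so exactly one factor \<open>p\<close> is gained. For p = 2
  this fails: the square of 3 is 1 + 8.\<close>

lemma prime_power_lift:
  fixes g b :: int
  assumes p: "prime p" "odd p" and N: "N \<ge> 1"
    and g: "g = 1 + int p ^ N * b" and b: "\<not> int p dvd b"
  shows "\<exists>b'. g ^ p = 1 + int p ^ Suc N * b' \<and> \<not> int p dvd b'"
proof -
  define c where "c = int p ^ (N - 1) * b"
  have gc: "g = 1 + int p * c"
    using N by (cases N) (auto simp: g c_def)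
  have "\<forall>i. \<exists>w. g ^ i = 1 + int i * (int p * c) + (int p * c)\<^sup>2 * w"
    unfolding gc using binomial_expansion_mod_square by blast
  then obtain w where w: "\<And>i. g ^ i = 1 + int i * (int p * c) + (int p * c)\<^sup>2 * w i"
    by metis
  \<comment> \<open>Oddness enters here: the sum of all \<open>i < p\<close> is
    \<open>p * m\<close>, so the linear terms together contribute a multiple of the square of
    \<open>p\<close>.\<close>
  obtain m where m: "p = 2 * m + 1" using p(2) by (auto elim: oddE)
  have "(\<Sum>i<n. int i) * 2 = int n * (int n - 1)" for n
    by (induction n) (auto simp: algebra_simps)
  from this[of p] have si: "(\<Sum>i<p. int i) = int p * int m"
    by (simp add: m)
  define z where "z = c * int m + c\<^sup>2 * (\<Sum>i<p. w i)"
  have "(\<Sum>i<p. g ^ i) = int p + (\<Sum>i<p. int i) * (int p * c) + (int p * c)\<^sup>2 * (\<Sum>i<p. w i)"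
    by (simp add: w sum.distrib sum_distrib_left sum_distrib_right)
  also have "\<dots> = int p * (1 + int p * z)"
    by (simp add: si z_def algebra_simps power2_eq_square)
  finally have "g ^ p - 1 = int p ^ N * b * (int p * (1 + int p * z))"
    using power_diff_1_eq[of g p] by (simp add: g)
  then have "g ^ p = 1 + int p ^ Suc N * (b * (1 + int p * z))"
    by (simp add: algebra_simps)
  moreover have "\<not> int p dvd b * (1 + int p * z)"
  proof
    assume "int p dvd b * (1 + int p * z)"
    then have "int p dvd 1 + int p * z"
      using b p(1) by (simp add: prime_dvd_mult_iff)
    then have "int p dvd 1" by (simp add: dvd_add_left_iff)
    then show False using p(1) by (simp add: prime_gt_1_nat)
  qed
  ultimately show ?thesis by blast
qed

text \<open>Prime by prime: a finite exponent below a supremum of finite exponents is already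
  reached by one of them. Only the finitely many primes of \<open>l\<close> matter, and along a
  divisibility chain the indices found for them may be replaced by the largest.\<close>

lemma supernatural_le_SUP_dvd:
  fixes e :: "nat \<Rightarrow> nat"
  assumes l: "l > 0" and e: "\<And>N. N \<ge> 1 \<Longrightarrow> e N > 0"
    and chain: "\<And>N M. 1 \<le> N \<Longrightarrow> N \<le> M \<Longrightarrow> e N dvd e M"
    and le: "supernatural_of_nat l \<le> (SUP N\<in>{1..}. supernatural_of_nat (e N))"
  shows "\<exists>N\<ge>1. l dvd e N"
proof -
  have ex: "\<exists>N\<ge>1. multiplicity q l \<le> multiplicity q (e N)" if q: "prime q" for q
  proof (rule ccontr)
    assume "\<not> (\<exists>N\<ge>1. multiplicity q l \<le> multiplicity q (e N))"
    then have lt: "\<And>N. N \<ge> 1 \<Longrightarrow> multiplicity q (e N) < multiplicity q l"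
      by (meson not_le)
    have "enat (multiplicity q l) \<le> (SUP N\<in>{1..}. enat (multiplicity q (e N)))"
      using le_funD[OF le, of q] q by (simp add: supernatural_of_nat_def SUP_apply image_comp)
    also have "\<dots> \<le> enat (multiplicity q l - 1)"
      using lt by (intro SUP_least) force
    finally show False using lt[of 1] by simp
  qed
  then obtain n where n: "\<And>q. prime q \<Longrightarrow> n q \<ge> 1 \<and> multiplicity q l \<le> multiplicity q (e (n q))"
    by metis
  define N where "N = Max (insert 1 (n ` prime_factors l))"
  have N1: "N \<ge> 1" by (auto simp: N_def)
  have "multiplicity q l \<le> multiplicity q (e N)" if q: "prime q" for q
  proof (cases "q \<in> prime_factors l")
    case True
    then have "n q \<le> N" by (auto simp: N_def)
    then have "multiplicity q (e (n q)) \<le> multiplicity q (e N)"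
      using chain[of "n q" N] n[OF q] e[OF N1] by (intro dvd_imp_multiplicity_le) auto
    then show ?thesis using n[OF q] by auto
  next
    case False
    then have "\<not> q dvd l" using l q by (auto simp: prime_factors_dvd)
    then show ?thesis by (simp add: not_dvd_imp_multiplicity_0)
  qed
  then have "l dvd e N"
    using l by (intro multiplicity_le_imp_dvd) auto
  with N1 show ?thesis by blast
qed

lemma padic_carrierD:
  assumes "x \<in> carrier (padic_integers p)"
  shows "0 \<le> x N" "x N < int p ^ N"
    and padic_mod: "N \<le> M \<Longrightarrow> x M mod int p ^ N = x N"
proof -
  have x: "x n \<in> {0..<int p ^ n}" "x (Suc n) mod int p ^ n = x n" for n
    using assms by (auto simp: padic_integers_def)
  show "0 \<le> x N" "x N < int p ^ N" using x by auto
  show "x M mod int p ^ N = x N" if "N \<le> M"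
    using that
  proof (induction M rule: dec_induct)
    case base
    show ?case using x(1)[of N] by simp
  next
    case (step M)
    have "x (Suc M) mod int p ^ N = x (Suc M) mod int p ^ M mod int p ^ N"
      using step(1) by (simp add: mod_mod_cancel le_imp_power_dvd)
    with step x(2) show ?case by simp
  qed
qed

lemma padic_mult_level: "(x \<otimes>\<^bsub>padic_integers p\<^esub> y) N = x N * y N mod int p ^ N"
  and padic_one_level: "\<one>\<^bsub>padic_integers p\<^esub> N = 1 mod int p ^ N"
  and padic_zero_level: "\<zero>\<^bsub>padic_integers p\<^esub> N = 0"
  by (simp_all add: padic_integers_def)


text \<open>The interface between arithmetic and analysis; \<open>pts j k\<close> is the point y_j
  r^k. The conditions speak of residues mod p^N because functions of finite level are dense.
  \<open>pts_dense\<close> also covers the residue of 0. \<open>pts_null\<close> is uniform in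
  \<open>k\<close> and gives norm convergence to the value at \<open>pi0\<close>;
  \<open>pts_period\<close> keeps the diagonals in the Bunce-Deddens algebra, and
  \<open>pts_separate\<close> makes the image exhaust it.\<close>

locale orbit_system =
  fixes p :: nat and r :: padic and S :: supernatural and pts :: "nat \<Rightarrow> int \<Rightarrow> padic"
  assumes p_pos: "0 < p" and r_unit: "r \<in> Units (padic_integers p)"
    and pts_carrier: "pts j k \<in> carrier (padic_integers p)"
    and pts_step: "pts j k \<otimes>\<^bsub>padic_integers p\<^esub> inv\<^bsub>padic_integers p\<^esub> r = pts j (k - 1)"
    and pts_dense: "x \<in> carrier (padic_integers p) \<Longrightarrow> \<exists>j k. pts j k N = x N"
    and pts_null: "\<exists>J. \<forall>j\<ge>J. \<forall>k. pts j k N = 0"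
    and pts_period: "\<exists>l>0. supernatural_of_nat l \<le> S \<and> (\<forall>j k. pts j (k + int l) N = pts j k N)"
    and pts_separate: "0 < l \<Longrightarrow> supernatural_of_nat l \<le> S \<Longrightarrow>
      \<exists>N. \<forall>i k k'. pts i k N = pts j k' N \<longrightarrow> i = j \<and> int l dvd k - k'"
    and level_dilation: "x \<in> carrier (padic_integers p) \<Longrightarrow> y \<in> carrier (padic_integers p) \<Longrightarrow>
      (x \<otimes>\<^bsub>padic_integers p\<^esub> inv\<^bsub>padic_integers p\<^esub> r) N
        = (y \<otimes>\<^bsub>padic_integers p\<^esub> inv\<^bsub>padic_integers p\<^esub> r) N \<longleftrightarrow> x N = y N"

locale padic_unit =
  fixes p :: nat and r :: padic
  assumes p: "prime p" "odd p"
    and r: "r \<in> Units (padic_integers p)"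
    and not_root: "\<not> (\<exists>n :: nat. n > 0 \<and> r [^]\<^bsub>padic_integers p\<^esub> n = \<one>\<^bsub>padic_integers p\<^esub>)"
begin

abbreviation "Z \<equiv> padic_integers p"

sublocale Z: cring Z
  by (rule cring_padic_integers) (use p prime_gt_0_nat in blast)

sublocale U: group "units_of Z"
  by (rule Z.units_group)

text \<open>Powers are taken in the group of units, so that negative exponents are
  available.\<close>

definition rpow :: "int \<Rightarrow> padic"
  where "rpow k = r [^]\<^bsub>units_of Z\<^esub> k"

lemma rpow_Units: "rpow k \<in> Units Z"
  using U.int_pow_closed[of r k] r by (simp add: rpow_def units_of_carrier)

lemma rpow_carrier: "rpow k \<in> carrier Z"
  using rpow_Units by (rule Z.Units_closed)

lemma rpow_0: "rpow 0 = \<one>\<^bsub>Z\<^esub>"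
  by (simp add: rpow_def units_of_one)

lemma rpow_add: "rpow (k + l) = rpow k \<otimes>\<^bsub>Z\<^esub> rpow l"
  using U.int_pow_mult[of r k l] r by (simp add: rpow_def units_of_mult units_of_carrier)

lemma rpow_1: "rpow 1 = r"
  using r by (simp add: rpow_def units_of_carrier U.int_pow_1)

lemma rpow_minus_1: "rpow (- 1) = inv\<^bsub>Z\<^esub> r"
  using U.int_pow_neg[of r 1] r by (simp add: rpow_def units_of_carrier U.int_pow_1 Z.units_of_inv)

lemma rpow_nat: "rpow (int n) = r [^]\<^bsub>Z\<^esub> n"
  using r by (simp add: rpow_def int_pow_int Z.units_of_pow)

lemma pN_pos: "0 < int p ^ N"
  using p prime_gt_0_nat by simp

lemma rpow_add_cong: "[rpow (k + l) N = rpow k N * rpow l N] (mod int p ^ N)"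
  by (simp add: rpow_add padic_mult_level cong_def)

lemma rpow_0_cong: "[rpow 0 N = 1] (mod int p ^ N)"
  by (simp add: rpow_0 padic_one_level cong_def)

lemma rpow_mod: "N \<le> M \<Longrightarrow> [rpow k M = rpow k N] (mod int p ^ N)"
  using padic_mod[OF rpow_carrier, of N M] padic_mod[OF rpow_carrier, of N N]
  by (simp add: cong_def)

lemma rpow_coprime: "N \<ge> 1 \<Longrightarrow> coprime (rpow k N) (int p)"
proof -
  assume N: "N \<ge> 1"
  have "[rpow k N * rpow (- k) N = 1] (mod int p ^ N)"
    using rpow_add_cong[of k "- k" N] rpow_0_cong[of N] by (simp add: cong_def)
  then have "coprime (rpow k N) (int p ^ N)"
    using coprime_iff_invertible_int by blast
  with N show ?thesis by simp
qed

lemma rpow_mult_cong: "[rpow (k * int m) N = rpow k N ^ m] (mod int p ^ N)"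
proof (induction m)
  case 0
  then show ?case using rpow_0_cong by simp
next
  case (Suc m)
  have "[rpow (k * int m + k) N = rpow k N ^ m * rpow k N] (mod int p ^ N)"
    using rpow_add_cong cong_scalar_right[OF Suc] cong_trans by blast
  then show ?case by (simp add: algebra_simps)
qed

definition level_ord :: "nat \<Rightarrow> nat"
  where "level_ord N = group.ord (units_of (residue_ring (int p ^ N))) (r N)"

lemma
  assumes N: "N \<ge> 1"
  shows level_ord_pos: "level_ord N > 0"
    and rpow_eq_1_iff: "[rpow k N = 1] (mod int p ^ N) \<longleftrightarrow> int (level_ord N) dvd k"
proof -
  have m1: "1 < int p ^ N"
    using p N prime_gt_1_nat by (simp add: one_less_power)
  interpret R: residues "int p ^ N" "residue_ring (int p ^ N)"
    by unfold_locales (use m1 in auto)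
  interpret UR: group "units_of (residue_ring (int p ^ N))"
    by (rule R.units_group)
  have rc: "r \<in> carrier Z" using r by (rule Z.Units_closed)
  have rr: "r N mod int p ^ N = r N" using padic_mod[OF rc, of N N] by simp
  have cop: "coprime (r N) (int p ^ N)"
    using rpow_coprime[OF N, of 1] by (simp add: rpow_1)
  then have "r N \<noteq> 0" using m1 by auto
  then have mem: "r N \<in> Units (residue_ring (int p ^ N))"
    using padic_carrierD[OF rc, of N] cop by (auto simp: R.res_units_eq less_le)
  have "finite (Units (residue_ring (int p ^ N)))"
    using R.finite_Units .
  then show "level_ord N > 0"
    using UR.ord_ge_1[of "r N"] mem by (simp add: level_ord_def units_of_carrier)
  have nat: "[rpow (int n) N = 1] (mod int p ^ N) \<longleftrightarrow> level_ord N dvd n" for n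
  proof -
    have "r N [^]\<^bsub>units_of (residue_ring (int p ^ N))\<^esub> n = r N ^ n mod int p ^ N"
      using R.pow_cong[of "r N" n] mem by (simp add: R.units_of_pow rr)
    then have "level_ord N dvd n \<longleftrightarrow> r N ^ n mod int p ^ N = 1"
      using UR.pow_eq_id[of "r N" n] mem
      by (simp add: level_ord_def units_of_carrier units_of_one R.one_cong[symmetric] R.res_one_eq)
    moreover have "[rpow (int n) N = r N ^ n] (mod int p ^ N)"
      using rpow_mult_cong[of 1 n N] by (simp add: rpow_1)
    ultimately show ?thesis
      using m1 by (simp add: cong_def)
  qed
  \<comment> \<open>Handles negative exponents: the inverse of a power congruent to 1 is congruent
    to 1.\<close>
  have inv: "[rpow (- k) N = 1] (mod int p ^ N)" if "[rpow k N = 1] (mod int p ^ N)" for k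
  proof -
    have "[rpow (- k) N * rpow k N = 1] (mod int p ^ N)"
      using rpow_add_cong[of "- k" k N] rpow_0_cong[of N] by (simp add: cong_def)
    moreover have "[rpow (- k) N * rpow k N = rpow (- k) N * 1] (mod int p ^ N)"
      using that by (rule cong_scalar_left)
    ultimately show ?thesis by (simp add: cong_def)
  qed
  show "[rpow k N = 1] (mod int p ^ N) \<longleftrightarrow> int (level_ord N) dvd k"
  proof (cases "k \<ge> 0")
    case True
    then show ?thesis using nat[of "nat k"] by (simp add: int_dvd_int_iff[symmetric] del: int_dvd_int_iff)
  next
    case False
    then show ?thesis
      using nat[of "nat (- k)"] inv[of k] inv[of "- k"]
      by (auto simp: int_dvd_int_iff[symmetric] simp del: int_dvd_int_iff)
  qed
qed

lemma level_ord_dvd: "1 \<le> N \<Longrightarrow> N \<le> M \<Longrightarrow> level_ord N dvd level_ord M"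
proof -
  assume NM: "1 \<le> N" "N \<le> M"
  have "[rpow (int (level_ord M)) M = 1] (mod int p ^ M)"
    using rpow_eq_1_iff[of M] NM by simp
  then have "[rpow (int (level_ord M)) M = 1] (mod int p ^ N)"
    using NM by (meson cong_dvd_modulus le_imp_power_dvd)
  then have "[rpow (int (level_ord M)) N = 1] (mod int p ^ N)"
    using rpow_mod[OF NM(2), of "int (level_ord M)"] by (simp add: cong_def)
  then show ?thesis using rpow_eq_1_iff[OF NM(1)] by simp
qed

lemma rpow_cong_iff:
  assumes N: "N \<ge> 1"
  shows "[rpow k N = rpow l N] (mod int p ^ N) \<longleftrightarrow> int (level_ord N) dvd k - l"
proof -
  have "[rpow k N = rpow (k - l) N * rpow l N] (mod int p ^ N)"
    using rpow_add_cong[of "k - l" l N] by simp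
  then have "[rpow k N = rpow l N] (mod int p ^ N)
      \<longleftrightarrow> [rpow (k - l) N * rpow l N = 1 * rpow l N] (mod int p ^ N)"
    by (simp add: cong_def)
  also have "\<dots> \<longleftrightarrow> [rpow (k - l) N = 1] (mod int p ^ N)"
    using rpow_coprime[OF N] by (intro cong_mult_rcancel) simp
  finally show ?thesis using rpow_eq_1_iff[OF N] by simp
qed

text \<open>For \<open>N \<ge> 1\<close>: the powers of \<open>r\<close> that lie in 1 + p^N Z_p
  have nontrivial image in the quotient by 1 + p^(N+1) Z_p. This quotient has order p, so they fill
  it.\<close>

definition exact_level :: "nat \<Rightarrow> bool"
  where "exact_level N \<longleftrightarrow> (\<exists>k. [rpow k N = 1] (mod int p ^ N)
    \<and> \<not> [rpow k (Suc N) = 1] (mod int p ^ Suc N))"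

text \<open>Turns the two congruences, which live at different levels, into one equation between
  integers at a common level \<open>M\<close>.\<close>

lemma exact_levelE:
  assumes "exact_level N" "M \<ge> Suc N"
  obtains k b where "rpow k M = 1 + int p ^ N * b" "\<not> int p dvd b"
proof -
  obtain k where k: "[rpow k N = 1] (mod int p ^ N)" "\<not> [rpow k (Suc N) = 1] (mod int p ^ Suc N)"
    using assms by (auto simp: exact_level_def)
  have "[rpow k M = 1] (mod int p ^ N)"
    using rpow_mod[of N M k] k(1) assms(2) by (simp add: cong_def)
  then obtain b where b: "rpow k M = 1 + int p ^ N * b"
    by (metis cong_iff_lin cong_sym)
  have "\<not> int p dvd b"
  proof
    assume "int p dvd b"
    then have "[rpow k M = 1] (mod int p ^ Suc N)"
      by (auto simp: b cong_iff_dvd_diff)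
    then have "[rpow k (Suc N) = 1] (mod int p ^ Suc N)"
      using rpow_mod[OF assms(2), of k] by (simp add: cong_def)
    with k(2) show False by simp
  qed
  with b that show ?thesis by blast
qed

text \<open>By \<open>prime_power_lift\<close>, the p-th power of a witness for \<open>N\<close> is
  a witness for \<open>N + 1\<close>.\<close>

lemma exact_level_Suc:
  assumes "exact_level N" "N \<ge> 1"
  shows "exact_level (Suc N)"
proof -
  \<comment> \<open>A residue of level \<open>M\<close> is informative only mod
    \<open>p ^ M\<close>, and the failure to be shown is one mod \<open>p ^ (N + 2)\<close>.\<close>
  obtain k b where kb: "rpow k (Suc (Suc N)) = 1 + int p ^ N * b" "\<not> int p dvd b"
    by (rule exact_levelE[OF assms(1), of "Suc (Suc N)"]) auto
  obtain b' where b': "rpow k (Suc (Suc N)) ^ p = 1 + int p ^ Suc N * b'" "\<not> int p dvd b'"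
    using prime_power_lift[OF p assms(2) kb] by blast
  let ?k = "k * int p"
  have c: "[rpow ?k (Suc (Suc N)) = 1 + int p ^ Suc N * b'] (mod int p ^ Suc (Suc N))"
    using rpow_mult_cong[of k p "Suc (Suc N)"] b'(1) by simp
  have "[rpow ?k (Suc (Suc N)) = 1 + int p ^ Suc N * b'] (mod int p ^ Suc N)"
    by (rule cong_dvd_modulus[OF c]) (simp add: le_imp_power_dvd)
  moreover have "[1 + int p ^ Suc N * b' = 1] (mod int p ^ Suc N)"
    by (simp add: cong_iff_dvd_diff)
  ultimately have "[rpow ?k (Suc N) = 1] (mod int p ^ Suc N)"
    using rpow_mod[of "Suc N" "Suc (Suc N)" ?k] by (simp add: cong_def)
  moreover have "\<not> [rpow ?k (Suc (Suc N)) = 1] (mod int p ^ Suc (Suc N))"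
  proof
    assume "[rpow ?k (Suc (Suc N)) = 1] (mod int p ^ Suc (Suc N))"
    then have "[1 + int p ^ Suc N * b' = 1] (mod int p ^ Suc (Suc N))"
      using c by (meson cong_sym cong_trans)
    then have "int p ^ Suc N * int p dvd int p ^ Suc N * b'"
      by (simp add: cong_iff_dvd_diff mult.commute)
    then show False
      using b'(2) pN_pos[of "Suc N"] by (subst (asm) dvd_mult_cancel_left) auto
  qed
  ultimately show ?thesis by (auto simp: exact_level_def)
qed

text \<open>With \<open>d\<close> the order of \<open>r\<close> mod \<open>p\<close>, the power r^d
  is 1 mod \<open>p\<close> but differs from 1, as \<open>r\<close> is no root of unity. The last
  level before it first differs from 1 is exact, and exactness propagates upwards.\<close>

lemma ex_exact_level: "\<exists>s\<ge>1. \<forall>N\<ge>s. exact_level N"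
proof -
  define d where "d = level_ord 1"
  have d: "d > 0" by (simp add: d_def level_ord_pos)
  then have "rpow (int d) \<noteq> \<one>\<^bsub>Z\<^esub>"
    using not_root rpow_nat[of d] by metis
  then obtain N where "rpow (int d) N \<noteq> \<one>\<^bsub>Z\<^esub> N" by auto
  then have ex: "\<not> [rpow (int d) N = 1] (mod int p ^ N)"
    using padic_mod[OF rpow_carrier, of N N] by (simp add: cong_def padic_one_level)
  define M where "M = (LEAST N. \<not> [rpow (int d) N = 1] (mod int p ^ N))"
  have M: "\<not> [rpow (int d) M = 1] (mod int p ^ M)"
    unfolding M_def using ex by (rule LeastI)
  have M': "[rpow (int d) N = 1] (mod int p ^ N)" if "N < M" for N
    using not_less_Least[OF that[unfolded M_def]] by simp
  \<comment> \<open>Mod \<open>p ^ 0\<close> everything is congruent, and mod \<open>p\<close> the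
    choice of \<open>d\<close> gives 1. Hence \<open>s \<ge> 1\<close>, which the lifting
    requires.\<close>
  have "M \<noteq> 0" using M by (metis cong_1 power_0)
  moreover have "M \<noteq> 1" using M rpow_eq_1_iff[of 1 "int d"] by (auto simp: d_def)
  ultimately obtain s where s: "M = Suc s" "s \<ge> 1" by (cases M) auto
  have "exact_level s"
    using M M'[of s] by (auto simp: exact_level_def s)
  have "exact_level N" if "N \<ge> s" for N
    using that
  proof (induction N rule: dec_induct)
    case base
    show ?case by (rule \<open>exact_level s\<close>)
  next
    case (step N)
    then show ?case using s exact_level_Suc by simp
  qed
  with s show ?thesis by blast
qed

text \<open>A power of \<open>r\<close> at distance exactly \<open>p\<close> to the \<open>- N\<close> from \<open>1\<close> corrects the \<open>N\<close>-th digit.\<close>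

lemma orbit_lift_Suc:
  assumes N: "exact_level N" "N \<ge> 1" and w: "coprime w (int p)"
    and k: "[w * rpow k N = u] (mod int p ^ N)"
  shows "\<exists>k. [w * rpow k (Suc N) = u] (mod int p ^ Suc N)"
proof -
  obtain l b where b: "rpow l (Suc N) = 1 + int p ^ N * b" "\<not> int p dvd b"
    by (rule exact_levelE[OF N(1), of "Suc N"]) auto
  define v where "v = rpow k (Suc N)"
  have v: "coprime v (int p)" by (simp add: v_def rpow_coprime)
  have "[w * v = w * rpow k N] (mod int p ^ N)"
    unfolding v_def by (intro cong_scalar_left rpow_mod) simp
  with k have "[u = w * v] (mod int p ^ N)" by (simp add: cong_def)
  then obtain t where t: "w * v = u + int p ^ N * t"
    by (metis cong_iff_lin)
  have "coprime b (int p)"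
    using b(2) p(1) prime_imp_coprime[of "int p" b] by (simp add: coprime_commute)
  with w v have "coprime (w * v * b) (int p)" by simp
  then obtain x where x: "[w * v * b * x = 1] (mod int p)"
    using cong_solve_coprime_int by blast
  \<comment> \<open>The discrepancy in digit \<open>N\<close> is \<open>t\<close> mod
    \<open>p\<close>, and \<open>m\<close> factors \<open>rpow l\<close> change it by
    \<open>w * v * b * m\<close>. As \<open>x\<close> inverts \<open>w * v * b\<close> mod
    \<open>p\<close>, the residue of \<open>- t * x\<close> cancels it.\<close>
  define m where "m = nat ((- t * x) mod int p)"
  have m: "int m = (- t * x) mod int p"
    unfolding m_def using p(1) prime_gt_0_nat by simp
  have "[t + w * v * b * int m = t + w * v * b * (- t * x)] (mod int p)"
    unfolding m by (intro cong_add cong_mult cong_refl) (simp add: cong_def)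
  also have "t + w * v * b * (- t * x) = t - t * (w * v * b * x)"
    by (simp add: algebra_simps)
  also have "[\<dots> = t - t * 1] (mod int p)"
    by (intro cong_diff cong_mult cong_refl x)
  finally obtain q where q: "t + w * v * b * int m = int p * q"
    by (auto simp: cong_0_iff)
  obtain z where z: "(1 + int p ^ N * b) ^ m = 1 + int m * (int p ^ N * b) + (int p ^ N * b)\<^sup>2 * z"
    using binomial_expansion_mod_square by blast
  have "w * (v * rpow l (Suc N) ^ m)
      = u + int p ^ N * (t + w * v * b * int m) + (int p ^ N * int p ^ N) * (w * v * b\<^sup>2 * z)"
  proof -
    have "w * (v * rpow l (Suc N) ^ m)
        = w * v + int p ^ N * (w * v * b * int m) + (int p ^ N * int p ^ N) * (w * v * b\<^sup>2 * z)"
      unfolding b(1) z by (simp add: algebra_simps power2_eq_square)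
    then show ?thesis unfolding t by (simp add: algebra_simps)
  qed
  \<comment> \<open>Since \<open>N \<ge> 1\<close>, the square of \<open>p ^ N\<close> is divisible
    by \<open>p ^ (N + 1)\<close>, so the quadratic remainder of the expansion drops out.\<close>
  also have "int p ^ N * int p ^ N = int p ^ Suc N * int p ^ (N - 1)"
    using N(2) by (cases N) auto
  also have "u + int p ^ N * (t + w * v * b * int m) + int p ^ Suc N * int p ^ (N - 1) * (w * v * b\<^sup>2 * z)
      = u + int p ^ Suc N * (q + int p ^ (N - 1) * (w * v * b\<^sup>2 * z))"
    by (simp only: q) (simp add: algebra_simps)
  finally have "[w * (v * rpow l (Suc N) ^ m) = u] (mod int p ^ Suc N)"
    by (simp add: cong_iff_dvd_diff)
  moreover have "[rpow (k + l * int m) (Suc N) = v * rpow l (Suc N) ^ m] (mod int p ^ Suc N)"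
    unfolding v_def by (meson rpow_add_cong rpow_mult_cong cong_scalar_left cong_trans)
  ultimately have "[w * rpow (k + l * int m) (Suc N) = u] (mod int p ^ Suc N)"
    by (meson cong_scalar_left cong_trans)
  then show ?thesis by blast
qed

text \<open>Openness of the closure of the powers of \<open>r\<close> in finite form: whether the
  orbit of \<open>w\<close> meets \<open>u\<close> to any given precision is decided mod
  \<open>p ^ s\<close>.\<close>

lemma orbit_lift:
  assumes s: "\<forall>N\<ge>s. exact_level N" "s \<ge> 1" and w: "coprime w (int p)"
    and k: "[w * rpow k s = u] (mod int p ^ s)" and N: "N \<ge> s"
  shows "\<exists>k. [w * rpow k N = u] (mod int p ^ N)"
  using N
proof (induction N rule: dec_induct)
  case base
  then show ?case using k by blast
next
  case (step N)
  then show ?case using orbit_lift_Suc[of N w] s w by auto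
qed

text \<open>The units mod \<open>p ^ s\<close> fall into finitely many cosets of the powers of
  \<open>r\<close>; \<open>c\<close> lists the least element of each. By \<open>orbit_lift\<close>
  the same list serves at every higher level.\<close>

lemma ex_orbit_representatives:
  assumes s: "s \<ge> 1"
  shows "\<exists>h>0. \<exists>c :: nat \<Rightarrow> int. (\<forall>i<h. coprime (c i) (int p))
    \<and> (\<forall>u. coprime u (int p) \<longrightarrow> (\<exists>i<h. \<exists>k. [c i * rpow k s = u] (mod int p ^ s)))
    \<and> (\<forall>i<h. \<forall>j<h. \<forall>k l. [c i * rpow k s = c j * rpow l s] (mod int p ^ s) \<longrightarrow> i = j)"
proof -
  let ?m = "int p ^ s"
  define U where "U = {u \<in> {0..<?m}. coprime u (int p)}"
  define rel where "rel u w \<longleftrightarrow> (\<exists>k. [u * rpow k s = w] (mod ?m))" for u w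
  have sym: "rel w u" if ab: "[u * rpow k s = w * rpow l s] (mod ?m)" for u w k l
  proof -
    have "[w * rpow (l - k) s = w * (rpow l s * rpow (- k) s)] (mod ?m)"
      using rpow_add_cong[of l "- k" s] by (intro cong_scalar_left) simp
    moreover have "[w * (rpow l s * rpow (- k) s) = u * (rpow k s * rpow (- k) s)] (mod ?m)"
      using cong_scalar_right[OF cong_sym[OF ab], of "rpow (- k) s"] by (simp add: mult.assoc)
    moreover have "[u * (rpow k s * rpow (- k) s) = u * 1] (mod ?m)"
      using rpow_add_cong[of k "- k" s] rpow_0_cong[of s]
      by (intro cong_scalar_left) (simp add: cong_def)
    ultimately show ?thesis unfolding rel_def by (metis cong_trans mult.right_neutral)
  qed
  have sym': "rel w u" if "rel u w" for u w
  proof -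
    have "[w = w * rpow 0 s] (mod ?m)"
      using cong_scalar_left[OF cong_sym[OF rpow_0_cong[of s]], of w] by simp
    with that show ?thesis unfolding rel_def[of u w] using sym cong_trans by blast
  qed
  have trans: "rel u v" if uw: "rel u w" and wv: "rel w v" for u v w
  proof -
    obtain k l where k: "[u * rpow k s = w] (mod ?m)" and l: "[w * rpow l s = v] (mod ?m)"
      using uw wv by (auto simp: rel_def)
    have "[u * rpow (k + l) s = u * rpow k s * rpow l s] (mod ?m)"
      using cong_scalar_left[OF rpow_add_cong[of k l s], of u] by (simp add: mult.assoc)
    moreover have "[u * rpow k s * rpow l s = w * rpow l s] (mod ?m)"
      by (rule cong_scalar_right[OF k])
    ultimately show ?thesis using l unfolding rel_def by (metis cong_trans)
  qed
  define C where "C = {u \<in> U. \<forall>w\<in>U. rel u w \<longrightarrow> u \<le> w}"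
  have finU: "finite U"
    by (rule finite_subset[of _ "{0..<?m}"]) (auto simp: U_def)
  then have finC: "finite C" by (simp add: C_def)
  have rep: "\<exists>c\<in>C. rel c u" if u: "u \<in> U" for u
  proof -
    define A where "A = {w \<in> U. rel u w}"
    have "rel u u"
      using cong_scalar_left[OF rpow_0_cong[of s], of u] unfolding rel_def by auto
    then have A: "finite A" "A \<noteq> {}" using finU u by (auto simp: A_def)
    have MA: "Min A \<in> A" using A by (rule Min_in)
    have "Min A \<in> C"
      unfolding C_def using MA A(1) trans by (auto simp: A_def intro!: Min_le)
    with MA sym' show ?thesis by (auto simp: A_def)
  qed
  obtain c where c: "bij_betw c {0..<card C} C"
    using ex_bij_betw_nat_finite[OF finC] by blast
  have cC: "c i \<in> C" if "i < card C" for i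
    using c that by (auto simp: bij_betw_def)
  have red: "\<exists>i<card C. \<exists>k. [c i * rpow k s = u] (mod ?m)" if u: "coprime u (int p)" for u
  proof -
    have "coprime u ?m" using u by simp
    then have "coprime (u mod ?m) ?m"
      using pN_pos[of s] by (subst coprime_mod_left_iff) auto
    then have "coprime (u mod ?m) (int p)"
      using s by (metis coprime_power_right_iff not_one_le_zero)
    then have "u mod ?m \<in> U"
      using pN_pos[of s] by (simp add: U_def)
    from rep[OF this] obtain w where w: "w \<in> C" "rel w (u mod ?m)" by blast
    then have "w \<in> c ` {0..<card C}" using c by (simp add: bij_betw_def)
    then obtain i where "i < card C" "c i = w" by auto
    with w show ?thesis by (auto simp: rel_def cong_def)
  qed
  \<comment> \<open>The coset of 1 shows that the list is nonempty, so that division by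
    \<open>h\<close> makes sense later.\<close>
  have "\<exists>i<card C. \<exists>k. [c i * rpow k s = 1] (mod ?m)" by (rule red) simp
  then have h: "card C > 0" by auto
  show ?thesis
  proof (rule exI[of _ "card C"], intro conjI h, rule exI[of _ c], intro conjI)
    show "\<forall>i<card C. coprime (c i) (int p)"
      using cC by (auto simp: C_def U_def)
    show "\<forall>u. coprime u (int p) \<longrightarrow> (\<exists>i<card C. \<exists>k. [c i * rpow k s = u] (mod ?m))"
      using red by blast
    show "\<forall>i<card C. \<forall>j<card C. \<forall>k l. [c i * rpow k s = c j * rpow l s] (mod ?m) \<longrightarrow> i = j"
    proof (intro allI impI)
      fix i j k l
      assume ij: "i < card C" "j < card C" and "[c i * rpow k s = c j * rpow l s] (mod ?m)"
      then have "rel (c j) (c i)" "rel (c i) (c j)" using sym sym' by blast+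
      then have "c i = c j"
        using cC[OF ij(1)] cC[OF ij(2)] by (force simp: C_def)
      then show "i = j" using c ij by (auto simp: bij_betw_def inj_on_def)
    qed
  qed
qed

lemma prime_power_decomposition:
  fixes x :: int
  assumes x: "x \<noteq> 0"
  obtains n u where "x = int p ^ n * u" "coprime u (int p)"
proof -
  have "\<not> is_unit (int p)" using p(1) prime_gt_1_nat by auto
  then obtain u where u: "x = int p ^ multiplicity (int p) x * u" "\<not> int p dvd u"
    using multiplicity_decompose'[of x "int p"] x by blast
  then have "coprime u (int p)"
    using p(1) prime_imp_coprime[of "int p" u] by (simp add: coprime_commute)
  with u(1) that show ?thesis by blast
qed

text \<open>Multiplying back by \<open>r\<close> recovers the residue. Dilation therefore permutes
  the classes mod \<open>p ^ N\<close> without loss of level.\<close>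

lemma level_eq_iff_dilation:
  assumes "x \<in> carrier Z" "y \<in> carrier Z"
  shows "(x \<otimes>\<^bsub>Z\<^esub> inv\<^bsub>Z\<^esub> r) N = (y \<otimes>\<^bsub>Z\<^esub> inv\<^bsub>Z\<^esub> r) N \<longleftrightarrow> x N = y N"
proof
  have cancel: "((x \<otimes>\<^bsub>Z\<^esub> inv\<^bsub>Z\<^esub> r) \<otimes>\<^bsub>Z\<^esub> r) = x" if "x \<in> carrier Z" for x
    using that r by (simp add: Z.m_assoc Z.Units_closed)
  assume "(x \<otimes>\<^bsub>Z\<^esub> inv\<^bsub>Z\<^esub> r) N = (y \<otimes>\<^bsub>Z\<^esub> inv\<^bsub>Z\<^esub> r) N"
  then have "((x \<otimes>\<^bsub>Z\<^esub> inv\<^bsub>Z\<^esub> r) \<otimes>\<^bsub>Z\<^esub> r) N = ((y \<otimes>\<^bsub>Z\<^esub> inv\<^bsub>Z\<^esub> r) \<otimes>\<^bsub>Z\<^esub> r) N"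
    by (subst (1 2) padic_mult_level) simp
  then show "x N = y N" using assms by (simp add: cancel)
qed (simp add: padic_mult_level)

lemma ex_orbit_system: "\<exists>pts. orbit_system p r (padic_ord p r) pts"
proof -
  obtain s where s: "s \<ge> 1" "\<forall>N\<ge>s. exact_level N"
    using ex_exact_level by blast
  obtain h and c :: "nat \<Rightarrow> int" where h: "h > 0"
    and c: "\<forall>i<h. coprime (c i) (int p)"
    and c_ex: "\<forall>u. coprime u (int p) \<longrightarrow> (\<exists>i<h. \<exists>k. [c i * rpow k s = u] (mod int p ^ s))"
    and c_inj: "\<forall>i<h. \<forall>j<h. \<forall>k l. [c i * rpow k s = c j * rpow l s] (mod int p ^ s) \<longrightarrow> i = j"
    using ex_orbit_representatives[OF s(1)] by (elim exE conjE) (rule that)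
  \<comment> \<open>The index \<open>j\<close> encodes a pair: \<open>j div h\<close> is the power
    of \<open>p\<close>, \<open>j mod h\<close> the coset representative. Large \<open>j\<close>
    thus means high divisibility by \<open>p\<close>.\<close>
  define pts where "pts j k = (\<lambda>N. int p ^ (j div h) * c (j mod h) * rpow k N mod int p ^ N)" for j k
  have cop: "coprime (c (j mod h)) (int p)" for j
    using h by (intro c[rule_format]) simp
  have pts_eq_iff: "pts i k N = pts j l N \<longleftrightarrow>
      [int p ^ (i div h) * c (i mod h) * rpow k N = int p ^ (j div h) * c (j mod h) * rpow l N] (mod int p ^ N)"
    for i j k l N
    by (simp add: pts_def cong_def)
  have carrier: "pts j k \<in> carrier Z" for j k
  proof -
    have "int p ^ (j div h) * c (j mod h) * rpow k (Suc N) mod int p ^ Suc N mod int p ^ N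
        = int p ^ (j div h) * c (j mod h) * rpow k N mod int p ^ N" for N
    proof -
      have "[int p ^ (j div h) * c (j mod h) * rpow k (Suc N) = int p ^ (j div h) * c (j mod h) * rpow k N] (mod int p ^ N)"
        by (intro cong_scalar_left rpow_mod) simp
      then show ?thesis
        by (simp add: cong_def mod_mod_cancel)
    qed
    then show ?thesis
      using pN_pos by (simp add: pts_def padic_integers_def del: power_Suc)
  qed
  have step: "pts j k \<otimes>\<^bsub>Z\<^esub> inv\<^bsub>Z\<^esub> r = pts j (k - 1)" for j k
  proof
    fix N
    have "[int p ^ (j div h) * c (j mod h) * (rpow k N * rpow (- 1) N)
        = int p ^ (j div h) * c (j mod h) * rpow (k - 1) N] (mod int p ^ N)"
      using cong_sym[OF rpow_add_cong[of k "- 1" N]] by (intro cong_scalar_left) simp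
    then show "(pts j k \<otimes>\<^bsub>Z\<^esub> inv\<^bsub>Z\<^esub> r) N = pts j (k - 1) N"
      by (simp add: padic_mult_level rpow_minus_1[symmetric] pts_def cong_def mod_mult_left_eq mult.assoc)
  qed
  have dense: "\<exists>j k. pts j k N = x N" if x: "x \<in> carrier Z" for N x
  proof (cases "x N = 0")
    case True
    \<comment> \<open>The index \<open>N * h\<close> belongs to the power \<open>p ^ N\<close>, so
      its points vanish mod \<open>p ^ N\<close>.\<close>
    have "pts (N * h) 0 N = x N"
      using h by (simp add: True pts_def mult.assoc)
    then show ?thesis by blast
  next
    case False
    then obtain n u where u: "x N = int p ^ n * u" "coprime u (int p)"
      by (rule prime_power_decomposition)
    obtain i k where ik: "i < h" "[c i * rpow k s = u] (mod int p ^ s)"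
      using c_ex[rule_format, OF u(2)] by blast
    \<comment> \<open>Lifting starts at level \<open>s\<close>, so it goes up to
      \<open>max s N\<close> and the result is reduced mod \<open>p ^ N\<close>.\<close>
    obtain l where l: "[c i * rpow l (max s N) = u] (mod int p ^ max s N)"
      using orbit_lift[OF s(2,1) c[rule_format, OF ik(1)] ik(2), of "max s N"] by auto
    then have "[c i * rpow l (max s N) = u] (mod int p ^ N)"
      by (rule cong_dvd_modulus) (simp add: le_imp_power_dvd)
    moreover have "[c i * rpow l N = c i * rpow l (max s N)] (mod int p ^ N)"
      by (intro cong_scalar_left cong_sym[OF rpow_mod]) simp
    ultimately have "[int p ^ n * (c i * rpow l N) = int p ^ n * u] (mod int p ^ N)"
      by (meson cong_scalar_left cong_trans)
    then have "pts (n * h + i) l N = x N mod int p ^ N"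
      using ik(1) h by (simp add: pts_def cong_def u(1) mult.assoc)
    then have "pts (n * h + i) l N = x N"
      using padic_mod[OF x, of N N] by simp
    then show ?thesis by blast
  qed
  have null: "\<exists>J. \<forall>j\<ge>J. \<forall>k. pts j k N = 0" for N
  proof (intro exI allI impI)
    fix j k assume "N * h \<le> j"
    then have "N \<le> j div h"
      using h by (metis div_le_mono nonzero_mult_div_cancel_right not_less_zero)
    then have "int p ^ N dvd int p ^ (j div h) * c (j mod h) * rpow k N"
      by (intro dvd_mult2 le_imp_power_dvd)
    then show "pts j k N = 0" by (simp add: pts_def)
  qed
  have padic_ord: "padic_ord p r = (SUP N\<in>{1..}. supernatural_of_nat (level_ord N))"
    by (simp add: padic_ord_def level_ord_def)
  have period: "\<exists>l>0. supernatural_of_nat l \<le> padic_ord p r \<and> (\<forall>j k. pts j (k + int l) N = pts j k N)" for N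
  proof -
    define M where "M = max 1 N"
    have M: "M \<ge> 1" "M \<ge> N" by (auto simp: M_def)
    have "supernatural_of_nat (level_ord M) \<le> padic_ord p r"
      unfolding padic_ord using M by (intro SUP_upper) simp
    moreover have "pts j (k + int (level_ord M)) N = pts j k N" for j k
    proof -
      have "[rpow (k + int (level_ord M)) M = rpow k M] (mod int p ^ M)"
        using rpow_cong_iff[OF M(1)] by simp
      then have "[rpow (k + int (level_ord M)) M = rpow k M] (mod int p ^ N)"
        by (rule cong_dvd_modulus) (simp add: M le_imp_power_dvd)
      then have "[rpow (k + int (level_ord M)) N = rpow k N] (mod int p ^ N)"
        using rpow_mod[OF M(2)] by (simp add: cong_def)
      then show ?thesis
        unfolding pts_eq_iff by (rule cong_scalar_left)
    qed
    ultimately show ?thesis using level_ord_pos[OF M(1)] by blast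
  qed
  have separate: "\<exists>N. \<forall>i k k'. pts i k N = pts j k' N \<longrightarrow> i = j \<and> int l dvd k - k'"
    if l: "l > 0" "supernatural_of_nat l \<le> padic_ord p r" for j l
  proof -
    obtain N1 where N1: "N1 \<ge> 1" "l dvd level_ord N1"
      using supernatural_le_SUP_dvd[OF l(1) level_ord_pos level_ord_dvd l(2)[unfolded padic_ord]] by blast
    \<comment> \<open>\<open>M\<close> digits of the unit part fix its coset, as
      \<open>M \<ge> s\<close>, and its exponent mod \<open>l\<close>, as \<open>l\<close> divides
      \<open>level_ord M\<close>. The factor \<open>p ^ n\<close> uses up \<open>n\<close> digits,
      hence the level \<open>n + M\<close>.\<close>
    define M where "M = max s N1"
    define n where "n = j div h"
    have M: "M \<ge> 1" "M \<ge> s" "l dvd level_ord M"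
      using N1 s level_ord_dvd[of N1 M] by (auto simp: M_def intro: dvd_trans)
    have "i = j \<and> int l dvd k - k'" if eq: "pts i k (n + M) = pts j k' (n + M)" for i k k'
    proof -
      let ?N = "n + M"
      define a where "a = c (i mod h) * rpow k ?N"
      define b where "b = c (j mod h) * rpow k' ?N"
      have ab: "coprime a (int p)" "coprime b (int p)"
        using cop rpow_coprime[of ?N] M(1) by (auto simp: a_def b_def)
      have nd: "\<not> int p dvd a" "\<not> int p dvd b"
        using ab p(1) by (metis coprime_common_divisor dvd_refl not_prime_unit prime_nat_int_transfer)+
      have e: "[int p ^ (i div h) * a = int p ^ n * b] (mod int p ^ ?N)"
        using eq unfolding pts_eq_iff by (simp add: a_def b_def n_def mult.assoc)
      have p0: "int p \<noteq> 0" using pN_pos[of 1] by simp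
      \<comment> \<open>The unit parts are prime to \<open>p\<close>, so unequal powers of
        \<open>p\<close> would already differ within \<open>n + M\<close> digits, because
        \<open>M \<ge> 1\<close>.\<close>
      have idiv: "i div h = n"
      proof (rule ccontr)
        assume "i div h \<noteq> n"
        then consider "Suc n \<le> i div h" | "Suc (i div h) \<le> n" by linarith
        then show False
        proof cases
          case 1
          have "[int p ^ (i div h) * a = int p ^ n * b] (mod int p ^ Suc n)"
            by (rule cong_dvd_modulus[OF e]) (use M(1) in \<open>simp add: le_imp_power_dvd del: power_Suc\<close>)
          moreover have "int p ^ Suc n dvd int p ^ (i div h) * a"
            by (intro dvd_mult2 le_imp_power_dvd 1)
          ultimately have "int p ^ Suc n dvd int p ^ n * b"
            using cong_dvd_iff cong_sym by (meson cong_dvd_mono_modulus dvd_refl cong_0_iff cong_trans)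
          then show False
            using nd(2) p0 by (simp add: mult.commute[of "int p"])
        next
          case 2
          have "[int p ^ (i div h) * a = int p ^ n * b] (mod int p ^ Suc (i div h))"
            by (rule cong_dvd_modulus[OF e]) (use 2 in \<open>simp add: le_imp_power_dvd del: power_Suc\<close>)
          moreover have "int p ^ Suc (i div h) dvd int p ^ n * b"
            by (intro dvd_mult2 le_imp_power_dvd 2)
          ultimately have "int p ^ Suc (i div h) dvd int p ^ (i div h) * a"
            by (meson cong_0_iff cong_trans)
          then show False
            using nd(1) p0 by (simp add: mult.commute[of "int p"])
        qed
      qed
      have "int p ^ n * int p ^ M dvd int p ^ n * (a - b)"
        using e unfolding idiv by (simp add: cong_iff_dvd_diff power_add right_diff_distrib)
      then have "[a = b] (mod int p ^ M)"
        using p0 by (simp add: cong_iff_dvd_diff)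
      moreover have "[a = c (i mod h) * rpow k M] (mod int p ^ M)" "[b = c (j mod h) * rpow k' M] (mod int p ^ M)"
        unfolding a_def b_def by (intro cong_scalar_left rpow_mod; simp)+
      ultimately have abM: "[c (i mod h) * rpow k M = c (j mod h) * rpow k' M] (mod int p ^ M)"
        by (meson cong_sym cong_trans)
      have "[c (i mod h) * rpow k M = c (j mod h) * rpow k' M] (mod int p ^ s)"
        by (rule cong_dvd_modulus[OF abM]) (simp add: M le_imp_power_dvd)
      moreover have "[c (i mod h) * rpow k M = c (i mod h) * rpow k s] (mod int p ^ s)"
        "[c (j mod h) * rpow k' M = c (j mod h) * rpow k' s] (mod int p ^ s)"
        by (intro cong_scalar_left rpow_mod M)+
      ultimately have "[c (i mod h) * rpow k s = c (j mod h) * rpow k' s] (mod int p ^ s)"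
        by (meson cong_sym cong_trans)
      then have im: "i mod h = j mod h"
        using h by (intro c_inj[rule_format]) auto
      have ij: "i = j"
        using idiv im unfolding n_def by (metis div_mult_mod_eq)
      have "[rpow k M = rpow k' M] (mod int p ^ M)"
        using abM cop[of j] unfolding im by (subst (asm) cong_mult_lcancel) auto
      then have "int (level_ord M) dvd k - k'"
        using rpow_cong_iff[OF M(1)] by simp
      moreover have "int l dvd int (level_ord M)" using M(3) by simp
      ultimately show ?thesis using ij dvd_trans by blast
    qed
    then show ?thesis by blast
  qed
  have "orbit_system p r (padic_ord p r) pts"
    by (intro orbit_system.intro prime_gt_0_nat[OF p(1)] r carrier step dense null period separate
        level_eq_iff_dilation)
  then show ?thesis by blast
qed

end


section \<open>Continuous functions on the p-adic integers\<close>

text \<open>The compatibility conditions cut out a closed subset of a product of finite discrete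
  sets.\<close>

lemma compact_padic_integers: "compact (carrier (padic_integers p))"
proof -
  let ?K = "PiE UNIV (\<lambda>n. {0..<int p ^ n})"
  have "compactin (product_topology (\<lambda>_. euclidean) (UNIV :: nat set)) ?K"
    by (simp add: compactin_PiE compactin_euclidean_iff finite_imp_compact)
  then have K: "compact ?K"
    unfolding euclidean_product_topology compactin_euclidean_iff .
  have "closed {x :: padic. x (Suc n) mod int p ^ n = x n}" for n
  proof (rule closed_Collect_eq)
    show "continuous_on UNIV (\<lambda>x :: padic. x (Suc n) mod int p ^ n)"
      by (rule continuous_on_compose2[OF Topological_Spaces.continuous_on_discrete[of UNIV "\<lambda>c. c mod int p ^ n"]]) auto
  qed simp
  then have "closed (\<Inter>n. {x :: padic. x (Suc n) mod int p ^ n = x n})"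
    by (intro closed_INT) auto
  from compact_Int_closed[OF K this]
  have "compact (?K \<inter> (\<Inter>n. {x :: padic. x (Suc n) mod int p ^ n = x n}))" .
  also have "?K \<inter> (\<Inter>n. {x :: padic. x (Suc n) mod int p ^ n = x n}) = carrier (padic_integers p)"
    by (auto simp: padic_integers_def PiE_def Pi_def)
  finally show ?thesis .
qed

lemma padic_continuous_bounded:
  assumes "f \<in> padic_continuous p"
  shows "\<exists>B. \<forall>x\<in>carrier (padic_integers p). cmod (f x) \<le> B"
proof -
  have "bounded (f ` carrier (padic_integers p))"
    using assms compact_padic_integers
    by (intro compact_imp_bounded compact_continuous_image) (auto simp: padic_continuous_def)
  then show ?thesis by (auto simp: bounded_iff)
qed

text \<open>Compactness gives uniform continuity for a metric of the product topology; agreement at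
  one high level entails agreement at all lower ones, hence nearness in that metric.\<close>

lemma padic_uniformly_continuous:
  assumes f: "f \<in> padic_continuous p" and e: "0 < e"
  shows "\<exists>N. \<forall>x\<in>carrier (padic_integers p). \<forall>y\<in>carrier (padic_integers p).
    x N = y N \<longrightarrow> cmod (f x - f y) < e"
proof -
  let ?C = "carrier (padic_integers p)"
  \<comment> \<open>The metric used is that of real sequences; the floor undoes the
    embedding.\<close>
  define emb :: "padic \<Rightarrow> nat \<Rightarrow> real" where "emb x = (\<lambda>n. of_int (x n))" for x
  define inv_emb where "inv_emb z = (\<lambda>n. \<lfloor>z n\<rfloor>)" for z :: "nat \<Rightarrow> real"
  have inv: "inv_emb (emb x) = x" for x by (simp add: inv_emb_def emb_def)
  have cont: "continuous_on ?C emb"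
    unfolding emb_def
    by (intro continuous_on_coordinatewise_then_product
        continuous_on_compose2[OF Topological_Spaces.continuous_on_discrete[of UNIV of_int]])
       (auto intro: continuous_on_subset[OF continuous_on_product_coordinates])
  have inv_cont: "continuous_on (emb ` ?C) inv_emb"
    by (rule continuous_on_inv[OF cont compact_padic_integers]) (simp add: inv)
  have f_cont: "continuous_on ?C f"
    using f by (simp add: padic_continuous_def)
  have "continuous_on (emb ` ?C) (\<lambda>z. f (inv_emb z))"
    by (rule continuous_on_compose2[OF f_cont inv_cont]) (auto simp: inv)
  then have "uniformly_continuous_on (emb ` ?C) (\<lambda>z. f (inv_emb z))"
    by (intro compact_uniformly_continuous compact_continuous_image cont compact_padic_integers)
  then have "\<exists>d>0. \<forall>u\<in>emb ` ?C. \<forall>v\<in>emb ` ?C. dist v u < d \<longrightarrow> dist (f (inv_emb v)) (f (inv_emb u)) < e"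
    using e unfolding uniformly_continuous_on_def by blast
  then obtain d where d: "d > 0" "\<forall>x\<in>?C. \<forall>y\<in>?C. dist (emb y) (emb x) < d \<longrightarrow> dist (f y) (f x) < e"
    by (auto simp: inv)
  obtain M where M: "(1 / 2) ^ M < d"
    using real_arch_pow_inv[OF d(1), of "1 / 2"] by auto
  \<comment> \<open>The metric enumerates coordinates by \<open>from_nat\<close>. \<open>N\<close>
    dominates the first \<open>M + 1\<close> of them, and the rest contributes at most
    \<open>(1 / 2) ^ M\<close>.\<close>
  define N where "N = Max (insert 0 ((\<lambda>n. from_nat n :: nat) ` {..M}))"
  have "cmod (f y - f x) < e" if xy: "x \<in> ?C" "y \<in> ?C" "x N = y N" for x y
  proof -
    have "x (from_nat n) = y (from_nat n)" if "n \<le> M" for n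
    proof -
      have "from_nat n \<le> N" using that by (auto simp: N_def)
      then show ?thesis
        using padic_mod[OF xy(1), of "from_nat n" N] padic_mod[OF xy(2), of "from_nat n" N] xy(3) by simp
    qed
    then have "{dist (emb y (from_nat n)) (emb x (from_nat n)) |n. n \<le> M} = {0}"
      by (auto simp: emb_def intro!: exI[of _ 0])
    then have "dist (emb y) (emb x) \<le> (1 / 2) ^ M"
      using dist_fun_le_dist_first_terms[of "emb y" "emb x" M] by simp
    with M d(2) xy(1,2) show ?thesis by (force simp: dist_norm)
  qed
  then show ?thesis by (metis norm_minus_commute)
qed

definition padic_level :: "nat \<Rightarrow> nat \<Rightarrow> (padic \<Rightarrow> complex) \<Rightarrow> bool"
  where "padic_level p N f \<longleftrightarrow>
    (\<forall>x\<in>carrier (padic_integers p). \<forall>y\<in>carrier (padic_integers p). x N = y N \<longrightarrow> f x = f y)"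

lemma padic_level_continuous:
  assumes "padic_level p N f"
  shows "f \<in> padic_continuous p"
proof -
  let ?C = "carrier (padic_integers p)"
  define g where "g c = f (SOME x. x \<in> ?C \<and> x N = c)" for c
  have "f x = g (x N)" if x: "x \<in> ?C" for x
  proof -
    define y where "y = (SOME y. y \<in> ?C \<and> y N = x N)"
    have "y \<in> ?C \<and> y N = x N"
      unfolding y_def by (rule someI[of _ x]) (use x in simp)
    then have "f x = f y" using assms x unfolding padic_level_def by metis
    then show ?thesis by (simp add: g_def y_def)
  qed
  moreover have "continuous_on ?C (\<lambda>x. g (x N))"
    by (rule continuous_on_compose2[OF Topological_Spaces.continuous_on_discrete[of UNIV g]])
       (auto intro: continuous_on_subset[OF continuous_on_product_coordinates])
  ultimately show ?thesis
    by (simp add: padic_continuous_def cong: continuous_on_cong)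
qed

lemma padic_level_mono:
  assumes "padic_level p N f" "N \<le> M"
  shows "padic_level p M f"
  unfolding padic_level_def
proof (intro ballI impI)
  fix x y
  assume x: "x \<in> carrier (padic_integers p)" and y: "y \<in> carrier (padic_integers p)" and "x M = y M"
  then have "x N = y N"
    using padic_mod[OF x assms(2)] padic_mod[OF y assms(2)] by simp
  then show "f x = f y" using assms(1) x y unfolding padic_level_def by blast
qed

definition padic_of_int :: "nat \<Rightarrow> int \<Rightarrow> padic"
  where "padic_of_int p a = (\<lambda>N. a mod int p ^ N)"

lemma padic_of_int_carrier: "0 < p \<Longrightarrow> padic_of_int p a \<in> carrier (padic_integers p)"
  by (simp add: padic_of_int_def padic_integers_def padic_mod_mod del: power_Suc)

lemma padic_of_int_level: "x \<in> carrier (padic_integers p) \<Longrightarrow> padic_of_int p (x N) N = x N"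
  using padic_mod[of x p N N] by (simp add: padic_of_int_def)

text \<open>Replace each point by the integer representing its residue mod \<open>p ^ N\<close>,
  with \<open>N\<close> taken from uniform continuity.\<close>

lemma padic_level_approx:
  assumes p: "0 < p" and f: "f \<in> padic_continuous p" and e: "0 < e"
  shows "\<exists>N g. padic_level p N g \<and> (\<forall>x\<in>carrier (padic_integers p). cmod (f x - g x) < e)"
proof -
  obtain N where N: "\<And>x y. x \<in> carrier (padic_integers p) \<Longrightarrow> y \<in> carrier (padic_integers p) \<Longrightarrow>
      x N = y N \<Longrightarrow> cmod (f x - f y) < e"
    using padic_uniformly_continuous[OF f e] by blast
  define g where "g x = f (padic_of_int p (x N))" for x
  have "padic_level p N g" by (simp add: padic_level_def g_def)
  moreover have "cmod (f x - g x) < e" if "x \<in> carrier (padic_integers p)" for x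
    unfolding g_def using that by (intro N) (simp_all add: padic_of_int_carrier p padic_of_int_level)
  ultimately show ?thesis by blast
qed


section \<open>Covariant pairs\<close>

lemma cinner_sum_right: "cinner x (\<Sum>i\<in>F. f i) = (\<Sum>i\<in>F. cinner x (f i))"
proof (induction F rule: infinite_finite_induct)
  case empty
  then show ?case by (simp add: cinner_def)
next
  case (infinite F)
  then show ?case by (simp add: cinner_def)
qed (simp add: cinner_add_right)

lemma norm_isometry:
  assumes "star V * V = (1 :: 'i cop)"
  shows "norm (cop_apply V x) = norm x"
proof -
  have "cop_apply (star V) (cop_apply V x) = x"
    using arg_cong[OF assms, of "\<lambda>T. cop_apply T x"] by simp
  then have "cinner (cop_apply V x) (cop_apply V x) = cinner x x"
    using star_adjoint_right[of x V "cop_apply V x"] star_adjoint_right[of x "star V" "cop_apply V x"]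
      star_adjoint[of "star V" x "cop_apply V x"] by simp
  then have "(norm (cop_apply V x))\<^sup>2 = (norm x)\<^sup>2"
    unfolding cinner_self of_real_eq_iff .
  then show ?thesis by simp
qed

lemma norm_isometry_power:
  assumes "star V * V = (1 :: 'i cop)"
  shows "norm (cop_apply (V ^ n) x) = norm x"
  by (induction n) (auto simp: norm_isometry[OF assms])

text \<open>For unitary \<open>V\<close> the adjoint is the inverse, so these are its integer
  powers.\<close>

definition int_power :: "'i cop \<Rightarrow> int \<Rightarrow> 'i cop"
  where "int_power V k = (if 0 \<le> k then V ^ nat k else star V ^ nat (- k))"

lemma int_power_Suc:
  assumes "star V * V = (1 :: 'i cop)"
  shows "int_power V (k + 1) = int_power V k * V"
proof (cases "0 \<le> k")
  case True
  then have "nat (k + 1) = Suc (nat k)" by simp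
  with True show ?thesis by (simp add: int_power_def power_commutes)
next
  case False
  define n where "n = nat (- k - 1)"
  have k: "k = - 1 - int n" using False by (simp add: n_def)
  have "star V ^ Suc n * V = star V ^ n * (star V * V)"
    by (simp only: power_Suc2 mult.assoc)
  then have "star V ^ Suc n * V = star V ^ n" by (simp add: assms)
  moreover have "int_power V k = star V ^ Suc n"
    by (simp add: int_power_def k nat_add_distrib)
  moreover have "int_power V (k + 1) = star V ^ n"
    by (cases n) (simp_all add: int_power_def k nat_add_distrib)
  ultimately show ?thesis by simp
qed

lemma norm_int_power:
  assumes "star V * V = (1 :: 'i cop)" "V * star V = 1"
  shows "norm (cop_apply (int_power V k) x) = norm x"
  using norm_isometry_power[OF assms(1)] norm_isometry_power[of "star V"] assms(2)
  by (simp add: int_power_def)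

lemma star_shift_basis: "cop_apply (star shift) (basis_vec k) = basis_vec (k - 1)"
  using arg_cong[OF shift_unitary(1), of "\<lambda>T. cop_apply T (basis_vec (k - 1))"]
  by (simp add: shift_basis)

lemma coord_star_shift: "coord (cop_apply (star shift) x) k = coord x (k + 1)"
proof -
  have "coord (cop_apply (star shift) x) k = cinner (cop_apply shift (basis_vec k)) x"
    by (simp add: cinner_basis_left[symmetric] star_adjoint_right)
  then show ?thesis by (simp add: shift_basis cinner_basis_left)
qed

lemma covariant_pairsD:
  assumes "(M, V) \<in> covariant_pairs p r"
  shows "M (\<lambda>_. 1) = 1" "star V * V = 1"
    and "f \<in> padic_continuous p \<Longrightarrow> g \<in> padic_continuous p \<Longrightarrow>
      (\<And>x. x \<in> carrier (padic_integers p) \<Longrightarrow> f x = g x) \<Longrightarrow> M f = M g"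
    and "f \<in> padic_continuous p \<Longrightarrow> g \<in> padic_continuous p \<Longrightarrow> M (\<lambda>x. f x + g x) = M f + M g"
    and "f \<in> padic_continuous p \<Longrightarrow> g \<in> padic_continuous p \<Longrightarrow> M (\<lambda>x. f x * g x) = M f * M g"
    and "f \<in> padic_continuous p \<Longrightarrow> M (\<lambda>x. cnj (f x)) = star (M f)"
    and "f \<in> padic_continuous p \<Longrightarrow> M (\<lambda>x. c * f x) = c *\<^sub>C M f"
    and "f \<in> padic_continuous p \<Longrightarrow> V * M f * star V = M (padic_dilation p r f)"
  using assms unfolding covariant_pairs_def padic_function_rep_def by blast+

lemma padic_continuous_const: "(\<lambda>_. c) \<in> padic_continuous p"
  by (simp add: padic_continuous_def)

lemma padic_continuous_algebra:
  assumes "f \<in> padic_continuous p"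
  shows "(\<lambda>x. cnj (f x)) \<in> padic_continuous p"
    and "(\<lambda>x. c * f x) \<in> padic_continuous p"
    and "g \<in> padic_continuous p \<Longrightarrow> (\<lambda>x. f x + g x) \<in> padic_continuous p"
    and "g \<in> padic_continuous p \<Longrightarrow> (\<lambda>x. f x - g x) \<in> padic_continuous p"
    and "g \<in> padic_continuous p \<Longrightarrow> (\<lambda>x. f x * g x) \<in> padic_continuous p"
  using assms unfolding padic_continuous_def mem_Collect_eq
  by (blast intro: continuous_on_cnj continuous_on_mult_left continuous_on_add continuous_on_diff
      continuous_on_mult)+

lemma padic_continuous_sum:
  assumes "\<And>a. a \<in> A \<Longrightarrow> f a \<in> padic_continuous p"
  shows "(\<lambda>x. \<Sum>a\<in>A. f a x) \<in> padic_continuous p"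
  using assms unfolding padic_continuous_def mem_Collect_eq by (intro continuous_on_sum)

definition indicator_fun :: "nat \<Rightarrow> int \<Rightarrow> padic \<Rightarrow> complex"
  where "indicator_fun N a = (\<lambda>x. if x N = a then 1 else 0)"

lemma indicator_fun_level: "padic_level p N (indicator_fun N a)"
  by (simp add: padic_level_def indicator_fun_def)

lemmas indicator_fun_continuous = padic_level_continuous[OF indicator_fun_level]

locale covariant_representation = orbit_system +
  fixes M :: "(padic \<Rightarrow> complex) \<Rightarrow> int cop" and V :: "int cop"
  assumes MV: "(M, V) \<in> covariant_pairs p r"
begin

lemmas M_simps = covariant_pairsD[OF MV]

abbreviation C where "C \<equiv> padic_continuous p"

text \<open>The constant function 1 is invariant under dilation, so covariance at it reads
  \<open>V * star V = 1\<close>.\<close>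

lemma V_unitary: "star V * V = 1" "V * star V = 1"
proof -
  show "star V * V = 1" by (rule M_simps(2))
  have "V * M (\<lambda>_. 1) * star V = M (padic_dilation p r (\<lambda>_. 1))"
    by (rule M_simps(8)[OF padic_continuous_const])
  then show "V * star V = 1" by (simp add: padic_dilation_def M_simps(1))
qed

lemma M_const: "M (\<lambda>_. c) = c *\<^sub>C 1"
  using M_simps(7)[OF padic_continuous_const[of 1], of c] by (simp add: M_simps(1))

lemma M_sum: "finite A \<Longrightarrow> (\<And>a. a \<in> A \<Longrightarrow> f a \<in> C) \<Longrightarrow> M (\<lambda>x. \<Sum>a\<in>A. f a x) = (\<Sum>a\<in>A. M (f a))"
proof (induction A rule: finite_induct)
  case empty
  then show ?case using M_const[of 0] by simp
next
  case (insert a A)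
  have "(\<lambda>x. \<Sum>a\<in>A. f a x) \<in> C"
    using insert.prems by (intro padic_continuous_sum) auto
  with insert show ?case by (simp add: M_simps(4))
qed

lemma M_diff: "f \<in> C \<Longrightarrow> g \<in> C \<Longrightarrow> M (\<lambda>x. f x - g x) = M f - M g"
proof -
  assume fg: "f \<in> C" "g \<in> C"
  have g': "(\<lambda>x. (- 1) * g x) \<in> C"
    using fg(2) by (rule padic_continuous_algebra)
  have "M (\<lambda>x. f x + (- 1) * g x) = M f + (- 1) *\<^sub>C M g"
    by (simp only: M_simps(4)[OF fg(1) g'] M_simps(7)[OF fg(2)])
  then show ?thesis by (simp add: scaleC_minus_one_cop)
qed

text \<open>
  With \<open>g = sqrt (B\<^sup>2 - \<bar>f\<bar>\<^sup>2)\<close> one has \<open>star (M f) * M f + star (M g) * M g = B\<^sup>2\<close>.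
\<close>

lemma norm_M_le:
  assumes f: "f \<in> C" and B: "\<And>x. x \<in> carrier (padic_integers p) \<Longrightarrow> cmod (f x) \<le> B"
  shows "norm (M f) \<le> B"
proof (rule cop_norm_leI)
  have "\<zero>\<^bsub>padic_integers p\<^esub> \<in> carrier (padic_integers p)"
    using p_pos by (simp add: padic_integers_def)
  then show B0: "0 \<le> B" using B norm_ge_zero order_trans by blast
  fix x
  define g where "g x = complex_of_real (sqrt (B\<^sup>2 - (cmod (f x))\<^sup>2))" for x
  have fc: "continuous_on (carrier (padic_integers p)) f"
    using f by (simp add: padic_continuous_def)
  have g: "g \<in> C"
    unfolding g_def padic_continuous_def mem_Collect_eq by (intro continuous_intros fc)
  note cf = padic_continuous_algebra(1)[OF f] and cg = padic_continuous_algebra(1)[OF g]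
  note cff = padic_continuous_algebra(5)[OF cf f] and cgg = padic_continuous_algebra(5)[OF cg g]
  note sum = padic_continuous_algebra(3)[OF cff cgg]
  have "star (M f) * M f + star (M g) * M g = M (\<lambda>x. cnj (f x) * f x + cnj (g x) * g x)"
    by (simp only: M_simps(4)[OF cff cgg] M_simps(5)[OF cf f] M_simps(5)[OF cg g] M_simps(6)[OF f] M_simps(6)[OF g])
  also have "\<dots> = M (\<lambda>_. complex_of_real (B\<^sup>2))"
  proof (rule M_simps(3)[OF sum padic_continuous_const])
    fix y assume "y \<in> carrier (padic_integers p)"
    then have "(cmod (f y))\<^sup>2 \<le> B\<^sup>2" using B by (simp add: power_mono)
    then have "cnj (g y) * g y = complex_of_real (B\<^sup>2 - (cmod (f y))\<^sup>2)"
      unfolding g_def by (simp flip: of_real_mult)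
    moreover have "cnj (f y) * f y = complex_of_real ((cmod (f y))\<^sup>2)"
      by (simp only: complex_norm_square mult.commute)
    ultimately show "cnj (f y) * f y + cnj (g y) * g y = complex_of_real (B\<^sup>2)"
      by simp
  qed
  also have "\<dots> = complex_of_real (B\<^sup>2) *\<^sub>C 1" by (rule M_const)
  finally have "cinner x (cop_apply (star (M f) * M f + star (M g) * M g) x)
      = cinner x (cop_apply (complex_of_real (B\<^sup>2) *\<^sub>C 1) x)" by simp
  then have "complex_of_real ((norm (cop_apply (M f) x))\<^sup>2 + (norm (cop_apply (M g) x))\<^sup>2)
      = complex_of_real (B\<^sup>2 * (norm x)\<^sup>2)"
    by (simp add: cinner_add_right star_adjoint_right cinner_scaleC_right cinner_self)
  then have "(norm (cop_apply (M f) x))\<^sup>2 \<le> B\<^sup>2 * (norm x)\<^sup>2"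
    unfolding of_real_eq_iff using zero_le_power2[of "norm (cop_apply (M g) x)"] by linarith
  then show "norm (cop_apply (M f) x) \<le> B * norm x"
    using B0 by (simp add: power_mult_distrib[symmetric] abs_le_square_iff[symmetric] power2_le_iff_abs_le)
qed

text \<open>The spectral projection of the clopen set of points with residue \<open>a\<close> mod
  \<open>p ^ N\<close>.\<close>

definition P :: "nat \<Rightarrow> int \<Rightarrow> int cop"
  where "P N a = M (indicator_fun N a)"

lemma P_selfadjoint: "star (P N a) = P N a" and P_idem: "P N a * P N a = P N a"
proof -
  have "(\<lambda>x. cnj (indicator_fun N a x)) = indicator_fun N a"
    "(\<lambda>x. indicator_fun N a x * indicator_fun N a x) = indicator_fun N a"
    by (auto simp: indicator_fun_def)
  then show "star (P N a) = P N a" "P N a * P N a = P N a"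
    using M_simps(6)[OF indicator_fun_continuous] M_simps(5)[OF indicator_fun_continuous indicator_fun_continuous]
    unfolding P_def by metis+
qed

lemma sum_P: "(\<Sum>a\<in>{0..<int p ^ N}. P N a) = 1"
proof -
  have "(\<Sum>a\<in>{0..<int p ^ N}. P N a) = M (\<lambda>x. \<Sum>a\<in>{0..<int p ^ N}. indicator_fun N a x)"
    unfolding P_def by (rule M_sum[symmetric]) (auto intro: indicator_fun_continuous)
  also have "\<dots> = M (\<lambda>_. 1)"
  proof (rule M_simps(3)[OF _ padic_continuous_const])
    show "(\<lambda>x. \<Sum>a\<in>{0..<int p ^ N}. indicator_fun N a x) \<in> C"
      by (rule padic_level_continuous[of p N]) (simp add: padic_level_def indicator_fun_def)
    show "(\<Sum>a\<in>{0..<int p ^ N}. indicator_fun N a x) = 1" if "x \<in> carrier (padic_integers p)" for x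
      using padic_carrierD(1,2)[OF that, of N] by (simp add: indicator_fun_def)
  qed
  finally show ?thesis by (simp add: M_simps(1))
qed

lemma sum_norm_P: "(\<Sum>a\<in>{0..<int p ^ N}. (norm (cop_apply (P N a) x))\<^sup>2) = (norm x)\<^sup>2"
proof -
  have "complex_of_real ((norm (cop_apply (P N a) x))\<^sup>2) = cinner x (cop_apply (P N a) x)" for a
  proof -
    have "cinner (cop_apply (P N a) x) (cop_apply (P N a) x) = cinner x (cop_apply (star (P N a) * P N a) x)"
      by (simp add: star_adjoint_right)
    then show ?thesis by (simp only: P_selfadjoint P_idem cinner_self)
  qed
  then have "complex_of_real (\<Sum>a\<in>{0..<int p ^ N}. (norm (cop_apply (P N a) x))\<^sup>2)
      = cinner x (\<Sum>a\<in>{0..<int p ^ N}. cop_apply (P N a) x)"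
    by (simp only: of_real_sum cinner_sum_right)
  also have "\<dots> = complex_of_real ((norm x)\<^sup>2)"
    by (simp only: cop_apply_sum[symmetric] sum_P cop_apply_simps cinner_self)
  finally show ?thesis unfolding of_real_eq_iff .
qed

text \<open>Dilation takes the indicator of one residue class to that of another, so conjugation by
  \<open>V\<close> moves the projection one step along the orbit.\<close>

lemma V_P: "V * P N (pts j k N) = P N (pts j (k + 1) N) * V"
proof -
  have "V * P N (pts j k N) * star V = P N (pts j (k + 1) N)"
    unfolding P_def M_simps(8)[OF indicator_fun_continuous]
  proof (rule M_simps(3)[OF _ indicator_fun_continuous])
    have eq: "padic_dilation p r (indicator_fun N (pts j k N)) x = indicator_fun N (pts j (k + 1) N) x"
      if x: "x \<in> carrier (padic_integers p)" for x
      using level_dilation[OF x pts_carrier, of N j "k + 1"] pts_step[of j "k + 1"]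
      by (simp add: padic_dilation_def indicator_fun_def)
    have "padic_level p N (padic_dilation p r (indicator_fun N (pts j k N)))"
      unfolding padic_level_def by (intro ballI impI) (simp only: eq, simp only: indicator_fun_def)
    then show "padic_dilation p r (indicator_fun N (pts j k N)) \<in> C"
      by (rule padic_level_continuous)
    show "padic_dilation p r (indicator_fun N (pts j k N)) x = indicator_fun N (pts j (k + 1) N) x"
      if "x \<in> carrier (padic_integers p)" for x
      by (rule eq[OF that])
  qed
  then have "V * P N (pts j k N) * star V * V = P N (pts j (k + 1) N) * V" by simp
  then show ?thesis by (simp add: mult.assoc V_unitary)
qed

lemma power_V_P: "V ^ i * P N (pts j k N) = P N (pts j (k + int i) N) * V ^ i"
proof (induction i)
  case (Suc i)
  have "V ^ Suc i * P N (pts j k N) = V * P N (pts j (k + int i) N) * V ^ i"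
    by (simp add: Suc mult.assoc)
  also have "\<dots> = P N (pts j (k + int i + 1) N) * V ^ Suc i"
    by (simp add: V_P mult.assoc)
  also have "k + int i + 1 = k + int (Suc i)" by simp
  finally show ?case .
qed simp

text \<open>The projection \<open>i\<close> steps further along is a conjugate by
  \<open>V ^ i\<close>. Hence one point per residue class, all moved by the same \<open>i\<close>,
  again give projections whose squared norms add up.\<close>

lemma norm_P_translate:
  "norm (cop_apply (P N (pts j (k + int i) N)) x) = norm (cop_apply (P N (pts j k N)) (cop_apply (star V ^ i) x))"
proof -
  have "V ^ i * star V ^ i = 1"
  proof (induction i)
    case (Suc i)
    have "V ^ Suc i * star V ^ Suc i = V * (V ^ i * star V ^ i) * star V"
      by (simp only: power_Suc[of V] power_Suc2[of "star V"] mult.assoc)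
    then show ?case by (simp add: Suc V_unitary)
  qed simp
  then have "P N (pts j (k + int i) N) = V ^ i * (P N (pts j k N) * star V ^ i)"
    by (simp only: mult.assoc[symmetric] power_V_P) (simp add: mult.assoc)
  then show ?thesis
    by (simp add: norm_isometry_power[OF V_unitary(1)])
qed

text \<open>The component of a vector at the \<open>i\<close>-th orbit point, seen at precision
  \<open>N\<close> and carried back to position 0 by a power of \<open>V\<close>. Under right
  multiplication by \<open>V\<close> and by functions of level \<open>N\<close> these operators
  behave like the coordinate functionals of the orbit representation.\<close>

definition W :: "nat \<Rightarrow> nat \<Rightarrow> int \<Rightarrow> int cop"
  where "W N j i = int_power V (- i) * P N (pts j i N)"

lemma norm_W: "norm (cop_apply (W N j i) x) = norm (cop_apply (P N (pts j i N)) x)"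
  by (simp add: W_def norm_int_power[OF V_unitary])

lemma W_V: "W N j i * V = W N j (i - 1)"
proof -
  have "W N j i * V = int_power V (- i) * (V * P N (pts j (i - 1) N))"
    using V_P[of N j "i - 1"] by (simp add: W_def mult.assoc)
  also have "\<dots> = int_power V (- i + 1) * P N (pts j (i - 1) N)"
    by (simp only: int_power_Suc[OF V_unitary(1)] mult.assoc)
  finally show ?thesis by (simp add: W_def)
qed

lemma W_star_V: "W N j i * star V = W N j (i + 1)"
proof -
  have "W N j i * star V = W N j (i + 1) * (V * star V)"
    using W_V[of N j "i + 1"] by (simp add: mult.assoc[symmetric])
  then show ?thesis by (simp add: V_unitary)
qed

text \<open>A function of level \<open>N\<close> is constant on the residue class to which
  \<open>P\<close> projects, so it acts there as a scalar.\<close>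

lemma W_M:
  assumes f: "padic_level p N f"
  shows "W N j i * M f = f (pts j i) *\<^sub>C W N j i"
proof -
  have ind: "indicator_fun N (pts j i N) \<in> C" by (rule indicator_fun_continuous)
  have "P N (pts j i N) * M f = M (\<lambda>x. indicator_fun N (pts j i N) x * f x)"
    unfolding P_def by (rule M_simps(5)[symmetric, OF indicator_fun_continuous padic_level_continuous[OF f]])
  also have "\<dots> = M (\<lambda>x. f (pts j i) * indicator_fun N (pts j i N) x)"
  proof (rule M_simps(3))
    show "(\<lambda>x. indicator_fun N (pts j i N) x * f x) \<in> C"
      by (rule padic_continuous_algebra(5)[OF ind padic_level_continuous[OF f]])
    show "(\<lambda>x. f (pts j i) * indicator_fun N (pts j i N) x) \<in> C"
      by (rule padic_continuous_algebra(2)[OF ind])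
    fix x assume x: "x \<in> carrier (padic_integers p)"
    have "x N = pts j i N \<Longrightarrow> f x = f (pts j i)"
      using f x pts_carrier[of j i] unfolding padic_level_def by blast
    then show "indicator_fun N (pts j i N) x * f x = f (pts j i) * indicator_fun N (pts j i N) x"
      by (cases "x N = pts j i N") (simp_all add: indicator_fun_def)
  qed
  also have "\<dots> = f (pts j i) *\<^sub>C P N (pts j i N)"
    unfolding P_def by (rule M_simps(7)[OF indicator_fun_continuous])
  finally show ?thesis by (simp add: W_def mult.assoc)
qed

end


section \<open>Transference\<close>

lemma has_sum_finite_sum:
  fixes f :: "'a \<Rightarrow> 'c \<Rightarrow> real"
  assumes "finite A" "\<And>i. i \<in> A \<Longrightarrow> (f i has_sum s i) UNIV"
  shows "((\<lambda>c. \<Sum>i\<in>A. f i c) has_sum (\<Sum>i\<in>A. s i)) UNIV"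
  using assms by (induction A rule: finite_induct) (auto intro: has_sum_add has_sum_0)

lemma sum_single:
  assumes "finite F" "k \<in> F"
  shows "(\<Sum>l\<in>F. (if l = k then 1 else 0) * f l) = (f k :: complex)"
    and "(\<Sum>l\<in>F. (if l = k then 1 else 0) *\<^sub>C T l) = (T k :: 'i cop)"
proof -
  have "(\<Sum>l\<in>F. (if l = k then 1 else 0) *\<^sub>C T l) = (\<Sum>l\<in>F. if l = k then T l else 0)"
    by (intro sum.cong) auto
  then show "(\<Sum>l\<in>F. (if l = k then 1 else 0) *\<^sub>C T l) = T k"
    using assms by simp
qed (use assms in \<open>simp add: mult_delta_left\<close>)

lemma sum_infsum_swap_le:
  fixes f g :: "'a \<Rightarrow> 'c \<Rightarrow> real"
  assumes "finite A" "finite B"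
    and f: "\<And>i. i \<in> A \<Longrightarrow> f i summable_on UNIV" and g: "\<And>i. i \<in> B \<Longrightarrow> g i summable_on UNIV"
    and le: "\<And>c. (\<Sum>i\<in>A. f i c) \<le> K * (\<Sum>i\<in>B. g i c)"
  shows "(\<Sum>i\<in>A. infsum (f i) UNIV) \<le> K * (\<Sum>i\<in>B. infsum (g i) UNIV)"
proof (rule has_sum_mono)
  show "((\<lambda>c. \<Sum>i\<in>A. f i c) has_sum (\<Sum>i\<in>A. infsum (f i) UNIV)) UNIV"
    using assms(1) f by (intro has_sum_finite_sum) auto
  show "((\<lambda>c. K * (\<Sum>i\<in>B. g i c)) has_sum (K * (\<Sum>i\<in>B. infsum (g i) UNIV))) UNIV"
    using assms(2) g by (intro has_sum_cmult_right has_sum_finite_sum) auto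
qed (rule le)

lemma sum_int_interval: "(\<Sum>i\<in>{m..<m + int L}. g i) = (\<Sum>t<L. g (m + int t))"
  by (rule sum.reindex_bij_witness[of _ "\<lambda>t. m + int t" "\<lambda>i. nat (i - m)"]) auto

context orbit_system
begin

definition orbit_pair :: "nat \<Rightarrow> covariant_pair"
  where "orbit_pair j = (\<lambda>f. diag (\<lambda>k. f (pts j k)), shift)"

lemma bounded_on_orbit: "f \<in> padic_continuous p \<Longrightarrow> \<exists>B. \<forall>k. cmod (f (pts j k)) \<le> B"
  using padic_continuous_bounded pts_carrier by blast

lemma orbit_pair_covariant: "orbit_pair j \<in> covariant_pairs p r"
proof -
  have "shift * diag (\<lambda>k. f (pts j k)) * star shift = diag (\<lambda>k. f (pts j (k - 1)))"
    if f: "f \<in> padic_continuous p" for f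
  proof -
    obtain B where B: "\<And>k. cmod (f (pts j k)) \<le> B" using bounded_on_orbit[OF f] by blast
    show ?thesis
      by (rule diag_eqI[symmetric])
         (simp add: star_shift_basis diag_basis[where a = "\<lambda>k. f (pts j k)", OF B] shift_basis)
  qed
  moreover have "diag (\<lambda>k. f (pts j k) + g (pts j k)) = diag (\<lambda>k. f (pts j k)) + diag (\<lambda>k. g (pts j k))"
    "diag (\<lambda>k. f (pts j k) * g (pts j k)) = diag (\<lambda>k. f (pts j k)) * diag (\<lambda>k. g (pts j k))"
    "diag (\<lambda>k. c * f (pts j k)) = c *\<^sub>C diag (\<lambda>k. f (pts j k))"
    "diag (\<lambda>k. cnj (f (pts j k))) = star (diag (\<lambda>k. f (pts j k)))"
    if fg: "f \<in> padic_continuous p" "g \<in> padic_continuous p" for f g c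
  proof -
    obtain A B where A: "\<And>k. cmod (f (pts j k)) \<le> A" and B: "\<And>k. cmod (g (pts j k)) \<le> B"
      using bounded_on_orbit[OF fg(1)] bounded_on_orbit[OF fg(2)] by blast
    show "diag (\<lambda>k. f (pts j k) + g (pts j k)) = diag (\<lambda>k. f (pts j k)) + diag (\<lambda>k. g (pts j k))"
      by (rule diag_add[where a = "\<lambda>k. f (pts j k)" and b = "\<lambda>k. g (pts j k)", OF A B])
    show "diag (\<lambda>k. f (pts j k) * g (pts j k)) = diag (\<lambda>k. f (pts j k)) * diag (\<lambda>k. g (pts j k))"
      by (rule diag_mult[where a = "\<lambda>k. f (pts j k)" and b = "\<lambda>k. g (pts j k)", OF A B])
    show "diag (\<lambda>k. c * f (pts j k)) = c *\<^sub>C diag (\<lambda>k. f (pts j k))"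
      by (rule diag_scaleC[where a = "\<lambda>k. f (pts j k)" and b = "\<lambda>k. g (pts j k)", OF A B])
    show "diag (\<lambda>k. cnj (f (pts j k))) = star (diag (\<lambda>k. f (pts j k)))"
      by (rule diag_cnj[where a = "\<lambda>k. f (pts j k)" and b = "\<lambda>k. g (pts j k)", OF A B])
  qed
  moreover have "diag (\<lambda>k. f (pts j k)) = diag (\<lambda>k. g (pts j k))"
    if "\<forall>x\<in>carrier (padic_integers p). f x = g x" for f g
    using that pts_carrier by simp
  ultimately show ?thesis
    by (simp add: covariant_pairs_def padic_function_rep_def orbit_pair_def shift_unitary
        diag_const padic_dilation_def pts_step)
qed

lemma covariant_representationI: "(M, V) \<in> covariant_pairs p r \<Longrightarrow> covariant_representation p r S pts M V"
  by (intro covariant_representation.intro covariant_representation_axioms.intro orbit_system_axioms)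

section \<open>Elements of finite width and their matrices\<close>

definition window :: "nat \<Rightarrow> int \<Rightarrow> int set"
  where "window n i = {i - int n..i + int n}"

lemma finite_window [simp]: "finite (window n i)"
  by (simp add: window_def)

text \<open>
  The matrix \<open>X\<close> of \<open>x\<close> in the representation \<open>orbit_pair j\<close> has finite width, and in every other
  representation its rows describe the action of \<open>x\<close> from the right on the operators \<open>W N j i\<close>.
\<close>

definition orbit_matrix ::
  "nat \<Rightarrow> nat \<Rightarrow> nat \<Rightarrow> (covariant_pair \<Rightarrow> int cop) \<Rightarrow> (int \<Rightarrow> int \<Rightarrow> complex) \<Rightarrow> bool"
  where "orbit_matrix n N j x X \<longleftrightarrow> (\<forall>i l. l \<notin> window n i \<longrightarrow> X i l = 0)
    \<and> (\<forall>i u. coord (cop_apply (x (orbit_pair j)) u) i = (\<Sum>l\<in>window n i. X i l * coord u l))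
    \<and> (\<forall>M V i. (M, V) \<in> covariant_pairs p r \<longrightarrow>
        covariant_representation.W pts M V N j i * x (M, V)
          = (\<Sum>l\<in>window n i. X i l *\<^sub>C covariant_representation.W pts M V N j l))"

text \<open>Rows vanish outside their window, so any finite set containing it may carry the sums.
  This gives rows of different widths a common range.\<close>

lemma orbit_matrixD:
  assumes "orbit_matrix n N j x X" "finite F" "window n i \<subseteq> F"
  shows "coord (cop_apply (x (orbit_pair j)) u) i = (\<Sum>l\<in>F. X i l * coord u l)"
    and "(M, V) \<in> covariant_pairs p r \<Longrightarrow> covariant_representation.W pts M V N j i * x (M, V)
      = (\<Sum>l\<in>F. X i l *\<^sub>C covariant_representation.W pts M V N j l)"
    and "l \<notin> window n i \<Longrightarrow> X i l = 0"
proof -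
  have "(\<Sum>l\<in>F. X i l * coord u l) = (\<Sum>l\<in>window n i. X i l * coord u l)"
    using assms by (intro sum.mono_neutral_right) (auto simp: orbit_matrix_def)
  moreover have "(\<Sum>l\<in>F. X i l *\<^sub>C covariant_representation.W pts M V N j l)
      = (\<Sum>l\<in>window n i. X i l *\<^sub>C covariant_representation.W pts M V N j l)"
    using assms by (intro sum.mono_neutral_right) (auto simp: orbit_matrix_def)
  ultimately show "coord (cop_apply (x (orbit_pair j)) u) i = (\<Sum>l\<in>F. X i l * coord u l)"
    "(M, V) \<in> covariant_pairs p r \<Longrightarrow> covariant_representation.W pts M V N j i * x (M, V)
      = (\<Sum>l\<in>F. X i l *\<^sub>C covariant_representation.W pts M V N j l)"
    using assms(1) by (simp_all add: orbit_matrix_def)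
  show "l \<notin> window n i \<Longrightarrow> X i l = 0"
    using assms(1) by (simp add: orbit_matrix_def)
qed

lemma orbit_matrix_add:
  assumes X: "orbit_matrix n N j x X" and Y: "orbit_matrix m N j y Y"
  shows "orbit_matrix (n + m) N j (x + y) (\<lambda>i l. X i l + Y i l)"
proof -
  have sub: "window n i \<subseteq> window (n + m) i" "window m i \<subseteq> window (n + m) i" for i
    by (auto simp: window_def)
  note D = orbit_matrixD[OF X finite_window sub(1)] orbit_matrixD[OF Y finite_window sub(2)]
  show ?thesis
    unfolding orbit_matrix_def
  proof (intro conjI allI impI)
    fix i l assume "l \<notin> window (n + m) i"
    then have "l \<notin> window n i" "l \<notin> window m i" using sub[of i] by auto
    then show "X i l + Y i l = 0" by (simp add: D)
  qed (simp_all add: family_simps D distrib_left distrib_right sum.distrib scaleC_add_left_cop)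
qed

lemma orbit_matrix_scaleC:
  assumes X: "orbit_matrix n N j x X"
  shows "orbit_matrix n N j (c *\<^sub>C x) (\<lambda>i l. c * X i l)"
  using X unfolding orbit_matrix_def
  by (simp add: family_simps sum_distrib_left mult.assoc scaleC_sum_right_cop)

lemma orbit_matrix_mult:
  assumes X: "orbit_matrix n N j x X" and Y: "orbit_matrix m N j y Y"
  shows "orbit_matrix (n + m) N j (x * y) (\<lambda>i l. \<Sum>k\<in>window n i. X i k * Y k l)"
proof -
  have sub: "window m k \<subseteq> window (n + m) i" if "k \<in> window n i" for k i
    using that by (auto simp: window_def)
  note DX = orbit_matrixD[OF X finite_window order.refl]
    and DY = orbit_matrixD[OF Y finite_window sub]
  show ?thesis
    unfolding orbit_matrix_def
  proof (intro conjI allI impI)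
    show "(\<Sum>k\<in>window n i. X i k * Y k l) = 0" if "l \<notin> window (n + m) i" for i l
      using DY(3) that sub by (intro sum.neutral ballI) (metis mult_zero_right orbit_matrixD(3)[OF Y finite_window order.refl] subsetD)
    show "coord (cop_apply ((x * y) (orbit_pair j)) u) i
        = (\<Sum>l\<in>window (n + m) i. (\<Sum>k\<in>window n i. X i k * Y k l) * coord u l)" for i u
    proof -
      have "coord (cop_apply ((x * y) (orbit_pair j)) u) i
          = (\<Sum>k\<in>window n i. X i k * (\<Sum>l\<in>window (n + m) i. Y k l * coord u l))"
        unfolding family_simps cop_apply_simps DX(1) by (intro sum.cong refl) (simp add: DY(1))
      also have "\<dots> = (\<Sum>l\<in>window (n + m) i. \<Sum>k\<in>window n i. X i k * (Y k l * coord u l))"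
        unfolding sum_distrib_left by (rule sum.swap)
      finally show ?thesis by (simp only: sum_distrib_right mult.assoc)
    qed
    fix M V i assume MV: "(M, V) \<in> covariant_pairs p r"
    let ?W = "covariant_representation.W pts M V N j"
    have "?W i * (x * y) (M, V) = (\<Sum>k\<in>window n i. X i k *\<^sub>C (?W k * y (M, V)))"
      unfolding family_simps mult.assoc[symmetric] DX(2)[OF MV] by (simp add: sum_distrib_right)
    also have "\<dots> = (\<Sum>k\<in>window n i. X i k *\<^sub>C (\<Sum>l\<in>window (n + m) i. Y k l *\<^sub>C ?W l))"
      by (intro sum.cong refl) (simp add: DY(2)[OF _ MV])
    also have "\<dots> = (\<Sum>l\<in>window (n + m) i. \<Sum>k\<in>window n i. X i k *\<^sub>C Y k l *\<^sub>C ?W l)"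
      unfolding scaleC_sum_right_cop by (rule sum.swap)
    finally show "?W i * (x * y) (M, V) = (\<Sum>l\<in>window (n + m) i. (\<Sum>k\<in>window n i. X i k * Y k l) *\<^sub>C ?W l)"
      by (simp add: scaleC_sum_left_cop)
  qed
qed

lemma orbit_matrix_zero: "orbit_matrix 0 N j 0 (\<lambda>_ _. 0)"
  by (simp add: orbit_matrix_def family_simps)

lemma orbit_matrixI:
  assumes "\<And>i l. l \<notin> window n i \<Longrightarrow> X i l = 0"
    and "\<And>i u. coord (cop_apply (x (orbit_pair j)) u) i = (\<Sum>l\<in>window n i. X i l * coord u l)"
    and "\<And>M V i. (M, V) \<in> covariant_pairs p r \<Longrightarrow> covariant_representation.W pts M V N j i * x (M, V)
      = (\<Sum>l\<in>window n i. X i l *\<^sub>C covariant_representation.W pts M V N j l)"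
  shows "orbit_matrix n N j x X"
  unfolding orbit_matrix_def by (intro conjI allI impI assms)

lemma universal_orbit_pair:
  "universal_V p r (orbit_pair j) = shift"
  "universal_M p r f (orbit_pair j) = diag (\<lambda>k. f (pts j k))"
  using orbit_pair_covariant[of j]
  by (simp_all only: universal_V_def universal_M_def if_True) (simp_all add: orbit_pair_def)

lemma orbit_matrix_V: "orbit_matrix 1 N j (universal_V p r) (\<lambda>i l. if l = i - 1 then 1 else 0)"
proof -
  have win: "i - 1 \<in> window 1 i" for i by (simp add: window_def)
  show ?thesis
  proof (rule orbit_matrixI)
    show "(if l = i - 1 then 1 else 0) = (0 :: complex)" if "l \<notin> window 1 i" for i l
      using that win[of i] by auto
    show "coord (cop_apply (universal_V p r (orbit_pair j)) u) i
        = (\<Sum>l\<in>window 1 i. (if l = i - 1 then 1 else 0) * coord u l)" for i u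
      by (simp only: universal_orbit_pair coord_shift sum_single[OF finite_window win])
    fix M V i assume MV: "(M, V) \<in> covariant_pairs p r"
    show "covariant_representation.W pts M V N j i * universal_V p r (M, V)
        = (\<Sum>l\<in>window 1 i. (if l = i - 1 then 1 else 0) *\<^sub>C covariant_representation.W pts M V N j l)"
      unfolding sum_single[OF finite_window win]
      using covariant_representation.W_V[OF covariant_representationI[OF MV], of N j i] MV
      by (simp add: universal_V_def)
  qed
qed

lemma orbit_matrix_star_V: "orbit_matrix 1 N j (star (universal_V p r)) (\<lambda>i l. if l = i + 1 then 1 else 0)"
proof -
  have win: "i + 1 \<in> window 1 i" for i by (simp add: window_def)
  show ?thesis
  proof (rule orbit_matrixI)
    show "(if l = i + 1 then 1 else 0) = (0 :: complex)" if "l \<notin> window 1 i" for i l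
      using that win[of i] by auto
    show "coord (cop_apply (star (universal_V p r) (orbit_pair j)) u) i
        = (\<Sum>l\<in>window 1 i. (if l = i + 1 then 1 else 0) * coord u l)" for i u
      by (simp only: star_fun_def universal_orbit_pair coord_star_shift sum_single[OF finite_window win])
    fix M V i assume MV: "(M, V) \<in> covariant_pairs p r"
    show "covariant_representation.W pts M V N j i * star (universal_V p r) (M, V)
        = (\<Sum>l\<in>window 1 i. (if l = i + 1 then 1 else 0) *\<^sub>C covariant_representation.W pts M V N j l)"
      unfolding sum_single[OF finite_window win]
      using covariant_representation.W_star_V[OF covariant_representationI[OF MV], of N j i] MV
      by (simp add: universal_V_def star_fun_def)
  qed
qed

lemma orbit_matrix_M:
  assumes f: "padic_level p N f"
  shows "orbit_matrix 0 N j (universal_M p r f) (\<lambda>i l. if l = i then f (pts j i) else 0)"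
proof -
  obtain B where B: "\<And>k. cmod (f (pts j k)) \<le> B"
    using bounded_on_orbit[OF padic_level_continuous[OF f]] by blast
  have win: "window 0 i = {i}" for i by (auto simp: window_def)
  show ?thesis
  proof (rule orbit_matrixI)
    show "(if l = i then f (pts j i) else 0) = 0" if "l \<notin> window 0 i" for i l
      using that by (simp add: win)
    show "coord (cop_apply (universal_M p r f (orbit_pair j)) u) i
        = (\<Sum>l\<in>window 0 i. (if l = i then f (pts j i) else 0) * coord u l)" for i u
      unfolding universal_orbit_pair coord_diag[where a = "\<lambda>k. f (pts j k)", OF B] win by simp
    fix M V i assume MV: "(M, V) \<in> covariant_pairs p r"
    show "covariant_representation.W pts M V N j i * universal_M p r f (M, V)
        = (\<Sum>l\<in>window 0 i. (if l = i then f (pts j i) else 0) *\<^sub>C covariant_representation.W pts M V N j l)"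
      using covariant_representation.W_M[OF covariant_representationI[OF MV] f, of j i] MV
      by (simp add: universal_M_def win)
  qed
qed

text \<open>The width \<open>n\<close> and the level bound must not depend on \<open>j\<close>,
  because the estimate below uses points of several orbits at one level. Allowing all
  \<open>N\<close> beyond the bound gives sums and products a common level.\<close>

definition banded :: "(covariant_pair \<Rightarrow> int cop) \<Rightarrow> bool"
  where "banded x \<longleftrightarrow> (\<forall>\<rho>. \<rho> \<notin> covariant_pairs p r \<longrightarrow> x \<rho> = 0)
    \<and> (\<exists>n N\<^sub>0. \<forall>N\<ge>N\<^sub>0. \<forall>j. \<exists>X. orbit_matrix n N j x X)"

lemma bandedI:
  assumes "\<And>\<rho>. \<rho> \<notin> covariant_pairs p r \<Longrightarrow> x \<rho> = 0"
    and "\<And>N j. N\<^sub>0 \<le> N \<Longrightarrow> \<exists>X. orbit_matrix n N j x X"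
  shows "banded x"
  unfolding banded_def
proof (intro conjI allI impI)
  show "x \<rho> = 0" if "\<rho> \<notin> covariant_pairs p r" for \<rho>
    using that by (rule assms(1))
  have "\<forall>N\<ge>N\<^sub>0. \<forall>j. \<exists>X. orbit_matrix n N j x X"
    using assms(2) by iprover
  then show "\<exists>n N\<^sub>0. \<forall>N\<ge>N\<^sub>0. \<forall>j. \<exists>X. orbit_matrix n N j x X"
    by iprover
qed

lemma
  assumes x: "banded x"
  shows banded_scaleC: "banded (c *\<^sub>C x)"
    and banded_add: "banded y \<Longrightarrow> banded (x + y)"
    and banded_mult: "banded y \<Longrightarrow> banded (x * y)"
proof -
  obtain n N where "\<forall>M\<ge>N. \<forall>j. \<exists>X. orbit_matrix n M j x X"
    using x unfolding banded_def by blast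
  then have X: "\<exists>X. orbit_matrix n M j x X" if "M \<ge> N" for M j
    using that by blast
  have x0: "x \<rho> = 0" if "\<rho> \<notin> covariant_pairs p r" for \<rho>
    using x that unfolding banded_def by blast
  show "banded (c *\<^sub>C x)"
  proof (rule bandedI[of _ N n])
    show "\<exists>Z. orbit_matrix n M j (c *\<^sub>C x) Z" if M: "M \<ge> N" for M j
    proof -
      obtain A where A: "orbit_matrix n M j x A" using X[OF M] by blast
      show ?thesis by (rule exI, rule orbit_matrix_scaleC[OF A])
    qed
  qed (simp add: family_simps x0)
  assume y: "banded y"
  obtain m N' where "\<forall>M\<ge>N'. \<forall>j. \<exists>Y. orbit_matrix m M j y Y"
    using y unfolding banded_def by blast
  then have Y: "\<exists>Y. orbit_matrix m M j y Y" if "M \<ge> N'" for M j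
    using that by blast
  have y0: "y \<rho> = 0" if "\<rho> \<notin> covariant_pairs p r" for \<rho>
    using y that unfolding banded_def by blast
  show "banded (x + y)"
  proof (rule bandedI[of _ "max N N'" "n + m"])
    show "\<exists>Z. orbit_matrix (n + m) M j (x + y) Z" if M: "M \<ge> max N N'" for M j
    proof -
      obtain A where A: "orbit_matrix n M j x A" using X[of M j] M by auto
      obtain B where B: "orbit_matrix m M j y B" using Y[of M j] M by auto
      show ?thesis by (rule exI, rule orbit_matrix_add[OF A B])
    qed
  qed (simp add: family_simps x0 y0)
  show "banded (x * y)"
  proof (rule bandedI[of _ "max N N'" "n + m"])
    show "\<exists>Z. orbit_matrix (n + m) M j (x * y) Z" if M: "M \<ge> max N N'" for M j
    proof -
      obtain A where A: "orbit_matrix n M j x A" using X[of M j] M by auto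
      obtain B where B: "orbit_matrix m M j y B" using Y[of M j] M by auto
      show ?thesis by (rule exI, rule orbit_matrix_mult[OF A B])
    qed
  qed (simp add: family_simps x0 y0)
qed

lemma banded_zero: "banded 0"
proof (rule bandedI)
  show "\<exists>X. orbit_matrix 0 N j 0 X" for N j
    by (rule exI, rule orbit_matrix_zero)
qed (simp add: zero_fun_def)

lemma banded_generators:
  shows "banded (universal_V p r)" "banded (star (universal_V p r))"
    and "padic_level p N f \<Longrightarrow> banded (universal_M p r f)"
proof -
  show "banded (universal_V p r)"
  proof (rule bandedI)
    show "\<exists>X. orbit_matrix 1 N j (universal_V p r) X" for N j
      by (rule exI, rule orbit_matrix_V)
  qed (simp add: universal_V_def)
  show "banded (star (universal_V p r))"
  proof (rule bandedI)
    show "\<exists>X. orbit_matrix 1 N j (star (universal_V p r)) X" for N j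
      by (rule exI, rule orbit_matrix_star_V)
  qed (simp add: universal_V_def star_fun_def)
  assume f: "padic_level p N f"
  show "banded (universal_M p r f)"
  proof (rule bandedI)
    show "\<exists>X. orbit_matrix 0 M j (universal_M p r f) X" if "N \<le> M" for M j
      by (rule exI, rule orbit_matrix_M[OF padic_level_mono[OF f that]])
  qed (simp add: universal_M_def)
qed

text \<open>The rows describe multiplication from the right only, so \<open>banded\<close> is not
  visibly stable under adjoints; both \<open>x\<close> and \<open>star x\<close> are therefore
  required to be banded.\<close>

lemma star_subalgebra_banded: "star_subalgebra {x. banded x \<and> banded (star x)}"
proof -
  have "star (0 :: covariant_pair \<Rightarrow> int cop) = 0" "star (star x) = x"
    "star (x + y) = star x + star y" "star (x * y) = star y * star x" "star (c *\<^sub>C x) = cnj c *\<^sub>C star x"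
    for x y :: "covariant_pair \<Rightarrow> int cop" and c
    by (auto simp: family_simps star_cop_simps)
  then show ?thesis
    by (auto simp: star_subalgebra_def banded_zero banded_add banded_mult banded_scaleC)
qed

text \<open>
  The transference argument: on a window of length \<open>L + 2 * n\<close> the vectors \<open>W N j i \<xi>\<close>
  form, coordinate by coordinate, an element of the space of \<open>orbit_pair j\<close>, and letting \<open>L\<close> grow
  makes the boundary effects negligible.
\<close>

lemma norm_window_le:
  assumes X: "orbit_matrix n N j x X" and MV: "(M, V) \<in> covariant_pairs p r"
    and B: "norm (x (orbit_pair j)) \<le> B"
  defines "w i \<xi> \<equiv> norm (cop_apply (covariant_representation.W pts M V N j i) \<xi>)"
  shows "(\<Sum>t<L. (w (m + int n + int t) (cop_apply (x (M, V)) \<xi>))\<^sup>2)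
    \<le> B\<^sup>2 * (\<Sum>t<L + 2 * n. (w (m + int t) \<xi>)\<^sup>2)"
proof -
  let ?W = "covariant_representation.W pts M V N j" and ?T = "x (orbit_pair j)"
  \<comment> \<open>\<open>J\<close> exceeds \<open>I\<close> by \<open>n\<close> on both sides, so
    rows with index in \<open>I\<close> involve only indices in \<open>J\<close>.\<close>
  define I where "I = {m + int n..<m + int n + int L}"
  define J where "J = {m..<m + int (L + 2 * n)}"
  have sub: "window n i \<subseteq> J" if "i \<in> I" for i
    using that by (auto simp: window_def I_def J_def)
  have fin: "finite I" "finite J" by (auto simp: I_def J_def)
  have "(\<Sum>i\<in>I. (cmod (coord (cop_apply (?W i) (cop_apply (x (M, V)) \<xi>)) c))\<^sup>2)
      \<le> B\<^sup>2 * (\<Sum>i\<in>J. (cmod (coord (cop_apply (?W i) \<xi>) c))\<^sup>2)" for c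
  proof -
    define a where "a i = coord (cop_apply (?W i) \<xi>) c" for i
    \<comment> \<open>For a fixed coordinate \<open>c\<close>, the numbers \<open>a i\<close> on
      \<open>J\<close> form a vector of the space of \<open>orbit_pair j\<close>, on which
      \<open>?T\<close> acts through the same matrix. Summing over \<open>c\<close> later turns
      entries into norms.\<close>
    define u where "u = (\<Sum>i\<in>J. a i *\<^sub>C basis_vec i)"
    have u: "coord u k = (if k \<in> J then a k else 0)" for k
      using fin by (simp add: u_def coord_sum basis_vec.rep_eq if_distrib cong: if_cong)
    have "coord (cop_apply (?W i) (cop_apply (x (M, V)) \<xi>)) c = coord (cop_apply ?T u) i" if i: "i \<in> I" for i
    proof -
      have "coord (cop_apply (?W i * x (M, V)) \<xi>) c = (\<Sum>l\<in>J. X i l * a l)"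
        unfolding orbit_matrixD(2)[OF X fin(2) sub[OF i] MV]
        by (simp add: cop_apply_sum coord_sum a_def)
      also have "\<dots> = coord (cop_apply ?T u) i"
        unfolding orbit_matrixD(1)[OF X fin(2) sub[OF i]] by (simp add: u)
      finally show ?thesis by simp
    qed
    then have "(\<Sum>i\<in>I. (cmod (coord (cop_apply (?W i) (cop_apply (x (M, V)) \<xi>)) c))\<^sup>2)
        = (\<Sum>i\<in>I. (cmod (coord (cop_apply ?T u) i))\<^sup>2)" by simp
    also have "\<dots> \<le> (norm (cop_apply ?T u))\<^sup>2"
      unfolding norm_ell2_square by (rule finite_sum_le_infsum[OF summable_coord fin(1)]) auto
    also have "\<dots> \<le> (B * norm u)\<^sup>2"
      by (intro power_mono order_trans[OF norm_cop_apply] mult_right_mono B) auto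
    also have "\<dots> = B\<^sup>2 * (norm u)\<^sup>2" by (simp add: power_mult_distrib)
    also have "(norm u)\<^sup>2 = (\<Sum>\<^sub>\<infinity>k\<in>J. (cmod (a k))\<^sup>2)"
      unfolding norm_ell2_square by (rule infsum_cong_neutral) (auto simp: u)
    also have "\<dots> = (\<Sum>k\<in>J. (cmod (a k))\<^sup>2)" using fin by simp
    finally show ?thesis by (simp only: a_def)
  qed
  then have "(\<Sum>i\<in>I. (w i (cop_apply (x (M, V)) \<xi>))\<^sup>2) \<le> B\<^sup>2 * (\<Sum>i\<in>J. (w i \<xi>)\<^sup>2)"
    unfolding w_def norm_ell2_square
    by (intro sum_infsum_swap_le fin summable_coord)
  then show ?thesis unfolding I_def J_def sum_int_interval .
qed

text \<open>Add the window estimates over one orbit point per residue mod \<open>p ^ N\<close>. The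
  projections of one position sum to 1, so this compares \<open>L\<close> copies of the squared norm
  of the image vector with \<open>L + 2 * n\<close> copies of that of the vector.\<close>

lemma norm_banded_le:
  assumes x: "banded x" and B: "\<And>j. norm (x (orbit_pair j)) \<le> B"
  shows "norm (x \<rho>) \<le> B"
proof (cases "\<rho> \<in> covariant_pairs p r")
  case False
  have "0 \<le> B" using order_trans[OF norm_ge_zero B] .
  moreover have "x \<rho> = 0" using x False unfolding banded_def by blast
  ultimately show ?thesis by simp
next
  case True
  obtain M V where \<rho>: "\<rho> = (M, V)" by (cases \<rho>)
  have MV: "(M, V) \<in> covariant_pairs p r" using True \<rho> by simp
  interpret covariant_representation p r S pts M V by (rule covariant_representationI[OF MV])
  obtain n N where X: "\<forall>j. \<exists>X. orbit_matrix n N j x X"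
    using x unfolding banded_def by blast
  let ?A = "{0..<int p ^ N}"
  \<comment> \<open>Every residue, that of 0 included, is taken by an orbit point;
    \<open>j a\<close> and \<open>k a\<close> fix one choice.\<close>
  have "\<exists>j k. pts j k N = a" if "a \<in> ?A" for a
    using pts_dense[OF padic_of_int_carrier[OF p_pos, of a], of N] that by (simp add: padic_of_int_def)
  then obtain j k where jk: "\<And>a. a \<in> ?A \<Longrightarrow> pts (j a) (k a) N = a" by metis
  have iso: "star (star V) * star V = 1" by (simp add: V_unitary)
  \<comment> \<open>After moving all chosen points by the same \<open>i\<close>, their projections
    still form a complete system, so the sum does not depend on \<open>i\<close>.\<close>
  have total: "(\<Sum>a\<in>?A. (norm (cop_apply (W N (j a) (k a + int i)) \<eta>))\<^sup>2) = (norm \<eta>)\<^sup>2" for i \<eta>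
  proof -
    have "(\<Sum>a\<in>?A. (norm (cop_apply (W N (j a) (k a + int i)) \<eta>))\<^sup>2)
        = (\<Sum>a\<in>?A. (norm (cop_apply (P N a) (cop_apply (star V ^ i) \<eta>)))\<^sup>2)"
      by (intro sum.cong refl) (simp add: norm_W norm_P_translate jk)
    also have "\<dots> = (norm (cop_apply (star V ^ i) \<eta>))\<^sup>2" by (rule sum_norm_P)
    finally show ?thesis by (simp add: norm_isometry_power[OF iso])
  qed
  have B0: "0 \<le> B" using order_trans[OF norm_ge_zero B] .
  have "norm (cop_apply (x (M, V)) \<xi>) \<le> B * norm \<xi>" for \<xi>
  proof -
    let ?y = "cop_apply (x (M, V)) \<xi>"
    have L: "real L * (norm ?y)\<^sup>2 \<le> (real L + 2 * real n) * (B\<^sup>2 * (norm \<xi>)\<^sup>2)" for L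
    proof -
      have "real L * (norm ?y)\<^sup>2 = (\<Sum>t<L. \<Sum>a\<in>?A. (norm (cop_apply (W N (j a) (k a + int (n + t))) ?y))\<^sup>2)"
        by (simp only: total) simp
      also have "\<dots> = (\<Sum>a\<in>?A. \<Sum>t<L. (norm (cop_apply (W N (j a) (k a + int n + int t)) ?y))\<^sup>2)"
        by (subst sum.swap) (simp add: add.assoc)
      also have "\<dots> \<le> (\<Sum>a\<in>?A. B\<^sup>2 * (\<Sum>t<L + 2 * n. (norm (cop_apply (W N (j a) (k a + int t)) \<xi>))\<^sup>2))"
      proof (rule sum_mono)
        fix a
        obtain Y where Y: "orbit_matrix n N (j a) x Y" using X by blast
        show "(\<Sum>t<L. (norm (cop_apply (W N (j a) (k a + int n + int t)) ?y))\<^sup>2)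
            \<le> B\<^sup>2 * (\<Sum>t<L + 2 * n. (norm (cop_apply (W N (j a) (k a + int t)) \<xi>))\<^sup>2)"
          by (rule norm_window_le[OF Y MV B])
      qed
      also have "\<dots> = B\<^sup>2 * (\<Sum>t<L + 2 * n. \<Sum>a\<in>?A. (norm (cop_apply (W N (j a) (k a + int t)) \<xi>))\<^sup>2)"
        by (subst sum.swap) (simp add: sum_distrib_left)
      also have "\<dots> = (real L + 2 * real n) * (B\<^sup>2 * (norm \<xi>)\<^sup>2)"
        by (simp add: total)
      finally show ?thesis .
    qed
    have "(norm ?y)\<^sup>2 \<le> B\<^sup>2 * (norm \<xi>)\<^sup>2"
    \<comment> \<open>The factor \<open>(L + 2 * n) / L\<close> tends to 1, so a strict violation
      would contradict the inequality for large \<open>L\<close>.\<close>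
    proof (rule ccontr)
      assume "\<not> (norm ?y)\<^sup>2 \<le> B\<^sup>2 * (norm \<xi>)\<^sup>2"
      then have "0 < (norm ?y)\<^sup>2 - B\<^sup>2 * (norm \<xi>)\<^sup>2" by simp
      from reals_Archimedean3[OF this] obtain L :: nat
        where "2 * real n * (B\<^sup>2 * (norm \<xi>)\<^sup>2) < real L * ((norm ?y)\<^sup>2 - B\<^sup>2 * (norm \<xi>)\<^sup>2)"
        by blast
      with L[of L] show False by (simp add: algebra_simps)
    qed
    then have "(norm ?y)\<^sup>2 \<le> (B * norm \<xi>)\<^sup>2" by (simp add: power_mult_distrib)
    then show ?thesis using B0 by (simp add: power2_le_iff_abs_le)
  qed
  then show ?thesis unfolding \<rho> by (intro cop_norm_leI B0)
qed

end


section \<open>The crossed product and its kernel ideal\<close>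

text \<open>As \<open>T\<close> tends to 0 in norm, the direct sum is the norm limit of its finite
  truncations. Serves both inclusions in \<open>image_orbit_sum\<close>.\<close>

lemma dir_sum_in_star_subalgebra:
  fixes T :: "nat \<Rightarrow> 'i cop"
  assumes F: "star_subalgebra F" "closed F" and T: "T \<longlonglongrightarrow> 0"
    and in_F: "\<And>j. dir_sum (\<lambda>i. if i = j then T j else 0) \<in> F"
  shows "dir_sum T \<in> F"
proof -
  obtain K where K: "\<And>j. norm (T j) \<le> K"
    using convergent_imp_Bseq[OF convergentI[OF T]] unfolding Bseq_def by blast
  have K0: "0 \<le> K" using order_trans[OF norm_ge_zero K] .
  have part_bound: "norm (if i < n then T i else 0) \<le> K" for i n using K K0 by simp
  have part: "dir_sum (\<lambda>i. if i < n then T i else 0) \<in> F" for n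
  proof (induction n)
    case 0
    have "dir_sum (\<lambda>i :: nat. 0 :: 'i cop) = dir_sum (\<lambda>i. 0 *\<^sub>C T i)" by simp
    also have "\<dots> = 0" by (subst dir_sum_scaleC[OF K]) simp
    finally show ?case using star_subalgebraD(1)[OF F(1)] by simp
  next
    case (Suc n)
    have b: "norm (if i = n then T n else 0) \<le> K" for i using K K0 by simp
    have "(\<lambda>i. if i < Suc n then T i else 0) = (\<lambda>i. (if i < n then T i else 0) + (if i = n then T n else 0))"
      by (auto simp: less_Suc_eq)
    then have "dir_sum (\<lambda>i. if i < Suc n then T i else 0)
        = dir_sum (\<lambda>i. if i < n then T i else 0) + dir_sum (\<lambda>i. if i = n then T n else 0)"
      using dir_sum_add[of "\<lambda>i. if i < n then T i else 0" K "\<lambda>i. if i = n then T n else 0" K, OF part_bound b] by simp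
    then show ?case using star_subalgebraD(2)[OF F(1) Suc in_F] by simp
  qed
  have "(\<lambda>n. dir_sum (\<lambda>i. if i < n then T i else 0)) \<longlonglongrightarrow> dir_sum T"
  proof (rule metric_LIMSEQ_I)
    fix e :: real assume e: "0 < e"
    then obtain n where n: "\<And>i. i \<ge> n \<Longrightarrow> norm (T i) < e / 2"
      using LIMSEQ_D[OF T, of "e / 2"] by auto
    have "dist (dir_sum (\<lambda>i. if i < m then T i else 0)) (dir_sum T) < e" if m: "m \<ge> n" for m
    proof -
      have "norm ((if i < m then T i else 0) - T i) \<le> e / 2" for i
        using n[of i] m e by (cases "i < m") (auto intro: less_imp_le)
      then have "norm (dir_sum (\<lambda>i. (if i < m then T i else 0) - T i)) \<le> e / 2"
        by (rule norm_dir_sum_le)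
      then show ?thesis
        using e dir_sum_diff[of "\<lambda>i. if i < m then T i else 0" K T K, OF part_bound K] by (simp add: dist_norm)
    qed
    then show "\<exists>n. \<forall>m\<ge>n. dist (dir_sum (\<lambda>i. if i < m then T i else 0)) (dir_sum T) < e" by blast
  qed
  then show ?thesis
    by (rule closed_sequentially[OF F(2) part])
qed

lemma c0_algebraD:
  assumes "A \<in> c0_algebra"
  shows "\<exists>a B. a \<longlonglongrightarrow> 0 \<and> (\<forall>k. cmod (a k) \<le> B)
    \<and> (\<forall>k. cop_apply A (basis_vec k) = a k *\<^sub>C basis_vec k)"
proof -
  obtain a where a: "a \<longlonglongrightarrow> 0" "\<forall>k. cop_apply A (basis_vec k) = a k *\<^sub>C basis_vec k"
    using assms unfolding c0_algebra_def by blast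
  moreover obtain B where "\<forall>k. cmod (a k) \<le> B"
    using convergent_imp_Bseq[OF convergentI[OF a(1)]] unfolding Bseq_def by blast
  ultimately show ?thesis by blast
qed

text \<open>The projection to the \<open>j\<close>-th basis vector is multiplication by a null
  sequence, so a single summand is an elementary tensor.\<close>

lemma ex_coordinate_projection:
  "\<exists>A\<in>c0_algebra. \<forall>b :: 'i cop. tensor_op A b = dir_sum (\<lambda>i. if i = j then b else 0)"
proof -
  define a :: "nat \<Rightarrow> complex" where "a i = (if i = j then 1 else 0)" for i
  have a1: "cmod (a i) \<le> 1" for i by (simp add: a_def)
  have "(\<lambda>i. a i) \<longlonglongrightarrow> 0"
    by (rule tendsto_eventually) (auto simp: a_def eventually_sequentially intro!: exI[of _ "Suc j"])
  then have "diag a \<in> c0_algebra"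
    unfolding c0_algebra_def using diag_basis[of a, OF a1] by blast
  moreover have "tensor_op (diag a) b = dir_sum (\<lambda>i. if i = j then b else 0)" for b :: "'i cop"
  proof -
    have "(\<lambda>i. a i *\<^sub>C b) = (\<lambda>i. if i = j then b else 0)" by (auto simp: a_def)
    then show ?thesis
      using dir_sum_tensor_op[of "diag a" a 1 b, OF diag_basis[of a, OF a1] a1] by simp
  qed
  ultimately show ?thesis by blast
qed

context orbit_system
begin

abbreviation "A\<^sub>r \<equiv> crossed_product p r"

lemmas star_subalgebra_crossed =
  star_subalgebra_cstar_generated_family[where G = "insert (universal_V p r) (universal_M p r ` padic_continuous p)",
    folded crossed_product_def]

lemmas uniformly_closed_crossed =
  uniformly_closed_cstar_generated_family[where G = "insert (universal_V p r) (universal_M p r ` padic_continuous p)",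
    folded crossed_product_def]

lemma crossed_generators: "universal_V p r \<in> A\<^sub>r" "f \<in> padic_continuous p \<Longrightarrow> universal_M p r f \<in> A\<^sub>r"
  using cstar_generated_family_superset[of "insert (universal_V p r) (universal_M p r ` padic_continuous p)"]
  by (auto simp: crossed_product_def)

lemma crossed_induct:
  assumes "star_subalgebra B" "uniformly_closed B" "universal_V p r \<in> B"
    and "\<And>f. f \<in> padic_continuous p \<Longrightarrow> universal_M p r f \<in> B"
  shows "A\<^sub>r \<subseteq> B"
  unfolding crossed_product_def using assms by (intro cstar_generated_family_least) auto

lemma crossed_diff: "x \<in> A\<^sub>r \<Longrightarrow> y \<in> A\<^sub>r \<Longrightarrow> (\<lambda>\<rho>. x \<rho> - y \<rho>) \<in> A\<^sub>r"
proof -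
  assume x: "x \<in> A\<^sub>r" and y: "y \<in> A\<^sub>r"
  have "x + (- 1) *\<^sub>C y = (\<lambda>\<rho>. x \<rho> - y \<rho>)"
    by (auto simp: family_simps scaleC_minus_one_cop)
  then show ?thesis
    using star_subalgebraD(2)[OF star_subalgebra_crossed x star_subalgebraD(5)[OF star_subalgebra_crossed y, of "- 1"]]
    by simp
qed

text \<open>In each covariant pair \<open>norm_M_le\<close> bounds the image of the difference, so
  uniform approximation of functions is uniform over all pairs.\<close>

lemma universal_M_approx:
  assumes f: "f \<in> padic_continuous p" and g: "g \<in> padic_continuous p"
    and le: "\<And>x. x \<in> carrier (padic_integers p) \<Longrightarrow> cmod (f x - g x) \<le> e"
    and e: "0 \<le> e"
  shows "norm (universal_M p r f \<rho> - universal_M p r g \<rho>) \<le> e"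
proof (cases "\<rho> \<in> covariant_pairs p r")
  case True
  obtain M V where \<rho>: "\<rho> = (M, V)" by (cases \<rho>)
  interpret covariant_representation p r S pts M V
    by (rule covariant_representationI) (use True \<rho> in simp)
  have "norm (M (\<lambda>x. f x - g x)) \<le> e"
    by (rule norm_M_le[OF padic_continuous_algebra(4)[OF f g] le])
  then show ?thesis using True by (simp add: \<rho> universal_M_def M_diff[OF f g])
qed (simp add: universal_M_def e)

lemma universal_bounded:
  "norm (universal_V p r \<rho>) \<le> 1"
  "f \<in> padic_continuous p \<Longrightarrow> \<exists>K. \<forall>\<rho>. norm (universal_M p r f \<rho>) \<le> K"
proof -
  show "norm (universal_V p r \<rho>) \<le> 1"
  proof (cases "\<rho> \<in> covariant_pairs p r")
    case True
    then have "star (snd \<rho>) * snd \<rho> = 1"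
      using covariant_pairsD(2)[of "fst \<rho>" "snd \<rho>"] by simp
    then have "norm (snd \<rho>) \<le> 1"
      by (intro cop_norm_leI) (simp_all add: norm_isometry)
    with True show ?thesis by (simp add: universal_V_def)
  qed (simp add: universal_V_def)
  assume f: "f \<in> padic_continuous p"
  obtain K where K: "\<And>x. x \<in> carrier (padic_integers p) \<Longrightarrow> cmod (f x) \<le> K"
    using padic_continuous_bounded[OF f] by blast
  have "universal_M p r (\<lambda>_. 0) \<rho> = 0" for \<rho>
  proof (cases "\<rho> \<in> covariant_pairs p r")
    case True
    then show ?thesis
      using covariant_representation.M_const[OF covariant_representationI, of "fst \<rho>" "snd \<rho>" 0]
      by (simp add: universal_M_def)
  qed (simp add: universal_M_def)
  then have "norm (universal_M p r f \<rho>) \<le> max K 0" for \<rho>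
    using universal_M_approx[OF f padic_continuous_const, of 0 "max K 0" \<rho>] K
    by (simp add: le_max_iff_disj)
  then show "\<exists>K. \<forall>\<rho>. norm (universal_M p r f \<rho>) \<le> K" by blast
qed

text \<open>Generators coming from continuous functions are uniform limits of those of finite level,
  which are banded.\<close>

lemma crossed_subset_closure: "A\<^sub>r \<subseteq> uniform_closure {x. banded x \<and> banded (star x)}"
proof (rule crossed_induct[OF star_subalgebra_uniform_closure[OF star_subalgebra_banded] uniformly_closed_uniform_closure])
  have "\<exists>y\<in>{x. banded x \<and> banded (star x)}. \<forall>\<rho>. norm (universal_V p r \<rho> - y \<rho>) \<le> e" if "0 < e" for e
    using banded_generators(1,2) that by (intro bexI[of _ "universal_V p r"]) auto
  moreover have "\<exists>K. \<forall>\<rho>. norm (universal_V p r \<rho>) \<le> K"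
    using universal_bounded(1) by blast
  ultimately show "universal_V p r \<in> uniform_closure {x. banded x \<and> banded (star x)}"
    by (simp add: uniform_closure_def)
  fix f assume f: "f \<in> padic_continuous p"
  have "\<exists>y\<in>{x. banded x \<and> banded (star x)}. \<forall>\<rho>. norm (universal_M p r f \<rho> - y \<rho>) \<le> e" if e: "0 < e" for e
  proof -
    obtain N g where g: "padic_level p N g" "\<And>x. x \<in> carrier (padic_integers p) \<Longrightarrow> cmod (f x - g x) < e"
      using padic_level_approx[OF p_pos f e] by blast
    have "padic_level p N (\<lambda>x. cnj (g x))"
      using g(1) unfolding padic_level_def by metis
    moreover have "star (universal_M p r g) = universal_M p r (\<lambda>x. cnj (g x))"
      using covariant_pairsD(6)[OF _ padic_level_continuous[OF g(1)]]
      by (auto simp: fun_eq_iff star_fun_def universal_M_def)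
    ultimately have "banded (star (universal_M p r g))"
      using banded_generators(3) by simp
    moreover have "norm (universal_M p r f \<rho> - universal_M p r g \<rho>) \<le> e" for \<rho>
      using g(2) e by (intro universal_M_approx f padic_level_continuous[OF g(1)]) (auto intro: less_imp_le)
    ultimately show ?thesis using banded_generators(3)[OF g(1)] by blast
  qed
  then show "universal_M p r f \<in> uniform_closure {x. banded x \<and> banded (star x)}"
    using universal_bounded(2)[OF f] by (simp add: uniform_closure_def)
qed

lemma crossed_bounded: "x \<in> A\<^sub>r \<Longrightarrow> \<exists>K. \<forall>\<rho>. norm (x \<rho>) \<le> K"
  using crossed_subset_closure unfolding uniform_closure_def by blast

text \<open>The transference bound passes from banded elements to their uniform limits; it expresses
  that the orbit representations together are isometric.\<close>

lemma norm_crossed_le: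
  assumes x: "x \<in> A\<^sub>r" and B: "\<And>j. norm (x (orbit_pair j)) \<le> B"
  shows "norm (x \<rho>) \<le> B"
proof (rule field_le_epsilon)
  fix e :: real assume e: "0 < e"
  have "x \<in> uniform_closure {x. banded x \<and> banded (star x)}" "0 < e / 2"
    using x crossed_subset_closure e by auto
  then obtain y where y: "banded y" "\<And>\<rho>. norm (x \<rho> - y \<rho>) \<le> e / 2"
    unfolding uniform_closure_def by blast
  have "norm (y (orbit_pair j)) \<le> B + e / 2" for j
    using norm_triangle_ineq4[of "x (orbit_pair j)" "x (orbit_pair j) - y (orbit_pair j)"]
      y(2)[of "orbit_pair j"] B[of j] by simp
  from norm_banded_le[OF y(1) this] have "norm (y \<rho>) \<le> B + e / 2" .
  then show "norm (x \<rho>) \<le> B + e"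
    using norm_triangle_ineq[of "x \<rho> - y \<rho>" "y \<rho>"] y(2)[of \<rho>] by simp
qed

text \<open>By \<open>pts_period\<close> a function of finite level gives a diagonal whose period
  divides \<open>S\<close>; closedness covers the other functions.\<close>

lemma crossed_orbit_pair_bunce_deddens:
  assumes "x \<in> A\<^sub>r"
  shows "x (orbit_pair j) \<in> bunce_deddens S"
proof -
  let ?BD = "bunce_deddens S"
  have BD: "star_subalgebra ?BD" "closed ?BD"
    unfolding bunce_deddens_def by (rule star_subalgebra_cstar_generated closed_cstar_generated)+
  have gen: "shift \<in> ?BD"
    "\<And>T a l. 0 < l \<Longrightarrow> supernatural_of_nat l \<le> S \<Longrightarrow> (\<And>k. a (k + int l) = a k) \<Longrightarrow>
      (\<And>k. cop_apply T (basis_vec k) = a k *\<^sub>C basis_vec k) \<Longrightarrow> T \<in> ?BD"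
    unfolding bunce_deddens_def by (rule subsetD[OF cstar_generated_superset]; blast)+
  have "A\<^sub>r \<subseteq> {x. x (orbit_pair j) \<in> ?BD}"
  proof (rule crossed_induct)
    show "star_subalgebra {x. x (orbit_pair j) \<in> ?BD}"
      unfolding star_subalgebra_def by (auto simp: family_simps star_subalgebraD[OF BD(1)])
    show "uniformly_closed {x. x (orbit_pair j) \<in> ?BD}"
      unfolding uniformly_closed_def
    proof (intro allI impI, elim conjE)
      fix X :: "nat \<Rightarrow> covariant_pair \<Rightarrow> int cop" and x
      assume X: "\<forall>n. X n \<in> {x. x (orbit_pair j) \<in> ?BD}" and lim: "uniform_limit UNIV X x sequentially"
      have "X n (orbit_pair j) \<in> ?BD" for n using X by simp
      moreover have "(\<lambda>n. X n (orbit_pair j)) \<longlonglongrightarrow> x (orbit_pair j)"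
        by (rule tendsto_uniform_limitI[OF lim]) simp
      ultimately have "x (orbit_pair j) \<in> ?BD"
        by (rule closed_sequentially[OF BD(2), of "\<lambda>n. X n (orbit_pair j)"])
      then show "x \<in> {x. x (orbit_pair j) \<in> ?BD}" by simp
    qed
    show "universal_V p r \<in> {x. x (orbit_pair j) \<in> ?BD}"
      by (simp add: universal_orbit_pair gen(1))
    fix f assume f: "f \<in> padic_continuous p"
    have "\<exists>T\<in>?BD. dist T (diag (\<lambda>k. f (pts j k))) < e" if e: "0 < e" for e
    proof -
      obtain N g where g: "padic_level p N g" "\<And>x. x \<in> carrier (padic_integers p) \<Longrightarrow> cmod (f x - g x) < e / 2"
        using padic_level_approx[OF p_pos f, of "e / 2"] e by auto
      obtain B where B: "\<And>k. cmod (g (pts j k)) \<le> B"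
        using bounded_on_orbit[OF padic_level_continuous[OF g(1)]] by blast
      obtain l where l: "0 < l" "supernatural_of_nat l \<le> S" "\<And>k. pts j (k + int l) N = pts j k N"
        using pts_period[of N] by blast
      have "g (pts j (k + int l)) = g (pts j k)" for k
        using g(1) pts_carrier l(3)[of k] unfolding padic_level_def by blast
      then have "diag (\<lambda>k. g (pts j k)) \<in> ?BD"
        by (intro gen(2)[OF l(1,2), of "\<lambda>k. g (pts j k)"] diag_basis[where a = "\<lambda>k. g (pts j k)", OF B])
      moreover have "norm (universal_M p r f (orbit_pair j) - universal_M p r g (orbit_pair j)) \<le> e / 2"
        using g(2) e by (intro universal_M_approx f padic_level_continuous[OF g(1)]) (auto intro: less_imp_le)
      then have "dist (diag (\<lambda>k. g (pts j k))) (diag (\<lambda>k. f (pts j k))) < e"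
        using e by (simp add: universal_orbit_pair dist_norm norm_minus_commute)
      ultimately show ?thesis by blast
    qed
    then have "diag (\<lambda>k. f (pts j k)) \<in> closure ?BD"
      by (simp add: closure_approachable)
    then show "universal_M p r f \<in> {x. x (orbit_pair j) \<in> ?BD}"
      using BD(2) by (simp add: universal_orbit_pair)
  qed
  with assms show ?thesis by blast
qed

text \<open>By \<open>pts_null\<close> the orbits approach 0 uniformly in \<open>k\<close>, so the
  diagonals of a continuous function converge in norm to its value at 0, while \<open>V\<close> is
  the shift throughout. An e/3 argument closes the set of convergent elements under uniform
  limits.\<close>

lemma crossed_tendsto_zero_rep:
  assumes "x \<in> A\<^sub>r"
  shows "(\<lambda>j. x (orbit_pair j)) \<longlonglongrightarrow> x (zero_rep p)"
proof -
  let ?L = "{x :: covariant_pair \<Rightarrow> int cop. (\<lambda>j. x (orbit_pair j)) \<longlonglongrightarrow> x (zero_rep p)}"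
  have "A\<^sub>r \<subseteq> ?L"
  proof (rule crossed_induct)
    have star: "(\<lambda>j. star (T j)) \<longlonglongrightarrow> star L" and scale: "(\<lambda>j. c *\<^sub>C T j) \<longlonglongrightarrow> c *\<^sub>C L"
      if T: "T \<longlonglongrightarrow> L" for T :: "nat \<Rightarrow> int cop" and L c
    proof -
      have n: "(\<lambda>j. norm (T j - L)) \<longlonglongrightarrow> 0"
        using T by (simp add: LIM_zero tendsto_norm_zero)
      then have "(\<lambda>j. norm (star (T j) - star L)) \<longlonglongrightarrow> 0"
        by (simp add: star_cop_diff[symmetric])
      then show "(\<lambda>j. star (T j)) \<longlonglongrightarrow> star L"
        by (rule LIM_zero_cancel[OF tendsto_norm_zero_cancel])
      have "(\<lambda>j. norm (c *\<^sub>C T j - c *\<^sub>C L)) \<longlonglongrightarrow> 0"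
        using tendsto_mult_right_zero[OF n, of "cmod c"]
        by (simp add: scaleC_diff_right_cop[symmetric] norm_scaleC_cop)
      then show "(\<lambda>j. c *\<^sub>C T j) \<longlonglongrightarrow> c *\<^sub>C L"
        by (rule LIM_zero_cancel[OF tendsto_norm_zero_cancel])
    qed
    show "star_subalgebra ?L"
      unfolding star_subalgebra_def
      by (auto simp: family_simps intro!: tendsto_add tendsto_mult star scale)
    show "uniformly_closed ?L"
      unfolding uniformly_closed_def
    proof (intro allI impI, elim conjE)
      fix X :: "nat \<Rightarrow> covariant_pair \<Rightarrow> int cop" and x
      assume "\<forall>n. X n \<in> ?L"
      then have X: "\<And>n. (\<lambda>j. X n (orbit_pair j)) \<longlonglongrightarrow> X n (zero_rep p)" by simp
      assume lim: "uniform_limit UNIV X x sequentially"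
      have "(\<lambda>j. x (orbit_pair j)) \<longlonglongrightarrow> x (zero_rep p)"
      proof (rule metric_LIMSEQ_I)
        fix e :: real assume e: "0 < e"
        obtain n where n: "\<And>\<rho>. norm (x \<rho> - X n \<rho>) < e / 3"
          using uniform_limit_approx[OF lim, of "e / 3"] e by auto
        obtain J where J: "\<And>j. j \<ge> J \<Longrightarrow> dist (X n (orbit_pair j)) (X n (zero_rep p)) < e / 3"
          using metric_LIMSEQ_D[OF X[of n], of "e / 3"] e by auto
        have "dist (x (orbit_pair j)) (x (zero_rep p)) < e" if "j \<ge> J" for j
          using n[of "orbit_pair j"] n[of "zero_rep p"] J[OF that]
            dist_triangle[of "x (orbit_pair j)" "x (zero_rep p)" "X n (orbit_pair j)"]
            dist_triangle[of "X n (orbit_pair j)" "x (zero_rep p)" "X n (zero_rep p)"]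
          by (simp add: dist_norm norm_minus_commute)
        then show "\<exists>J. \<forall>j\<ge>J. dist (x (orbit_pair j)) (x (zero_rep p)) < e" by blast
      qed
      then show "x \<in> ?L" by simp
    qed
    show "universal_V p r \<in> ?L"
      using pi0_generators(1)[OF p_pos r_unit] by (simp add: universal_orbit_pair pi0_def)
    fix f assume f: "f \<in> padic_continuous p"
    let ?z = "f \<zero>\<^bsub>padic_integers p\<^esub>"
    have zero: "\<zero>\<^bsub>padic_integers p\<^esub> \<in> carrier (padic_integers p)"
      using p_pos by (simp add: padic_integers_def)
    have "(\<lambda>j. diag (\<lambda>k. f (pts j k))) \<longlonglongrightarrow> ?z *\<^sub>C 1"
    proof (rule metric_LIMSEQ_I)
      fix e :: real assume e: "0 < e"
      obtain N where N: "\<And>x y. x \<in> carrier (padic_integers p) \<Longrightarrow> y \<in> carrier (padic_integers p) \<Longrightarrow>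
          x N = y N \<Longrightarrow> cmod (f x - f y) < e / 2"
        using padic_uniformly_continuous[OF f, of "e / 2"] e by auto
      obtain J where J: "\<And>j k. j \<ge> J \<Longrightarrow> pts j k N = 0" using pts_null by blast
      have "dist (diag (\<lambda>k. f (pts j k))) (?z *\<^sub>C 1) < e" if j: "j \<ge> J" for j
      proof -
        obtain B where B: "\<And>k. cmod (f (pts j k)) \<le> B" using bounded_on_orbit[OF f] by blast
        have z: "cmod (- ?z) \<le> cmod ?z" by simp
        have "norm (diag (\<lambda>k. f (pts j k) + - ?z)) \<le> e / 2"
        proof (rule norm_diag_le)
          show "cmod (f (pts j k) + - ?z) \<le> e / 2" for k
            using N[OF pts_carrier zero, of j k] J[OF j, of k] by (simp add: padic_zero_level less_imp_le)
        qed
        moreover have "diag (\<lambda>k. f (pts j k) + - ?z) = diag (\<lambda>k. f (pts j k)) + diag (\<lambda>_. - ?z)"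
          by (rule diag_add[where a = "\<lambda>k. f (pts j k)" and b = "\<lambda>_. - ?z", OF B z])
        moreover have "diag (\<lambda>_ :: int. - ?z) = - (?z *\<^sub>C 1)"
          by (simp add: diag_const scaleC_minus_one_cop[symmetric])
        ultimately show ?thesis using e by (simp add: dist_norm)
      qed
      then show "\<exists>J. \<forall>j\<ge>J. dist (diag (\<lambda>k. f (pts j k))) (?z *\<^sub>C 1) < e" by blast
    qed
    then show "universal_M p r f \<in> ?L"
      using pi0_generators(2)[OF p_pos r_unit] by (simp add: universal_orbit_pair pi0_def)
  qed
  with assms show ?thesis by blast
qed

section \<open>The direct sum of the orbit representations and its image\<close>

definition orbit_sum :: "(covariant_pair \<Rightarrow> int cop) \<Rightarrow> (nat \<times> int) cop"
  where "orbit_sum x = dir_sum (\<lambda>j. x (orbit_pair j))"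

lemma
  assumes x: "x \<in> A\<^sub>r"
  shows orbit_sum_add: "y \<in> A\<^sub>r \<Longrightarrow> orbit_sum (x + y) = orbit_sum x + orbit_sum y"
    and orbit_sum_diff: "y \<in> A\<^sub>r \<Longrightarrow> orbit_sum (\<lambda>\<rho>. x \<rho> - y \<rho>) = orbit_sum x - orbit_sum y"
    and orbit_sum_mult: "y \<in> A\<^sub>r \<Longrightarrow> orbit_sum (x * y) = orbit_sum x * orbit_sum y"
    and orbit_sum_star: "orbit_sum (star x) = star (orbit_sum x)"
    and orbit_sum_scaleC: "orbit_sum (c *\<^sub>C x) = c *\<^sub>C orbit_sum x"
    and norm_le_norm_orbit_sum: "norm (x \<rho>) \<le> norm (orbit_sum x)"
proof -
  obtain K where K: "\<And>\<rho>. norm (x \<rho>) \<le> K" using crossed_bounded[OF x] by blast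
  show "orbit_sum (star x) = star (orbit_sum x)" "orbit_sum (c *\<^sub>C x) = c *\<^sub>C orbit_sum x"
    unfolding orbit_sum_def family_simps
    by (rule dir_sum_star[of "\<lambda>j. x (orbit_pair j)", OF K] dir_sum_scaleC[of "\<lambda>j. x (orbit_pair j)", OF K])+
  show "norm (x \<rho>) \<le> norm (orbit_sum x)"
    unfolding orbit_sum_def
    by (rule norm_crossed_le[OF x norm_le_norm_dir_sum[of "\<lambda>j. x (orbit_pair j)", OF K]])
  assume y: "y \<in> A\<^sub>r"
  obtain L where L: "\<And>\<rho>. norm (y \<rho>) \<le> L" using crossed_bounded[OF y] by blast
  show "orbit_sum (x + y) = orbit_sum x + orbit_sum y" "orbit_sum (x * y) = orbit_sum x * orbit_sum y"
    "orbit_sum (\<lambda>\<rho>. x \<rho> - y \<rho>) = orbit_sum x - orbit_sum y"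
    unfolding orbit_sum_def family_simps
    by (rule dir_sum_add[of "\<lambda>j. x (orbit_pair j)" K "\<lambda>j. y (orbit_pair j)", OF K L]
        dir_sum_mult[of "\<lambda>j. x (orbit_pair j)" K "\<lambda>j. y (orbit_pair j)", OF K L]
        dir_sum_diff[of "\<lambda>j. x (orbit_pair j)" K "\<lambda>j. y (orbit_pair j)", OF K L])+
qed

lemma inj_on_orbit_sum: "inj_on orbit_sum A\<^sub>r"
proof (rule inj_onI)
  fix x y assume x: "x \<in> A\<^sub>r" and y: "y \<in> A\<^sub>r" and eq: "orbit_sum x = orbit_sum y"
  have "norm (x \<rho> - y \<rho>) \<le> 0" for \<rho>
    using norm_le_norm_orbit_sum[OF crossed_diff[OF x y], of \<rho>] orbit_sum_diff[OF x y] eq by simp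
  then show "x = y" by (simp add: fun_eq_iff)
qed

text \<open>The norm limit along the orbits is the value under \<open>pi0\<close>, so by uniqueness
  of limits the kernel consists of the elements whose summands form a null sequence.\<close>

lemma kernel_iff: "x \<in> kernel_ideal p r \<longleftrightarrow> x \<in> A\<^sub>r \<and> (\<lambda>j. x (orbit_pair j)) \<longlonglongrightarrow> 0"
proof -
  have "x (zero_rep p) = 0 \<longleftrightarrow> (\<lambda>j. x (orbit_pair j)) \<longlonglongrightarrow> 0" if "x \<in> A\<^sub>r"
    using crossed_tendsto_zero_rep[OF that] by (metis LIMSEQ_unique)
  then show ?thesis by (auto simp: kernel_ideal_def pi0_def)
qed

lemma star_subalgebra_kernel: "star_subalgebra (kernel_ideal p r)"
  using star_subalgebraD[OF star_subalgebra_crossed]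
  by (simp add: star_subalgebra_def kernel_ideal_def pi0_def family_simps)

lemma star_subalgebra_image: "star_subalgebra (orbit_sum ` kernel_ideal p r)"
proof -
  let ?I = "kernel_ideal p r"
  note D = star_subalgebraD[OF star_subalgebra_kernel]
  have sub: "?I \<subseteq> A\<^sub>r" by (auto simp: kernel_ideal_def)
  have zero: "orbit_sum 0 = 0"
    using orbit_sum_diff[of 0 0] D(1) sub by (simp add: family_simps subsetD)
  show ?thesis
    unfolding star_subalgebra_def
  proof (intro conjI ballI allI)
    show "0 \<in> orbit_sum ` ?I" using zero D(1) by (metis imageI)
    fix X assume "X \<in> orbit_sum ` ?I"
    then obtain x where x: "x \<in> ?I" "X = orbit_sum x" by blast
    then have xA: "x \<in> A\<^sub>r" using sub by blast
    show "star X \<in> orbit_sum ` ?I"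
      unfolding x(2) orbit_sum_star[OF xA, symmetric] by (intro imageI D x)
    show "c *\<^sub>C X \<in> orbit_sum ` ?I" for c
      unfolding x(2) orbit_sum_scaleC[OF xA, symmetric] by (intro imageI D x)
    fix Y assume "Y \<in> orbit_sum ` ?I"
    then obtain y where y: "y \<in> ?I" "Y = orbit_sum y" by blast
    then have yA: "y \<in> A\<^sub>r" using sub by blast
    show "X + Y \<in> orbit_sum ` ?I"
      unfolding x(2) y(2) orbit_sum_add[OF xA yA, symmetric] by (intro imageI D x y)
    show "X * Y \<in> orbit_sum ` ?I"
      unfolding x(2) y(2) orbit_sum_mult[OF xA yA, symmetric] by (intro imageI D x y)
  qed
qed

text \<open>By isometry, a Cauchy sequence in the image comes from a uniformly Cauchy sequence of families.\<close>

lemma closed_image: "closed (orbit_sum ` kernel_ideal p r)"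
  unfolding closed_sequential_limits
proof (intro allI impI, elim conjE)
  fix Y :: "nat \<Rightarrow> (nat \<times> int) cop" and T
  assume "\<forall>n. Y n \<in> orbit_sum ` kernel_ideal p r" and lim: "Y \<longlonglongrightarrow> T"
  then have "\<forall>n. \<exists>x. x \<in> kernel_ideal p r \<and> Y n = orbit_sum x" by blast
  then obtain X where X: "\<And>n. X n \<in> kernel_ideal p r" "\<And>n. Y n = orbit_sum (X n)"
    using choice[of "\<lambda>n x. x \<in> kernel_ideal p r \<and> Y n = orbit_sum x"] by blast
  have XA: "X n \<in> A\<^sub>r" "X n (zero_rep p) = 0" for n
    using X(1)[of n] by (simp_all add: kernel_ideal_def pi0_def)
  have le: "dist (X m \<rho>) (X n \<rho>) \<le> dist (Y m) (Y n)" for m n \<rho>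
    using norm_le_norm_orbit_sum[OF crossed_diff[OF XA(1)[of m] XA(1)[of n]], of \<rho>]
    by (simp add: orbit_sum_diff[OF XA(1) XA(1)] X(2) dist_norm)
  have "Cauchy Y" using lim by (rule LIMSEQ_imp_Cauchy)
  have "uniformly_Cauchy_on UNIV X"
  proof (rule uniformly_Cauchy_onI)
    fix e :: real assume "0 < e"
    then obtain M where "\<forall>m\<ge>M. \<forall>n\<ge>M. dist (Y m) (Y n) < e"
      using metric_CauchyD[OF \<open>Cauchy Y\<close>] by blast
    then show "\<exists>M. \<forall>\<rho>\<in>UNIV. \<forall>m\<ge>M. \<forall>n\<ge>M. dist (X m \<rho>) (X n \<rho>) < e"
      using le by (meson le_less_trans)
  qed
  then obtain x where x: "uniform_limit UNIV X x sequentially"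
    using Cauchy_uniformly_convergent uniformly_convergent_on_def by blast
  have xA: "x \<in> A\<^sub>r"
    by (rule uniformly_closedD[OF uniformly_closed_crossed XA(1) x])
  have "(\<lambda>n. X n (zero_rep p)) \<longlonglongrightarrow> x (zero_rep p)"
    by (rule tendsto_uniform_limitI[OF x]) simp
  then have "x (zero_rep p) = 0"
    by (simp add: XA(2) LIMSEQ_const_iff)
  then have xI: "x \<in> kernel_ideal p r" using xA by (simp add: kernel_ideal_def pi0_def)
  have "Y \<longlonglongrightarrow> orbit_sum x"
  proof (rule metric_LIMSEQ_I)
    fix e :: real assume e: "0 < e"
    obtain N where N: "\<And>n \<rho>. n \<ge> N \<Longrightarrow> norm (x \<rho> - X n \<rho>) < e / 2"
      using uniform_limit_approx[OF x, of "e / 2"] e by auto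
    have "dist (Y n) (orbit_sum x) < e" if n: "n \<ge> N" for n
    proof -
      have "norm (orbit_sum (\<lambda>\<rho>. x \<rho> - X n \<rho>)) \<le> e / 2"
        unfolding orbit_sum_def by (rule norm_dir_sum_le) (rule less_imp_le[OF N[OF n]])
      then show ?thesis
        using e by (simp add: orbit_sum_diff[OF xA XA(1)] X(2) dist_norm norm_minus_commute)
    qed
    then show "\<exists>N. \<forall>n\<ge>N. dist (Y n) (orbit_sum x) < e" by blast
  qed
  then have "T = orbit_sum x" using lim LIMSEQ_unique by blast
  then show "T \<in> orbit_sum ` kernel_ideal p r" using xI by blast
qed

text \<open>
  Since the values \<open>pts i k N\<close> separate the orbit of \<open>j\<close> from the others and determine \<open>k\<close> modulo \<open>l\<close>
  on it, a function of level \<open>N\<close> realises any \<open>l\<close>-periodic sequence on the \<open>j\<close>-th orbit.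
\<close>

lemma ex_level_function:
  assumes l: "0 < l" "supernatural_of_nat l \<le> S" and a: "\<And>k. a (k + int l) = a k"
  shows "\<exists>f\<in>padic_continuous p. \<forall>i k. f (pts i k) = (if i = j then a k else 0)"
proof -
  obtain N where N: "\<And>i k k'. pts i k N = pts j k' N \<Longrightarrow> i = j \<and> int l dvd k - k'"
    using pts_separate[OF l, of j] by blast
  have per: "a (k + int l * int n) = a k" for k n
  proof (induction n)
    case (Suc n)
    have "a (k + int l * int (Suc n)) = a (k + int l * int n + int l)"
      by (simp add: algebra_simps)
    with Suc show ?case by (simp only: a)
  qed simp
  have a_eq: "a k = a k'" if "int l dvd k - k'" for k k'
  proof -
    obtain q where q: "k - k' = int l * q" using \<open>int l dvd k - k'\<close> by (rule dvdE)
    show ?thesis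
    proof (cases "0 \<le> q")
      case True
      then have "k = k' + int l * int (nat q)" using q by simp
      then show ?thesis by (metis per)
    next
      case False
      then have "k' = k + int l * int (nat (- q))" using q by simp
      then show ?thesis by (metis per)
    qed
  qed
  \<comment> \<open>The residue determines \<open>k\<close> only modulo \<open>l\<close>; by
    periodicity of \<open>a\<close> every choice gives the same value. Residues not met by the orbit
    \<open>j\<close> get 0.\<close>
  define f where "f x = (if \<exists>k. pts j k N = x N then a (SOME k. pts j k N = x N) else 0)" for x
  have "padic_level p N f" by (simp add: padic_level_def f_def)
  moreover have "f (pts i k) = (if i = j then a k else 0)" for i k
  proof (cases "i = j")
    case True
    define m where "m = (SOME m. pts j m N = pts j k N)"
    have "pts j m N = pts j k N" unfolding m_def by (rule someI[of _ k]) simp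
    then have "a m = a k" using N[of j m k] a_eq by blast
    moreover have "f (pts j k) = a m" by (auto simp: f_def m_def)
    ultimately show ?thesis using True by simp
  next
    case False
    then have "\<not> (\<exists>m. pts j m N = pts i k N)" using N[of i k] by metis
    then show ?thesis using False by (simp add: f_def)
  qed
  ultimately show ?thesis using padic_level_continuous by blast
qed

text \<open>Placing \<open>b\<close> in the \<open>j\<close>-th block is a contractive
  star-homomorphism and the image is a closed star-subalgebra, so it suffices to treat the
  generators of the Bunce-Deddens algebra.\<close>

lemma image_summands:
  assumes "b \<in> bunce_deddens S"
  shows "dir_sum (\<lambda>i. if i = j then b else 0) \<in> orbit_sum ` kernel_ideal p r"
proof -
  let ?F = "orbit_sum ` kernel_ideal p r"
  define \<delta> :: "int cop \<Rightarrow> (nat \<times> int) cop" where "\<delta> b = dir_sum (\<lambda>i. if i = j then b else 0)" for b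
  note F = star_subalgebraD[OF star_subalgebra_image]
  have bd: "norm (if i = j then b else (0 :: int cop)) \<le> norm b" for b and i :: nat by simp
  have hom: "\<delta> (b + c) = \<delta> b + \<delta> c" "\<delta> (b - c) = \<delta> b - \<delta> c" "\<delta> (b * c) = \<delta> b * \<delta> c"
    "\<delta> (star b) = star (\<delta> b)" "\<delta> (z *\<^sub>C b) = z *\<^sub>C \<delta> b" for b c z
  proof -
    show "\<delta> (b + c) = \<delta> b + \<delta> c" "\<delta> (b - c) = \<delta> b - \<delta> c" "\<delta> (b * c) = \<delta> b * \<delta> c"
      unfolding \<delta>_def dir_sum_add[OF bd bd, symmetric] dir_sum_diff[OF bd bd, symmetric]
        dir_sum_mult[OF bd bd, symmetric]
      by (auto intro!: arg_cong[where f = dir_sum])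
    show "\<delta> (star b) = star (\<delta> b)" "\<delta> (z *\<^sub>C b) = z *\<^sub>C \<delta> b"
      unfolding \<delta>_def dir_sum_star[OF bd, symmetric] dir_sum_scaleC[OF bd, symmetric]
      by (auto intro!: arg_cong[where f = dir_sum])
  qed
  have norm_\<delta>: "norm (\<delta> b) \<le> norm b" for b
    unfolding \<delta>_def by (rule norm_dir_sum_le[OF bd])
  have in_F: "\<delta> T \<in> ?F"
    if x: "x \<in> A\<^sub>r" and T: "\<And>i. x (orbit_pair i) = (if i = j then T else 0)" for x T
  proof -
    \<comment> \<open>Only the summand \<open>j\<close> is nonzero, so the sequence is eventually 0
      and \<open>kernel_iff\<close> applies.\<close>
    have "(\<lambda>i. x (orbit_pair i)) \<longlonglongrightarrow> 0"
      unfolding T by (rule tendsto_eventually, unfold eventually_sequentially) (rule exI[of _ "Suc j"], simp)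
    then have "x \<in> kernel_ideal p r" using x by (simp add: kernel_iff)
    moreover have "orbit_sum x = \<delta> T" by (simp add: orbit_sum_def \<delta>_def T)
    ultimately show ?thesis by (metis imageI)
  qed
  have diag_if: "diag (\<lambda>k. if i = j then a k else 0) = (if i = j then diag a else 0)" for i and a :: "int \<Rightarrow> complex"
    by (simp add: diag_const)
  have "bunce_deddens S \<subseteq> {b. \<delta> b \<in> ?F}"
    unfolding bunce_deddens_def
  proof (rule cstar_generated_least)
    have "\<delta> 0 = 0" using hom(2)[of 0 0] by simp
    then show "star_subalgebra {b. \<delta> b \<in> ?F}"
      using F unfolding star_subalgebra_def[of "{b. \<delta> b \<in> ?F}"] by (simp add: hom)
    have "isCont \<delta> b" for b
    proof -
      have "dist (\<delta> c) (\<delta> b) \<le> 1 * dist c b" for c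
        using norm_\<delta>[of "c - b"] by (simp add: hom dist_norm)
      then show ?thesis
        unfolding continuous_at_eps_delta by (metis le_less_trans mult_1)
    qed
    then have "continuous_on UNIV \<delta>" by (simp add: continuous_at_imp_continuous_on)
    then show "closed {b. \<delta> b \<in> ?F}"
      using closed_vimage[OF closed_image] by (simp add: vimage_def)
    \<comment> \<open>The constant 1 has period 1, which divides every \<open>S\<close>. The
      resulting \<open>f\<close> is 1 on the orbit \<open>j\<close> and 0 on the others, so it cuts
      \<open>V\<close> down to the shift in block \<open>j\<close>.\<close>
    have "supernatural_of_nat 1 \<le> S" by (simp add: supernatural_of_nat_def le_fun_def zero_enat_def[symmetric])
    then obtain f where f: "f \<in> padic_continuous p" "\<And>i k. f (pts i k) = (if i = j then 1 else 0)"
      using ex_level_function[of 1 "\<lambda>_. 1" j] by auto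
    have "\<delta> shift \<in> ?F"
    proof (rule in_F)
      show "universal_M p r f * universal_V p r \<in> A\<^sub>r"
        by (intro star_subalgebraD(3)[OF star_subalgebra_crossed] crossed_generators f)
      show "(universal_M p r f * universal_V p r) (orbit_pair i) = (if i = j then shift else 0)" for i
        by (simp add: times_fun_def universal_orbit_pair f(2) diag_if diag_const)
    qed
    moreover have "\<delta> T \<in> ?F"
      if l: "0 < l" "supernatural_of_nat l \<le> S" "\<And>k. a (k + int l) = a k"
        and T: "\<And>k. cop_apply T (basis_vec k) = a k *\<^sub>C basis_vec k" for T a l
    proof -
      obtain f where f: "f \<in> padic_continuous p" "\<And>i k. f (pts i k) = (if i = j then a k else 0)"
        using ex_level_function[of l a j] l by blast
      show ?thesis
      proof (rule in_F)
        show "universal_M p r f \<in> A\<^sub>r" by (rule crossed_generators(2)[OF f(1)])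
        show "universal_M p r f (orbit_pair i) = (if i = j then T else 0)" for i
          by (simp add: universal_orbit_pair f(2) diag_if diag_eqI[of T a, OF T])
      qed
    qed
    ultimately show "insert shift {T. \<exists>a. (\<exists>l>0. supernatural_of_nat l \<le> S \<and> (\<forall>k. a (k + int l) = a k)) \<and>
        (\<forall>k. cop_apply T (basis_vec k) = a k *\<^sub>C basis_vec k)} \<subseteq> {b. \<delta> b \<in> ?F}"
      by blast
  qed
  with assms show ?thesis unfolding \<delta>_def by blast
qed

text \<open>Summands of a kernel element lie in the Bunce-Deddens algebra and tend to 0, so it is a
  limit of finite sums of elementary tensors. Conversely, \<open>tensor_op A b\<close> has the
  summands \<open>a j *\<^sub>C b\<close>, which tend to 0 as well.\<close>

lemma image_orbit_sum: "orbit_sum ` kernel_ideal p r = cstar_tensor c0_algebra (bunce_deddens S)"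
proof
  let ?T = "cstar_tensor c0_algebra (bunce_deddens S)"
  show "orbit_sum ` kernel_ideal p r \<subseteq> ?T"
  proof
    fix X assume "X \<in> orbit_sum ` kernel_ideal p r"
    then obtain x where x: "x \<in> A\<^sub>r" "(\<lambda>j. x (orbit_pair j)) \<longlonglongrightarrow> 0" "X = orbit_sum x"
      using kernel_iff by blast
    have summands: "dir_sum (\<lambda>i. if i = j then x (orbit_pair j) else 0) \<in> ?T" for j
    proof -
      obtain A where A: "A \<in> c0_algebra"
        "tensor_op A (x (orbit_pair j)) = dir_sum (\<lambda>i. if i = j then x (orbit_pair j) else 0)"
        using ex_coordinate_projection[of j] by blast
      then show ?thesis
        using crossed_orbit_pair_bunce_deddens[OF x(1), of j]
        unfolding cstar_tensor_def by (intro subsetD[OF cstar_generated_superset]) force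
    qed
    have "star_subalgebra ?T" "closed ?T"
      unfolding cstar_tensor_def by (rule star_subalgebra_cstar_generated closed_cstar_generated)+
    then show "X \<in> ?T"
      unfolding x(3) orbit_sum_def by (rule dir_sum_in_star_subalgebra[OF _ _ x(2) summands])
  qed
  show "?T \<subseteq> orbit_sum ` kernel_ideal p r"
    unfolding cstar_tensor_def
  proof (rule cstar_generated_least[OF star_subalgebra_image closed_image], clarify)
    fix A b assume A: "A \<in> c0_algebra" and b: "b \<in> bunce_deddens S"
    obtain a B where a: "a \<longlonglongrightarrow> 0" "\<And>k. cmod (a k) \<le> B"
      "\<And>k. cop_apply A (basis_vec k) = a k *\<^sub>C basis_vec k"
      using c0_algebraD[OF A] by blast
    have "dir_sum (\<lambda>j. a j *\<^sub>C b) \<in> orbit_sum ` kernel_ideal p r"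
    proof (rule dir_sum_in_star_subalgebra[OF star_subalgebra_image closed_image])
      have "(\<lambda>j. norm (a j *\<^sub>C b)) \<longlonglongrightarrow> 0"
        using tendsto_mult_left_zero[OF tendsto_norm_zero[OF a(1)], of "norm b"] by (simp add: norm_scaleC_cop)
      then show "(\<lambda>j. a j *\<^sub>C b) \<longlonglongrightarrow> 0" by (rule tendsto_norm_zero_cancel)
      show "dir_sum (\<lambda>i. if i = j then a j *\<^sub>C b else 0) \<in> orbit_sum ` kernel_ideal p r" for j
        using b by (intro image_summands)
          (auto simp: bunce_deddens_def intro: star_subalgebraD(5)[OF star_subalgebra_cstar_generated])
    qed
    then show "tensor_op A b \<in> orbit_sum ` kernel_ideal p r"
      by (simp only: dir_sum_tensor_op[OF a(3,2)])
  qed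
qed

theorem kernel_ideal_isomorphic:
  "cstar_isomorphic (kernel_ideal p r) (cstar_tensor c0_algebra (bunce_deddens S))"
proof -
  have sub: "kernel_ideal p r \<subseteq> A\<^sub>r" by (auto simp: kernel_ideal_def)
  have "bij_betw orbit_sum (kernel_ideal p r) (cstar_tensor c0_algebra (bunce_deddens S))"
    unfolding bij_betw_def using inj_on_subset[OF inj_on_orbit_sum sub] image_orbit_sum by blast
  then show ?thesis
    unfolding cstar_isomorphic_def
    using orbit_sum_add orbit_sum_mult orbit_sum_star orbit_sum_scaleC sub
    by (intro exI[of _ orbit_sum]) (auto simp: subsetD)
qed

end

theorem proposition5p4:
  fixes p :: nat and r :: padic
  assumes "prime p" and "odd p"
    and "r \<in> Units (padic_integers p)"
    and "\<not> (\<exists>n :: nat. n > 0 \<and> r [^]\<^bsub>padic_integers p\<^esub> n = \<one>\<^bsub>padic_integers p\<^esub>)"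
  shows "cstar_isomorphic (kernel_ideal p r)
    (cstar_tensor c0_algebra (bunce_deddens (padic_ord p r)))"
proof -
  interpret padic_unit p r by (intro padic_unit.intro assms)
  obtain pts where "orbit_system p r (padic_ord p r) pts"
    using ex_orbit_system by blast
  then show ?thesis by (rule orbit_system.kernel_ideal_isomorphic)
qed

end
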